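(* Let $X_s=B_s+\sum_{i=1}^{N_s}\eta_i$ be a Brownian motion with random jumps as described in the context, and let $t>0$. For any constants $a\in\mathbb R$ and $b>0$, it holds $$\begin{aligned} &P\Big(\max_{0\le s<t}\{X_s-as-b\}<0\Big)=\sum_{k=0}^{\infty}P(N_t=k)\int_{\mathcal S_k^t}dF_k\Big(t_1,t_1+t_2,\ldots,\sum_{i=1}^k t_i\Big)\int_{\mathbb R^k}dG_k(h_1,\ldots,h_k)\\ &\quad\cdot\int_{-\infty}^{\beta_1}\cdots\int_{-\infty}^{\beta_k}\ \prod_{i=1}^k\Big(1-e^{-2b_i(at_i+b_i-x_i)/t_i}\Big)\\ &\quad\cdot\Big(\Phi\big(a\sqrt{t_{k+1}}+\tfrac{b_{k+1}}{\sqrt{t_{k+1}}}\big)-e^{-2ab_{k+1}}\Phi\big(a\sqrt{t_{k+1}}-\tfrac{b_{k+1}}{\sqrt{t_{k+1}}}\big)\Big)\,d\Phi_{t_1}(x_1)\cdots d\Phi_{t_k}(x_k), \end{aligned}$$ where $b_1=b$, $b_{i+1}=b_i+at_i-x_i-h_i$ for $i=1,\ldots,k$; $\beta_i=\min\{at_i+b_i,\ at_i+b_i-h_i\}$ for $i=1,\ldots,k$; $t_{k+1}=t-\sum_{i=1}^k t_i>0$; and $\Phi=\Phi_1$. Further, if $(N_s)$ is a Poisson process with rate $\lambda$ and the $\eta_i$ are i.i.d. with distribution $G$, then, with the same $b_i,\beta_i,t_{k+1}$, $$\begin{aligned} &P\Big(\max_{0\le s<t}\{X_s-as-b\}<0\Big)=\sum_{k=0}^{\infty}\lambda^k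 e^{-\lambda t}\int_0^t dt_1\int_0^{t-t_1}dt_2\cdots\int_0^{t-\sum_{i=1}^{k-1}t_i}dt_k\\ &\quad\cdot\int_{\mathbb R^k}dG(h_1)\cdots dG(h_k)\int_{-\infty}^{\beta_1}\cdots\int_{-\infty}^{\beta_k}\ \prod_{i=1}^k\Big(1-e^{-2b_i(at_i+b_i-x_i)/t_i}\Big)\\ &\quad\cdot\Big(\Phi\big(a\sqrt{t_{k+1}}+\tfrac{b_{k+1}}{\sqrt{t_{k+1}}}\big)-e^{-2ab_{k+1}}\Phi\big(a\sqrt{t_{k+1}}-\tfrac{b_{k+1}}{\sqrt{t_{k+1}}}\big)\Big)\,d\Phi_{t_1}(x_1)\cdots d\Phi_{t_k}(x_k). \end{aligned}$$
   Context: $(B_s)_{s\ge0}$ is a standard Brownian motion; $(N_s)_{s\ge0}$ is any integer-valued stochastic process starting with $N_0=0$ (for example a Poisson process with rate $\lambda$); $(\eta_i)_{i\ge1}$ is a family of real random variables representing jump sizes, not necessarily independent or identically distributed. $(B_s)$, $(N_s)$ and $(\eta_i)$ are mutually independent. The jump times are $\tau_1=\inf\{s>0: N_s\ne N_{s^-}\}$ and $\tau_k=\inf\{s>\tau_{k-1}: N_s\ne N_{s^-}\}$ for $k\ge2$, where $N_{s^-}=\lim_{r\to s^-}N_r$. For each $k\ge1$, $F_k(t_1,\ldots,t_k)$ is the joint distribution function of the jump times $(\tau_1,\ldots,\tau_k)$ and $G_k(h_1,\ldots,h_k)$ is the joint distribution function of the corresponding jump heights $(\eta_1,\ldots,\eta_k)$.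 For each $t>0$ the support of $F_k$ is $\mathcal S_k^t=\{(s_1,\ldots,s_k):0<s_1<\cdots<s_k<t\}$. $\Phi_s(x)=\frac1{\sqrt{2\pi s}}\int_{-\infty}^x e^{-y^2/(2s)}dy$ is the distribution function of $B_s$. For $k=0$ there are no integrals and the empty product is $1$.
   Formalization: N is assumed to be a counting process (right-continuous, jumps of size +1), since the formula fails for general integer-valued N (e.g. minus a Poisson process), and F_k is taken as the law of the jump times conditional on N_t=k, as the unconditional law contradicts the Poisson formula. *)

theory Defs
  imports "HOL-Probability.Probability"
begin

definition standard_brownian_motion :: "'a measure \<Rightarrow> (real \<Rightarrow> 'a \<Rightarrow> real) \<Rightarrow> bool" where
  "standard_brownian_motion M B \<longleftrightarrow>
     (\<forall>s\<ge>0. B s \<in> borel_measurable M) \<and>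
     (\<forall>\<omega>\<in>space M. B 0 \<omega> = 0) \<and>
     (\<forall>\<omega>\<in>space M. continuous_on {0..} (\<lambda>s. B s \<omega>)) \<and>
     (\<forall>s u. 0 \<le> s \<and> s < u \<longrightarrow>
        distributed M lborel (\<lambda>\<omega>. B u \<omega> - B s \<omega>) (normal_density 0 (sqrt (u - s)))) \<and>
     (\<forall>(n::nat) (p::nat \<Rightarrow> real). 0 \<le> p 0 \<and> mono p \<longrightarrow>
        prob_space.indep_vars M (\<lambda>_. borel) (\<lambda>i \<omega>. B (p (Suc i)) \<omega> - B (p i) \<omega>) {..<n})"

definition left_lim :: "(real \<Rightarrow> 'a \<Rightarrow> nat) \<Rightarrow> real \<Rightarrow> 'a \<Rightarrow> nat" where
  "left_lim N s \<omega> = Lim (at_left s) (\<lambda>r. N r \<omega>)"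

text \<open>
  A counting process: integer valued, starting at 0, right-continuous, with jumps of size one,
  so that the number of jump times in \<open>(0,s]\<close> is \<open>N s\<close> and the \<open>i\<close>-th jump time carries
  the \<open>i\<close>-th jump height. The left limits exist by monotonicity.
\<close>
definition counting_process :: "'a measure \<Rightarrow> (real \<Rightarrow> 'a \<Rightarrow> nat) \<Rightarrow> bool" where
  "counting_process M N \<longleftrightarrow>
     (\<forall>s\<ge>0. N s \<in> measurable M (count_space UNIV)) \<and>
     (\<forall>\<omega>\<in>space M. N 0 \<omega> = 0) \<and>
     (\<forall>\<omega>\<in>space M. mono_on {0..} (\<lambda>s. N s \<omega>)) \<and>
     (\<forall>\<omega>\<in>space M. \<forall>s\<ge>0. ((\<lambda>r. N r \<omega>) \<longlongrightarrow> N s \<omega>) (at_right s)) \<and>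
     (\<forall>\<omega>\<in>space M. \<forall>s>0. N s \<omega> = left_lim N s \<omega> \<or> N s \<omega> = left_lim N s \<omega> + 1)"

definition poisson_process :: "'a measure \<Rightarrow> real \<Rightarrow> (real \<Rightarrow> 'a \<Rightarrow> nat) \<Rightarrow> bool" where
  "poisson_process M l N \<longleftrightarrow>
     counting_process M N \<and>
     (\<forall>s u. 0 \<le> s \<and> s < u \<longrightarrow>
        distr M (count_space UNIV) (\<lambda>\<omega>. N u \<omega> - N s \<omega>) = measure_pmf (poisson_pmf (l * (u - s)))) \<and>
     (\<forall>(n::nat) (p::nat \<Rightarrow> real). 0 \<le> p 0 \<and> mono p \<longrightarrow>
        prob_space.indep_vars M (\<lambda>_. count_space UNIV)
          (\<lambda>i \<omega>. N (p (Suc i)) \<omega> - N (p i) \<omega>) {..<n})"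

text \<open>The \<open>\<sigma>\<close>-algebra generated by a family of random variables.\<close>
definition generated_events ::
    "'a measure \<Rightarrow> 'i set \<Rightarrow> ('i \<Rightarrow> 'a \<Rightarrow> 'b::topological_space) \<Rightarrow> 'a set set" where
  "generated_events M I X =
     sigma_sets (space M) {X i -` A \<inter> space M | i A. i \<in> I \<and> A \<in> sets borel}"

definition mutually_independent ::
    "'a measure \<Rightarrow> (real \<Rightarrow> 'a \<Rightarrow> real) \<Rightarrow> (real \<Rightarrow> 'a \<Rightarrow> nat) \<Rightarrow> (nat \<Rightarrow> 'a \<Rightarrow> real) \<Rightarrow> bool" where
  "mutually_independent M B N \<eta> \<longleftrightarrow>
     prob_space.indep_sets M
       (\<lambda>j. [generated_events M {0..} B, generated_events M {0..} N, generated_events M {1..} \<eta>] ! j)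
       {..<3}"

definition jump_bm ::
    "(real \<Rightarrow> 'a \<Rightarrow> real) \<Rightarrow> (real \<Rightarrow> 'a \<Rightarrow> nat) \<Rightarrow> (nat \<Rightarrow> 'a \<Rightarrow> real) \<Rightarrow> real \<Rightarrow> 'a \<Rightarrow> real" where
  "jump_bm B N \<eta> s \<omega> = B s \<omega> + (\<Sum>i = 1..N s \<omega>. \<eta> i \<omega>)"

text \<open>Extended reals, so that the infimum of the empty set is \<open>\<infinity>\<close>.\<close>
primrec jump_time :: "(real \<Rightarrow> 'a \<Rightarrow> nat) \<Rightarrow> nat \<Rightarrow> 'a \<Rightarrow> ereal" where
  "jump_time N 0 \<omega> = 0"
| "jump_time N (Suc k) \<omega> =
     Inf {ereal s | s. jump_time N k \<omega> < ereal s \<and> N s \<omega> \<noteq> left_lim N s \<omega>}"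

text \<open>
  The distribution of the first \<open>k\<close> jump times given \<open>N t = k\<close>; on this event they are all finite.
  If the event has probability 0, this is the zero measure.
\<close>
definition jump_times_law :: "'a measure \<Rightarrow> (real \<Rightarrow> 'a \<Rightarrow> nat) \<Rightarrow> real \<Rightarrow> nat \<Rightarrow> (nat \<Rightarrow> real) measure" where
  "jump_times_law M N t k =
     distr (uniform_measure M {\<omega> \<in> space M. N t \<omega> = k}) (Pi\<^sub>M {1..k} (\<lambda>_. borel))
       (\<lambda>\<omega>. \<lambda>i\<in>{1..k}. real_of_ereal (jump_time N i \<omega>))"

definition jump_heights_law :: "'a measure \<Rightarrow> (nat \<Rightarrow> 'a \<Rightarrow> real) \<Rightarrow> nat \<Rightarrow> (nat \<Rightarrow> real) measure" where
  "jump_heights_law M \<eta> k = distr M (Pi\<^sub>M {1..k} (\<lambda>_. borel)) (\<lambda>\<omega>. \<lambda>i\<in>{1..k}. \<eta> i \<omega>)"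

definition ordered_times :: "real \<Rightarrow> nat \<Rightarrow> (nat \<Rightarrow> real) set" where
  "ordered_times t k = {s. (\<forall>i\<in>{1..k}. 0 < s i \<and> s i < t) \<and> strict_mono_on {1..k} s}"

text \<open>The waiting times \<open>t\<^sub>i = s\<^sub>i - s\<^sub>i\<^sub>-\<^sub>1\<close> (with \<open>s\<^sub>0 = 0\<close>), i.e. \<open>s\<^sub>i = t\<^sub>1 + \<dots> + t\<^sub>i\<close>.\<close>
definition waiting_time :: "(nat \<Rightarrow> real) \<Rightarrow> nat \<Rightarrow> real" where
  "waiting_time s i = s i - (if i = 1 then 0 else s (i - 1))"

definition Phi :: "real \<Rightarrow> real \<Rightarrow> real" where
  "Phi s x = 1 / sqrt (2 * pi * s) * (LINT y:{..x}|lborel. exp (- y\<^sup>2 / (2 * s)))"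

text \<open>
  In the following the arguments \<open>u\<close>, \<open>h\<close>, \<open>x\<close> hold \<open>t\<^sub>i\<close>, \<open>h\<^sub>i\<close>, \<open>x\<^sub>i\<close> for \<open>i \<ge> 1\<close>;
  the values at index 0 play no role.
\<close>
fun barrier :: "real \<Rightarrow> real \<Rightarrow> (nat \<Rightarrow> real) \<Rightarrow> (nat \<Rightarrow> real) \<Rightarrow> (nat \<Rightarrow> real) \<Rightarrow> nat \<Rightarrow> real" where
  "barrier a b u h x 0 = b"
| "barrier a b u h x (Suc 0) = b"
| "barrier a b u h x (Suc (Suc i)) =
     barrier a b u h x (Suc i) + a * u (Suc i) - x (Suc i) - h (Suc i)"

definition upper_limit ::
    "real \<Rightarrow> real \<Rightarrow> (nat \<Rightarrow> real) \<Rightarrow> (nat \<Rightarrow> real) \<Rightarrow> (nat \<Rightarrow> real) \<Rightarrow> nat \<Rightarrow> real" where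
  "upper_limit a b u h x i =
     min (a * u i + barrier a b u h x i) (a * u i + barrier a b u h x i - h i)"

definition crossing_integrand ::
    "real \<Rightarrow> real \<Rightarrow> real \<Rightarrow> nat \<Rightarrow> (nat \<Rightarrow> real) \<Rightarrow> (nat \<Rightarrow> real) \<Rightarrow> (nat \<Rightarrow> real) \<Rightarrow> real" where
  "crossing_integrand a b t k u h x =
     (let \<beta> = barrier a b u h x; r = t - (\<Sum>i = 1..k. u i) in
       (\<Prod>i = 1..k. 1 - exp (- 2 * \<beta> i * (a * u i + \<beta> i - x i) / u i)) *
       (Phi 1 (a * sqrt r + \<beta> (k + 1) / sqrt r)
         - exp (- 2 * a * \<beta> (k + 1)) * Phi 1 (a * sqrt r - \<beta> (k + 1) / sqrt r)))"

text \<open>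
  \<open>iterated_integral \<mu> D f i n x\<close> is the \<open>n\<close>-fold iterated integral of \<open>f\<close> over the coordinates
  \<open>i, \<dots>, i + n - 1\<close> of \<open>x\<close>, coordinate \<open>i\<close> being outermost. The domain \<open>D j x\<close> of
  coordinate \<open>j\<close> may depend on the coordinates before \<open>j\<close>.
\<close>
primrec iterated_integral ::
    "(nat \<Rightarrow> real measure) \<Rightarrow> (nat \<Rightarrow> (nat \<Rightarrow> real) \<Rightarrow> real set) \<Rightarrow> ((nat \<Rightarrow> real) \<Rightarrow> real)
      \<Rightarrow> nat \<Rightarrow> nat \<Rightarrow> (nat \<Rightarrow> real) \<Rightarrow> real" where
  "iterated_integral \<mu> D f i 0 x = f x"
| "iterated_integral \<mu> D f i (Suc n) x =
     (LINT y:D i x|\<mu> i. iterated_integral \<mu> D f (Suc i) n (x(i := y)))"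

abbreviation iterated_integral_from_1 ::
    "nat \<Rightarrow> (nat \<Rightarrow> real measure) \<Rightarrow> (nat \<Rightarrow> (nat \<Rightarrow> real) \<Rightarrow> real set) \<Rightarrow> ((nat \<Rightarrow> real) \<Rightarrow> real) \<Rightarrow> real" where
  "iterated_integral_from_1 k \<mu> D f \<equiv> iterated_integral \<mu> D f 1 k (\<lambda>_. 0)"

text \<open>The integral over \<open>x\<^sub>1, \<dots>, x\<^sub>k\<close> with respect to the Stieltjes measures \<open>d\<Phi>\<close> with parameter \<open>t\<^sub>i\<close>.\<close>
definition gaussian_integral ::
    "real \<Rightarrow> real \<Rightarrow> real \<Rightarrow> nat \<Rightarrow> (nat \<Rightarrow> real) \<Rightarrow> (nat \<Rightarrow> real) \<Rightarrow> real" where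
  "gaussian_integral a b t k u h =
     iterated_integral_from_1 k (\<lambda>i. interval_measure (Phi (u i))) (\<lambda>i x. {..upper_limit a b u h x i})
       (crossing_integrand a b t k u h)"

end

theory Submission imports Defs
begin

text \<open>
  One segment without jumps: the distance \<open>Y s = b + a s - B s\<close> to the barrier is a Brownian motion
  with drift, and for \<open>D\<close> normal with mean \<open>a v\<close> and variance \<open>v\<close> one has
  \<open>E (g D) = E (g (- D) exp (- 2 a D))\<close>. Applied to the increment of \<open>Y\<close> after the first zero of \<open>Y\<close>
  (approximated by grid times, so that the simple Markov property suffices), this is a reflection
  principle with drift. It gives the law of \<open>B u\<close> on the event that the barrier is not
  crossed before \<open>u\<close>, without a change of measure.

  Given the jump times and heights, the segments between jumps are independent and the barrier
  seen by the next segment is \<open>b\<^sub>i + a t\<^sub>i - x\<^sub>i - h\<^sub>i\<close>, so the multiple integral arises by induction on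
  the number of remaining jumps. The jump times, heights and the Brownian path are then integrated out by
  independence. In the Poisson case the probabilities of having one jump in each of \<open>k\<close>
  disjoint intervals, and no other jump, show that the jump times have density
  \<open>l\<^sup>k exp (- l t)\<close> on the simplex.
\<close>

text \<open>The supremum runs over a half-open interval and paths with jumps are only
  right-continuous, so being negative at every time is weaker than having a negative supremum: the
  left limits at the jump times and at \<open>t\<close> count too. The event is therefore encoded by
  a uniform negative gap, which survives limits, can be tested at rational times and can be cut at
  the jumps. It keeps the path under the barrier both just before and just after a jump, hence the
  minimum in \<open>upper_limit\<close>.

  At a grid time the distance to the barrier is only close to zero. The error disappears in the
  limit since the final value almost surely avoids zero and the discontinuities of the test
  functions. The bridge exponent is the mixed term left over when the square in the normal density
  is reflected.

  In the general formula the jump times are conditioned on \<open>N t = k\<close>, and their support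
  enters as an almost sure condition: a jump exactly at \<open>t\<close> would leave no final
  segment. In the Poisson case the conditional law has a density, so this boundary is null.\<close>

abbreviation borel_on :: "'i set \<Rightarrow> ('i \<Rightarrow> real) measure" where
  "borel_on I \<equiv> PiM I (\<lambda>_. borel)"

abbreviation lborel_on :: "'i set \<Rightarrow> ('i \<Rightarrow> real) measure" where
  "lborel_on I \<equiv> PiM I (\<lambda>_. lborel)"

abbreviation gauss :: "real \<Rightarrow> real \<Rightarrow> real" where
  "gauss v \<equiv> normal_density 0 (sqrt v)"

lemmas lint_cong = Bochner_Integration.integral_cong

section \<open>Functions staying below zero\<close>

text \<open>Over the half-open interval this is a negative supremum, not just negativity at each
  point. Gaps of the form 1 / (m + 1) turn the existential quantifier into a countable
  union.\<close>

definition below :: "real \<Rightarrow> real \<Rightarrow> (real \<Rightarrow> real) \<Rightarrow> bool" where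
  "below c d f \<longleftrightarrow> (\<exists>m::nat. \<forall>r\<in>{c..<d}. f r \<le> - inverse (real (Suc m)))"

text \<open>Only countably many coordinates of the path occur, so this form defines a measurable set
  even in a product space indexed by an interval of times.\<close>

definition below_rat :: "real \<Rightarrow> real \<Rightarrow> (real \<Rightarrow> real) \<Rightarrow> bool" where
  "below_rat c d f \<longleftrightarrow> (\<exists>m::nat. \<forall>r\<in>\<rat>. c \<le> r \<longrightarrow> r < d \<longrightarrow> f r \<le> - inverse (real (Suc m)))"

lemma below_cong: "(\<And>r. c \<le> r \<Longrightarrow> r < d \<Longrightarrow> f r = g r) \<Longrightarrow> below c d f \<longleftrightarrow> below c d g"
  by (auto simp: below_def)

text \<open>If the bound fails at \<open>r\<close>, right-continuity makes it fail on an interval to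
  the right of \<open>r\<close>, which contains a rational. Only right limits are used, so jumps do
  no harm.\<close>

lemma below_iff_rat:
  assumes "\<And>r. c \<le> r \<Longrightarrow> r < d \<Longrightarrow> continuous (at_right r) f"
  shows "below c d f \<longleftrightarrow> below_rat c d f"
proof
  assume "below_rat c d f"
  then obtain m :: nat where m: "\<And>r. r \<in> \<rat> \<Longrightarrow> c \<le> r \<Longrightarrow> r < d \<Longrightarrow> f r \<le> - inverse (real (Suc m))"
    by (auto simp: below_rat_def)
  have "f r \<le> - inverse (real (Suc m))" if r: "c \<le> r" "r < d" for r
  proof (rule ccontr)
    assume "\<not> f r \<le> - inverse (real (Suc m))"
    then have "\<forall>\<^sub>F y in at_right r. - inverse (real (Suc m)) < f y"
      using assms[OF r] by (intro order_tendstoD(1)[of f "f r"]) (auto simp: continuous_within)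
    then obtain e where e: "e > r" "\<And>y. r < y \<Longrightarrow> y < e \<Longrightarrow> - inverse (real (Suc m)) < f y"
      by (auto simp: eventually_at_right_field)
    obtain q where "q \<in> \<rat>" "r < q" "q < min e d"
      using Rats_dense_in_real[of r "min e d"] e(1) r by auto
    then show False using e(2)[of q] m[of q] r by auto
  qed
  then show "below c d f" unfolding below_def by (intro exI[of _ m]) simp
next
  show "below c d f \<Longrightarrow> below_rat c d f"
    unfolding below_def below_rat_def by (meson atLeastLessThan_iff)
qed

lemma below_split:
  assumes "c \<le> s" "s \<le> d"
  shows "below c d f \<longleftrightarrow> below c s f \<and> below s d f"
proof
  assume "below c s f \<and> below s d f"
  then obtain m n :: nat where *: "\<And>r. r \<in> {c..<s} \<Longrightarrow> f r \<le> - inverse (real (Suc m))"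
     "\<And>r. r \<in> {s..<d} \<Longrightarrow> f r \<le> - inverse (real (Suc n))"
    unfolding below_def by blast
  have "inverse (real (Suc (max m n))) \<le> inverse (real (Suc m))"
       "inverse (real (Suc (max m n))) \<le> inverse (real (Suc n))"
    by (auto intro!: le_imp_inverse_le)
  with * have "f r \<le> - inverse (real (Suc (max m n)))" if "r \<in> {c..<d}" for r
    using that order_trans[OF *(1)[of r]] order_trans[OF *(2)[of r]] by (cases "r < s") auto
  then show "below c d f" unfolding below_def by blast
next
  assume "below c d f"
  then show "below c s f \<and> below s d f"
    using assms unfolding below_def by (meson atLeastLessThan_iff le_less_trans less_le_trans order_trans)
qed

lemma below_shift: "below s (s + d) f \<longleftrightarrow> below 0 d (\<lambda>r. f (s + r))"
proof -
  have "(\<forall>r\<in>{s..<s + d}. f r \<le> x) \<longleftrightarrow> (\<forall>r\<in>{0..<d}. f (s + r) \<le> x)" for x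
  proof safe
    fix r assume *: "\<forall>r\<in>{0..<d}. f (s + r) \<le> x" "r \<in> {s..<s + d}"
    show "f r \<le> x" using *(2) *(1)[rule_format, of "r - s"] by simp
  qed auto
  then show ?thesis by (simp add: below_def)
qed

text \<open>From left to right the gap passes to the endpoint \<open>d\<close> by closure; from
  right to left the maximum over the compact interval is attained and negative.\<close>

lemma below_continuous_iff:
  assumes "continuous_on {c..d} f" "c < d"
  shows "below c d f \<longleftrightarrow> (\<forall>r\<in>{c..d}. f r < 0)"
proof
  assume "below c d f"
  then obtain m :: nat where m: "\<And>r. r \<in> {c..<d} \<Longrightarrow> f r \<le> - inverse (real (Suc m))"
    unfolding below_def by blast
  have "f r \<le> - inverse (real (Suc m))" if "r \<in> {c..d}" for r
    by (rule continuous_le_on_closure[of "{c..<d}" f])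
       (use assms m that in \<open>auto simp: closure_atLeastLessThan\<close>)
  moreover have "- inverse (real (Suc m)) < 0" by simp
  ultimately show "\<forall>r\<in>{c..d}. f r < 0"
    by (blast intro: le_less_trans)
next
  assume *: "\<forall>r\<in>{c..d}. f r < 0"
  obtain y where y: "y \<in> {c..d}" "\<And>r. r \<in> {c..d} \<Longrightarrow> f r \<le> f y"
    using continuous_attains_sup[of "{c..d}" f] assms by auto
  obtain m :: nat where "inverse (real (Suc m)) < - f y"
    using reals_Archimedean[of "- f y"] * y(1) by auto
  then show "below c d f"
    unfolding below_def using y(2) by (intro exI[of _ m]) fastforce
qed

text \<open>Boundedness has to be supplied because the supremum of an unbounded set of reals is an
  unspecified value.\<close>

lemma SUP_less_0_iff_below:
  assumes "bdd_above (f ` {0..<t})" "(0::real) < t"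
  shows "(SUP s\<in>{0..<t}. f s) < 0 \<longleftrightarrow> below 0 t f"
proof
  assume "(SUP s\<in>{0..<t}. f s) < 0"
  then obtain m :: nat where m: "inverse (real (Suc m)) < - (SUP s\<in>{0..<t}. f s)"
    using reals_Archimedean[of "- (SUP s\<in>{0..<t}. f s)"] by auto
  have "f r \<le> - inverse (real (Suc m))" if "r \<in> {0..<t}" for r
    using cSUP_upper[OF that assms(1)] m by linarith
  then show "below 0 t f" unfolding below_def by blast
next
  assume "below 0 t f"
  then obtain m :: nat where m: "\<And>r. r \<in> {0..<t} \<Longrightarrow> f r \<le> - inverse (real (Suc m))"
    unfolding below_def by blast
  then have "(SUP s\<in>{0..<t}. f s) \<le> - inverse (real (Suc m))"
    using assms by (intro cSUP_least) auto
  also have "\<dots> < 0" by simp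
  finally show "(SUP s\<in>{0..<t}. f s) < 0" .
qed

lemma measurable_below_rat:
  assumes "\<And>r. r \<in> \<rat> \<Longrightarrow> c \<le> r \<Longrightarrow> r < d \<Longrightarrow> (\<lambda>x. f x r) \<in> borel_measurable S"
  shows "Measurable.pred S (\<lambda>x. below_rat c d (f x))"
proof -
  have "(\<lambda>x. below_rat c d (f x)) = (\<lambda>x. \<exists>m::nat. \<forall>r\<in>{r\<in>\<rat>. c \<le> r \<and> r < d}. f x r \<le> - inverse (real (Suc m)))"
    by (auto simp: below_rat_def fun_eq_iff)
  moreover have "Measurable.pred S (\<lambda>x. \<exists>m::nat. \<forall>r\<in>{r\<in>\<rat>. c \<le> r \<and> r < d}. f x r \<le> - inverse (real (Suc m)))"
  proof (rule pred_intros_countable(2), rule measurable_pred_countable(1))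
    show "countable {r\<in>\<rat>. c \<le> r \<and> r < (d::real)}"
      by (rule countable_subset[OF _ countable_rat]) auto
  next
    fix m :: nat and r assume "r \<in> {r\<in>\<rat>. c \<le> r \<and> r < d}"
    then have [measurable]: "(\<lambda>x. f x r) \<in> borel_measurable S" using assms by auto
    show "Measurable.pred S (\<lambda>x. f x r \<le> - inverse (real (Suc m)))" by measurable
  qed
  ultimately show ?thesis by simp
qed

section \<open>Independence of past and future of Brownian motion\<close>

lemma vimage_prod_algebra:
  assumes X: "\<And>i. i \<in> I \<Longrightarrow> X i \<in> measurable M (S i)" and A: "A \<in> prod_algebra I S"
  shows "\<exists>J E. finite J \<and> J \<subseteq> I \<and> (\<forall>j\<in>J. E j \<in> sets (S j)) \<and>
    (\<lambda>\<omega>. \<lambda>i\<in>I. X i \<omega>) -` A \<inter> space M = {\<omega>\<in>space M. \<forall>j\<in>J. X j \<omega> \<in> E j}"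
proof -
  from prod_algebraE[OF A] obtain J E where *: "A = prod_emb I S J (Pi\<^sub>E J E)"
    "finite J" "J \<noteq> {} \<or> I = {}" "J \<subseteq> I" "\<And>j. j \<in> J \<Longrightarrow> E j \<in> sets (S j)"
    by metis
  have "(\<lambda>i\<in>I. X i \<omega>) \<in> A \<longleftrightarrow> (\<forall>j\<in>J. X j \<omega> \<in> E j)" if "\<omega> \<in> space M" for \<omega>
  proof -
    have "(\<lambda>i\<in>I. X i \<omega>) \<in> (\<Pi>\<^sub>E i\<in>I. space (S i))"
      using measurable_space[OF X that] by simp
    moreover have "restrict (\<lambda>i\<in>I. X i \<omega>) J = restrict (\<lambda>i. X i \<omega>) J"
      using *(4) by (simp add: Int_absorb1)
    ultimately show ?thesis
      unfolding *(1) prod_emb_def by (simp add: Pi_iff)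
  qed
  then have "(\<lambda>\<omega>. \<lambda>i\<in>I. X i \<omega>) -` A \<inter> space M = {\<omega>\<in>space M. \<forall>j\<in>J. X j \<omega> \<in> E j}"
    by (intro set_eqI) (simp add: conj_commute cong: conj_cong)
  with *(2,4,5) show ?thesis by (intro exI[of _ J] exI[of _ E]) simp
qed

lemma Int_stable_vimage:
  assumes "Int_stable G"
  shows "Int_stable {f -` A \<inter> \<Omega> | A. A \<in> G}"
proof (rule Int_stableI)
  fix a b assume "a \<in> {f -` A \<inter> \<Omega> | A. A \<in> G}" "b \<in> {f -` A \<inter> \<Omega> | A. A \<in> G}"
  then obtain A B where "A \<in> G" "B \<in> G" "a = f -` A \<inter> \<Omega>" "b = f -` B \<inter> \<Omega>" by auto
  with assms show "a \<inter> b \<in> {f -` A \<inter> \<Omega> | A. A \<in> G}"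
    by (auto simp: Int_stable_def intro!: exI[of _ "A \<inter> B"])
qed

lemma sigma_sets_vimage_PiM:
  assumes X: "\<And>i. i \<in> I \<Longrightarrow> X i \<in> measurable M (S i)"
  shows "sigma_sets (space M) {(\<lambda>\<omega>. \<lambda>i\<in>I. X i \<omega>) -` A \<inter> space M | A. A \<in> sets (PiM I S)} =
    sigma_sets (space M) {(\<lambda>\<omega>. \<lambda>i\<in>I. X i \<omega>) -` A \<inter> space M | A. A \<in> prod_algebra I S}"
proof -
  have "(\<lambda>\<omega>. \<lambda>i\<in>I. X i \<omega>) \<in> space M \<rightarrow> (\<Pi>\<^sub>E i\<in>I. space (S i))"
    using measurable_space[OF X] by auto
  from sigma_sets_vimage_commute[OF this, of "prod_algebra I S"] show ?thesis
    by (subst sets_PiM) (auto simp: intro!: sigma_sets_sigma_sets_eq)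
qed

text \<open>Preimages of cylinder sets form an intersection-stable generator of each of the two
  sigma-algebras, so independence of two possibly uncountable families reduces to events on finitely
  many coordinates.\<close>

lemma (in prob_space) indep_var_PiM_I:
  assumes X: "\<And>i. i \<in> I \<Longrightarrow> X i \<in> measurable M (S i)"
    and Y: "\<And>i. i \<in> L \<Longrightarrow> Y i \<in> measurable M (T i)"
    and fin: "\<And>J K E F. finite J \<Longrightarrow> J \<subseteq> I \<Longrightarrow> finite K \<Longrightarrow> K \<subseteq> L \<Longrightarrow>
       (\<And>j. j \<in> J \<Longrightarrow> E j \<in> sets (S j)) \<Longrightarrow> (\<And>k. k \<in> K \<Longrightarrow> F k \<in> sets (T k)) \<Longrightarrow>
       prob {\<omega>\<in>space M. (\<forall>j\<in>J. X j \<omega> \<in> E j) \<and> (\<forall>k\<in>K. Y k \<omega> \<in> F k)} =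
       prob {\<omega>\<in>space M. \<forall>j\<in>J. X j \<omega> \<in> E j} * prob {\<omega>\<in>space M. \<forall>k\<in>K. Y k \<omega> \<in> F k}"
  shows "indep_var (PiM I S) (\<lambda>\<omega>. \<lambda>i\<in>I. X i \<omega>) (PiM L T) (\<lambda>\<omega>. \<lambda>i\<in>L. Y i \<omega>)"
proof -
  have mX: "(\<lambda>\<omega>. \<lambda>i\<in>I. X i \<omega>) \<in> measurable M (PiM I S)"
    and mY: "(\<lambda>\<omega>. \<lambda>i\<in>L. Y i \<omega>) \<in> measurable M (PiM L T)"
    using X Y by (auto intro!: measurable_restrict)
  have sub: "prod_algebra I S \<subseteq> sets (PiM I S)" "prod_algebra L T \<subseteq> sets (PiM L T)"
    unfolding sets_PiM by auto
  have "indep_set {(\<lambda>\<omega>. \<lambda>i\<in>I. X i \<omega>) -` A \<inter> space M | A. A \<in> prod_algebra I S}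
     {(\<lambda>\<omega>. \<lambda>i\<in>L. Y i \<omega>) -` A \<inter> space M | A. A \<in> prod_algebra L T}"
    unfolding indep_sets2_eq
  proof (intro conjI ballI)
    show "{(\<lambda>\<omega>. \<lambda>i\<in>I. X i \<omega>) -` A \<inter> space M | A. A \<in> prod_algebra I S} \<subseteq> events"
      using measurable_sets[OF mX] sub by auto
    show "{(\<lambda>\<omega>. \<lambda>i\<in>L. Y i \<omega>) -` A \<inter> space M | A. A \<in> prod_algebra L T} \<subseteq> events"
      using measurable_sets[OF mY] sub by auto
  next
    fix a b assume "a \<in> {(\<lambda>\<omega>. \<lambda>i\<in>I. X i \<omega>) -` A \<inter> space M | A. A \<in> prod_algebra I S}"
      and "b \<in> {(\<lambda>\<omega>. \<lambda>i\<in>L. Y i \<omega>) -` A \<inter> space M | A. A \<in> prod_algebra L T}"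
    then obtain A A' where A: "A \<in> prod_algebra I S" "A' \<in> prod_algebra L T"
      and ab: "a = (\<lambda>\<omega>. \<lambda>i\<in>I. X i \<omega>) -` A \<inter> space M" "b = (\<lambda>\<omega>. \<lambda>i\<in>L. Y i \<omega>) -` A' \<inter> space M"
      by auto
    from vimage_prod_algebra[of I X M S, OF _ A(1)] X
    obtain J E where J: "finite J" "J \<subseteq> I" "\<forall>j\<in>J. E j \<in> sets (S j)"
      "a = {\<omega>\<in>space M. \<forall>j\<in>J. X j \<omega> \<in> E j}"
      unfolding ab by auto
    from vimage_prod_algebra[of L Y M T, OF _ A(2)] Y
    obtain K F where K: "finite K" "K \<subseteq> L" "\<forall>j\<in>K. F j \<in> sets (T j)"
      "b = {\<omega>\<in>space M. \<forall>j\<in>K. Y j \<omega> \<in> F j}"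
      unfolding ab by auto
    have "a \<inter> b = {\<omega>\<in>space M. (\<forall>j\<in>J. X j \<omega> \<in> E j) \<and> (\<forall>k\<in>K. Y k \<omega> \<in> F k)}"
      using J(4) K(4) by auto
    then show "prob (a \<inter> b) = prob a * prob b"
      using fin[OF J(1,2) K(1,2), of E F] J(3,4) K(3,4) by simp
  qed
  from indep_set_sigma_sets[OF this] show ?thesis
    unfolding indep_var_eq using mX mY
    by (simp add: sigma_sets_vimage_PiM[OF X] sigma_sets_vimage_PiM[OF Y]
        Int_stable_vimage Int_stable_prod_algebra)
qed

locale brownian = prob_space M for M :: "'a measure" +
  fixes B :: "real \<Rightarrow> 'a \<Rightarrow> real"
  assumes bm: "standard_brownian_motion M B"
begin

lemma B_measurable: "0 \<le> s \<Longrightarrow> B s \<in> borel_measurable M"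
  and B_0: "\<omega> \<in> space M \<Longrightarrow> B 0 \<omega> = 0"
  and B_continuous: "\<omega> \<in> space M \<Longrightarrow> continuous_on {0..} (\<lambda>s. B s \<omega>)"
  and B_increment: "0 \<le> s \<Longrightarrow> s < u \<Longrightarrow>
        distributed M lborel (\<lambda>\<omega>. B u \<omega> - B s \<omega>) (gauss ((u - s)))"
  and B_indep: "0 \<le> p 0 \<Longrightarrow> mono p \<Longrightarrow>
        indep_vars (\<lambda>_. borel) (\<lambda>i \<omega>. B (p (Suc i)) \<omega> - B (p i) \<omega>) {..<n::nat}"
  using bm unfolding standard_brownian_motion_def by blast+

lemma brownian_shift:
  assumes c: "0 \<le> c"
  shows "brownian M (\<lambda>s \<omega>. B (c + s) \<omega> - B c \<omega>)"
proof unfold_locales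
  show "standard_brownian_motion M (\<lambda>s \<omega>. B (c + s) \<omega> - B c \<omega>)"
    unfolding standard_brownian_motion_def
  proof (intro conjI allI ballI impI)
    fix s :: real assume "0 \<le> s"
    then show "(\<lambda>\<omega>. B (c + s) \<omega> - B c \<omega>) \<in> borel_measurable M"
      using c by (intro borel_measurable_diff B_measurable) auto
  next
    fix \<omega> assume w: "\<omega> \<in> space M"
    show "B (c + 0) \<omega> - B c \<omega> = 0" by simp
    show "continuous_on {0..} (\<lambda>s. B (c + s) \<omega> - B c \<omega>)"
      by (intro continuous_intros continuous_on_compose2[OF B_continuous[OF w]]) (use c in auto)
  next
    fix s u :: real assume "0 \<le> s \<and> s < u"
    then show "distributed M lborel (\<lambda>\<omega>. B (c + u) \<omega> - B c \<omega> - (B (c + s) \<omega> - B c \<omega>)) (gauss ((u - s)))"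
      using B_increment[of "c + s" "c + u"] c by simp
  next
    fix n and p :: "nat \<Rightarrow> real" assume "0 \<le> p 0 \<and> mono p"
    then show "indep_vars (\<lambda>_. borel) (\<lambda>i \<omega>. B (c + p (Suc i)) \<omega> - B c \<omega> - (B (c + p i) \<omega> - B c \<omega>)) {..<n}"
      using B_indep[of "\<lambda>i. c + p i" n] c by (auto simp: mono_def)
  qed
qed

text \<open>The assumption on Brownian motion concerns consecutive increments along one monotone
  sequence. All chosen past and future times are put into one sorted grid; past values are sums of
  increments with index below \<open>m\<close>, future displacements are sums with index from
  \<open>m\<close> on, and these two blocks are independent.\<close>

lemma indep_past_future:
  assumes c: "0 \<le> c"
  shows "indep_var (borel_on {0..c}) (\<lambda>\<omega>. \<lambda>s\<in>{0..c}. B s \<omega>)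
    (borel_on {0..}) (\<lambda>\<omega>. \<lambda>s\<in>{0..}. B (c + s) \<omega> - B c \<omega>)"
proof (rule indep_var_PiM_I)
  show "B i \<in> borel_measurable M" if "i \<in> {0..c}" for i using that by (auto intro: B_measurable)
  show "(\<lambda>\<omega>. B (c + i) \<omega> - B c \<omega>) \<in> borel_measurable M" if "i \<in> {0..}" for i
    using that c by (intro borel_measurable_diff B_measurable) auto
next
  fix J K :: "real set" and E F :: "real \<Rightarrow> real set"
  assume J: "finite J" "J \<subseteq> {0..c}" and K: "finite K" "K \<subseteq> {0..}"
    and E: "\<And>j. j \<in> J \<Longrightarrow> E j \<in> sets borel" and F: "\<And>j. j \<in> K \<Longrightarrow> F j \<in> sets borel"
  \<comment> \<open>The points 0 and \<open>c\<close> are added: past values are sums of increments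
    from 0, where the motion vanishes, and the two blocks meet at \<open>c\<close>.\<close>
  define T where "T = insert 0 (insert c (J \<union> (+) c ` K))"
  have T: "finite T" "0 \<in> T" "c \<in> T" "\<And>x. x \<in> T \<Longrightarrow> 0 \<le> x"
    using J K c by (auto simp: T_def)
  define l where "l = sorted_list_of_set T"
  have l: "sorted l" "set l = T" "l \<noteq> []" using T by (auto simp: l_def)
  define n where "n = length l"
  \<comment> \<open>Beyond the last grid point the sequence stays constant, as
    \<open>B_indep\<close> asks for a sequence that is monotone on all of the naturals.\<close>
  define p where "p i = l ! min i (n - 1)" for i
  have n: "0 < n" using l by (simp add: n_def)
  have mono: "mono p"
    unfolding p_def mono_def by (auto intro!: sorted_nth_mono l simp: n_def[symmetric] n less_imp_le min_def)
       (use n in auto)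
  have p_in: "p i \<in> T" for i
    using n unfolding p_def l(2)[symmetric] n_def by (intro nth_mem min.strict_coboundedI2) auto
  have ex_p: "\<exists>i<n. p i = x" if x: "x \<in> T" for x
  proof -
    obtain i where "i < n" "l ! i = x" using x unfolding l(2)[symmetric] in_set_conv_nth n_def by auto
    then show ?thesis by (intro exI[of _ i]) (auto simp: p_def min_def)
  qed
  have p0: "p 0 = 0"
  proof -
    obtain i where "p i = 0" using ex_p[OF T(2)] by auto
    moreover have "p 0 \<le> p i" using mono by (auto simp: mono_def)
    ultimately show ?thesis using T(4)[OF p_in[of 0]] by simp
  qed
  obtain m where m: "m < n" "p m = c" using ex_p[OF T(3)] by auto
  define D where "D i \<omega> = B (p (Suc i)) \<omega> - B (p i) \<omega>" for i \<omega>
  have "indep_vars (\<lambda>_. borel) D {..<n}"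
    unfolding D_def using B_indep[of p n] mono p0 by auto
  from indep_var_restrict[OF this, of "{..<m}" "{m..<n}"] m(1)
  have ind: "indep_var (borel_on {..<m}) (\<lambda>\<omega>. \<lambda>i\<in>{..<m}. D i \<omega>) (borel_on {m..<n}) (\<lambda>\<omega>. \<lambda>i\<in>{m..<n}. D i \<omega>)"
    by (simp add: ivl_disj_int subset_eq)
  have sum_D: "(\<Sum>i\<in>{j..<k}. D i \<omega>) = B (p k) \<omega> - B (p j) \<omega>" if "j \<le> k" for j k \<omega>
    unfolding D_def using sum_Suc_diff'[OF that, of "\<lambda>i. B (p i) \<omega>"] by simp
  have "\<exists>i\<le>m. p i = j" if "j \<in> J" for j
  proof -
    have "j \<in> T" using that by (simp add: T_def)
    then obtain i where i: "p i = j" using ex_p[of j] by blast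
    show ?thesis
    proof (cases "i \<le> m")
      case False
      \<comment> \<open>An index past \<open>m\<close> can only represent a time of at least
        \<open>c\<close>, so the past time is \<open>c\<close> itself and \<open>m\<close> serves
        instead.\<close>
      then have "c \<le> p i" using mono m(2) by (auto simp: mono_def)
      then have "p m = j" using i m(2) that J(2) by auto
      then show ?thesis by auto
    qed (use i in auto)
  qed
  then obtain f where f: "\<And>j. j \<in> J \<Longrightarrow> f j \<le> m \<and> p (f j) = j" by metis
  have "\<exists>i\<ge>m. i < n \<and> p i = c + j" if "j \<in> K" for j
  proof -
    have "c + j \<in> T" using that by (simp add: T_def)
    then obtain i where i: "i < n" "p i = c + j" using ex_p[of "c + j"] by blast
    show ?thesis
    proof (cases "i \<ge> m")
      case False
      then have "p i \<le> c" using mono m(2) by (auto simp: mono_def)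
      then have "p m = c + j" using i m(2) that K(2) by auto
      then show ?thesis using m(1) by auto
    qed (use i in auto)
  qed
  then obtain g where g: "\<And>j. j \<in> K \<Longrightarrow> m \<le> g j \<and> g j < n \<and> p (g j) = c + j" by metis
  define A1 where "A1 = {d\<in>space (borel_on {..<m}). \<forall>j\<in>J. (\<Sum>i\<in>{0..<f j}. d i) \<in> E j}"
  define A2 where "A2 = {d\<in>space (borel_on {m..<n}). \<forall>j\<in>K. (\<Sum>i\<in>{m..<g j}. d i) \<in> F j}"
  have "A1 \<in> sets (borel_on {..<m})"
    unfolding A1_def
  proof (intro sets.sets_Collect_finite_All J)
    fix j assume j: "j \<in> J"
    have "(\<lambda>d. \<Sum>i\<in>{0..<f j}. d i) \<in> borel_measurable (borel_on {..<m})"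
      using f[OF j] by (intro borel_measurable_sum measurable_component_singleton) auto
    from measurable_sets[OF this E[OF j]]
    show "{x \<in> space (borel_on {..<m}). sum x {0..<f j} \<in> E j} \<in> sets (borel_on {..<m})"
      by (simp add: vimage_def Int_def conj_commute)
  qed
  moreover have "A2 \<in> sets (borel_on {m..<n})"
    unfolding A2_def
  proof (intro sets.sets_Collect_finite_All K)
    fix j assume j: "j \<in> K"
    have "(\<lambda>d. \<Sum>i\<in>{m..<g j}. d i) \<in> borel_measurable (borel_on {m..<n})"
      using g[OF j] by (intro borel_measurable_sum measurable_component_singleton) auto
    from measurable_sets[OF this F[OF j]]
    show "{x \<in> space (borel_on {m..<n}). sum x {m..<g j} \<in> F j} \<in> sets (borel_on {m..<n})"
      by (simp add: vimage_def Int_def conj_commute)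
  qed
  ultimately have "prob ((\<lambda>\<omega>. (\<lambda>i\<in>{..<m}. D i \<omega>, \<lambda>i\<in>{m..<n}. D i \<omega>)) -` (A1 \<times> A2) \<inter> space M) =
    prob ((\<lambda>\<omega>. \<lambda>i\<in>{..<m}. D i \<omega>) -` A1 \<inter> space M) * prob ((\<lambda>\<omega>. \<lambda>i\<in>{m..<n}. D i \<omega>) -` A2 \<inter> space M)"
    using ind by (rule indep_varD[rotated])
  moreover have 1: "((\<lambda>i\<in>{..<m}. D i \<omega>) \<in> A1) \<longleftrightarrow> (\<forall>j\<in>J. B j \<omega> \<in> E j)" if w: "\<omega> \<in> space M" for \<omega>
  proof -
    have "(\<Sum>i\<in>{0..<f j}. (\<lambda>i\<in>{..<m}. D i \<omega>) i) = B j \<omega>" if j: "j \<in> J" for j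
    proof -
      have "(\<Sum>i\<in>{0..<f j}. (\<lambda>i\<in>{..<m}. D i \<omega>) i) = (\<Sum>i\<in>{0..<f j}. D i \<omega>)"
        using f[OF j] by (intro sum.cong) auto
      then show ?thesis using sum_D[of 0 "f j"] f[OF j] p0 B_0[OF w] by simp
    qed
    then show ?thesis by (auto simp: A1_def space_PiM)
  qed
  moreover have 2: "((\<lambda>i\<in>{m..<n}. D i \<omega>) \<in> A2) \<longleftrightarrow> (\<forall>j\<in>K. B (c + j) \<omega> - B c \<omega> \<in> F j)" for \<omega>
  proof -
    have "(\<Sum>i\<in>{m..<g j}. (\<lambda>i\<in>{m..<n}. D i \<omega>) i) = B (c + j) \<omega> - B c \<omega>" if j: "j \<in> K" for j
    proof -
      have "(\<Sum>i\<in>{m..<g j}. (\<lambda>i\<in>{m..<n}. D i \<omega>) i) = (\<Sum>i\<in>{m..<g j}. D i \<omega>)"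
        using g[OF j] by (intro sum.cong) auto
      then show ?thesis using sum_D[of m "g j"] g[OF j] m(2) by simp
    qed
    then show ?thesis by (auto simp: A2_def space_PiM)
  qed
  moreover have "(\<lambda>\<omega>. (\<lambda>i\<in>{..<m}. D i \<omega>, \<lambda>i\<in>{m..<n}. D i \<omega>)) -` (A1 \<times> A2) \<inter> space M =
    {\<omega> \<in> space M. (\<forall>j\<in>J. B j \<omega> \<in> E j) \<and> (\<forall>k\<in>K. B (c + k) \<omega> - B c \<omega> \<in> F k)}"
    using 1 2 by auto
  moreover have "(\<lambda>\<omega>. \<lambda>i\<in>{..<m}. D i \<omega>) -` A1 \<inter> space M = {\<omega> \<in> space M. \<forall>j\<in>J. B j \<omega> \<in> E j}"
    using 1 by auto
  moreover have "(\<lambda>\<omega>. \<lambda>i\<in>{m..<n}. D i \<omega>) -` A2 \<inter> space M = {\<omega> \<in> space M. \<forall>k\<in>K. B (c + k) \<omega> - B c \<omega> \<in> F k}"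
    using 2 by auto
  ultimately show "prob {\<omega> \<in> space M. (\<forall>j\<in>J. B j \<omega> \<in> E j) \<and> (\<forall>k\<in>K. B (c + k) \<omega> - B c \<omega> \<in> F k)} =
    prob {\<omega> \<in> space M. \<forall>j\<in>J. B j \<omega> \<in> E j} * prob {\<omega> \<in> space M. \<forall>k\<in>K. B (c + k) \<omega> - B c \<omega> \<in> F k}"
    by simp
qed

end

section \<open>First passage on a grid\<close>

text \<open>The times with value at most 0 form a compact set, whose least element is the candidate.
  The intermediate value theorem shows that the value there is 0 and not negative.\<close>

lemma first_zero:
  fixes y :: "real \<Rightarrow> real"
  assumes cont: "continuous_on {0..u} y" and y0: "0 < y 0" and "0 < u"
  shows "(\<forall>s\<in>{0..u}. 0 < y s) \<or> (\<exists>\<tau>\<in>{0<..u}. y \<tau> = 0 \<and> (\<forall>s\<in>{0..<\<tau>}. 0 < y s))"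
proof (cases "\<forall>s\<in>{0..u}. 0 < y s")
  case False
  define S where "S = {0..u} \<inter> y -` {..0}"
  have "closed S"
    unfolding S_def by (intro continuous_closed_preimage cont) auto
  then have "compact S" by (auto simp: compact_eq_bounded_closed S_def intro: bounded_Int)
  moreover have "S \<noteq> {}" using False by (force simp: S_def)
  ultimately obtain \<tau> where \<tau>: "\<tau> \<in> S" "\<And>s. s \<in> S \<Longrightarrow> \<tau> \<le> s"
    using compact_attains_inf by metis
  have "\<tau> \<noteq> 0" using \<tau>(1) y0 by (auto simp: S_def)
  then have pos: "0 < \<tau>" "\<tau> \<le> u" using \<tau>(1) by (auto simp: S_def)
  have "continuous_on {0..\<tau>} y" using cont by (rule continuous_on_subset) (use pos in auto)
  with IVT2'[of y \<tau> 0 0] \<tau>(1) y0 pos obtain s where s: "0 \<le> s" "s \<le> \<tau>" "y s = 0"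
    by (auto simp: S_def)
  then have "s = \<tau>" using \<tau>(2)[of s] pos by (auto simp: S_def)
  moreover have "0 < y s" if "s \<in> {0..<\<tau>}" for s
    using \<tau>(2)[of s] that pos by (force simp: S_def)
  ultimately show ?thesis using s pos by auto
qed simp

text \<open>The overshoot sum of the grid approximation of the first zero \<open>\<tau>\<close> of \<open>y\<close>:
  its only nonzero term belongs to the first grid point after \<open>\<tau>\<close>.\<close>
definition grid_sum :: "(real \<Rightarrow> bool) \<Rightarrow> (real \<Rightarrow> real) \<Rightarrow> real \<Rightarrow> (real \<Rightarrow> real) \<Rightarrow> nat \<Rightarrow> real" where
  "grid_sum A y u \<phi> m = (\<Sum>i<m - 1. if A (u * real i / real m) \<and> \<not> A (u * real (Suc i) / real m) then \<phi> (y u - y (u * real (Suc i) / real m)) else 0)"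

lemma grid_sum_alive:
  assumes u: "0 < u" and A: "\<And>q. 0 \<le> q \<Longrightarrow> q \<le> u \<Longrightarrow> A q"
  shows "grid_sum A y u \<phi> m = 0"
  unfolding grid_sum_def
proof (intro sum.neutral ballI)
  fix i assume i: "i \<in> {..<m - 1}"
  have "u * real (Suc i) / real m \<le> u * 1" unfolding times_divide_eq_right[symmetric]
    using i u by (intro mult_left_mono) (auto simp: divide_simps)
  then have "A (u * real (Suc i) / real m)" using u by (intro A) auto
  then show "(if A (u * real i / real m) \<and> \<not> A (u * real (Suc i) / real m) then \<phi> (y u - y (u * real (Suc i) / real m)) else 0) = 0"
    by simp
qed

text \<open>\<open>k\<close> is the index of the first grid point not before \<tau>. The cell that
  ends at \<open>u\<close> is left out of the sum because the later reflection needs an increment of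
  positive length, so the sum is 0 if \<open>k = m\<close>.\<close>

lemma grid_sum_hit:
  assumes \<tau>: "0 < \<tau>" "\<tau> \<le> u" and A: "\<And>q. 0 \<le> q \<Longrightarrow> q \<le> u \<Longrightarrow> A q \<longleftrightarrow> q < \<tau>" and m: "0 < m"
  defines "k \<equiv> nat \<lceil>\<tau> * real m / u\<rceil>"
  shows "grid_sum A y u \<phi> m = (if k < m then \<phi> (y u - y (u * real k / real m)) else 0)"
    and "\<tau> \<le> u * real k / real m" "u * real k / real m \<le> \<tau> + u / real m" "k \<le> m" "real k < \<tau> * real m / u + 1"
proof -
  have u: "0 < u" using \<tau> by simp
  have pos: "0 < \<tau> * real m / u" using \<tau> m by simp
  then have kc: "real k = of_int \<lceil>\<tau> * real m / u\<rceil>" unfolding k_def by (simp add: ceiling_le_iff)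
  have k1: "\<tau> * real m / u \<le> real k" "real k < \<tau> * real m / u + 1"
    unfolding kc by linarith+
  then have "0 < real k" using pos by linarith
  then have k0: "0 < k" by simp
  have "\<tau> * real m / u \<le> real m" using \<tau> by (auto simp: divide_simps mult.commute intro!: mult_right_mono)
  then show km: "k \<le> m" using k1(2) by linarith
  show "\<tau> \<le> u * real k / real m" using k1(1) u m by (simp add: field_simps)
  show "u * real k / real m \<le> \<tau> + u / real m" using k1(2) u m by (simp add: field_simps)
  show "real k < \<tau> * real m / u + 1" by fact
  have iff: "(A (u * real i / real m) \<and> \<not> A (u * real (Suc i) / real m)) \<longleftrightarrow> i = k - 1" if i: "i < m - 1" for i
  proof -
    have "u * real i / real m \<le> u * 1" "u * real (Suc i) / real m \<le> u * 1" unfolding times_divide_eq_right[symmetric]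
      using i u by (auto intro!: mult_left_mono simp: divide_simps)
    then have "A (u * real i / real m) \<longleftrightarrow> u * real i / real m < \<tau>" "A (u * real (Suc i) / real m) \<longleftrightarrow> u * real (Suc i) / real m < \<tau>"
      using u by (auto intro!: A)
    moreover have "u * real i / real m < \<tau> \<longleftrightarrow> real i < \<tau> * real m / u" "u * real (Suc i) / real m < \<tau> \<longleftrightarrow> real (Suc i) < \<tau> * real m / u"
      using u m by (simp_all add: field_simps)
    moreover have "real i < \<tau> * real m / u \<and> \<not> real (Suc i) < \<tau> * real m / u \<longleftrightarrow> i = k - 1"
    proof
      assume "real i < \<tau> * real m / u \<and> \<not> real (Suc i) < \<tau> * real m / u"
      then have "real i < real k" "real k < real i + 2" using k1 by linarith+
      then have "i < k" "k < i + 2" by linarith+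
      then show "i = k - 1" by simp
    next
      assume "i = k - 1"
      then have "real k = real i + 1" using k0 by simp
      then show "real i < \<tau> * real m / u \<and> \<not> real (Suc i) < \<tau> * real m / u" using k1 by auto
    qed
    ultimately show ?thesis by simp
  qed
  have "grid_sum A y u \<phi> m = (\<Sum>i<m - 1. if i = k - 1 then \<phi> (y u - y (u * real k / real m)) else 0)"
    unfolding grid_sum_def
  proof (intro sum.cong refl)
    fix i assume "i \<in> {..<m - 1}"
    then have i: "i < m - 1" by simp
    have "i = k - 1 \<Longrightarrow> Suc i = k" using k0 by simp
    then show "(if A (u * real i / real m) \<and> \<not> A (u * real (Suc i) / real m) then \<phi> (y u - y (u * real (Suc i) / real m)) else 0) =
       (if i = k - 1 then \<phi> (y u - y (u * real k / real m)) else 0)"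
      unfolding iff[OF i] by auto
  qed
  also have "\<dots> = (if k - 1 < m - 1 then \<phi> (y u - y (u * real k / real m)) else 0)"
    by (subst sum.delta) auto
  also have "k - 1 < m - 1 \<longleftrightarrow> k < m" using k0 by auto
  finally show "grid_sum A y u \<phi> m = (if k < m then \<phi> (y u - y (u * real k / real m)) else 0)" .
qed

text \<open>At most one term is nonzero, which gives a bound independent of the mesh. As the mesh
  shrinks, the grid point after \<tau> tends to \<tau>, where \<open>y\<close> vanishes, so the
  increment up to \<open>u\<close> tends to \<open>y u\<close>. That \<open>y u\<close> is nonzero
  excludes \<tau> = u, the one case in which the omitted last cell would matter for every
  mesh.\<close>

lemma
  fixes y :: "real \<Rightarrow> real"
  assumes cont: "continuous_on {0..u} y" and y0: "0 < y 0" and u: "0 < u"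
    and A0: "A 0" and A: "\<And>q. 0 < q \<Longrightarrow> q \<le> u \<Longrightarrow> A q \<longleftrightarrow> (\<forall>s\<in>{0..q}. 0 < y s)"
  shows grid_sum_bound: "(\<And>x. \<bar>\<phi> x\<bar> \<le> K) \<Longrightarrow> \<bar>grid_sum A y u \<phi> m\<bar> \<le> K"
    and grid_sum_tendsto: "y u \<noteq> 0 \<Longrightarrow> isCont \<phi> (y u) \<Longrightarrow>
      grid_sum A y u \<phi> \<longlonglongrightarrow> (if A u then 0 else \<phi> (y u))"
proof -
  note first_zero[OF cont y0 u]
  moreover have "A q" if "\<forall>s\<in>{0..u}. 0 < y s" "0 \<le> q" "q \<le> u" for q
    using that A0 A[of q] by (cases "q = 0") auto
  moreover have "A q \<longleftrightarrow> q < \<tau>" if "\<tau>\<in>{0<..u}" "y \<tau> = 0" "\<forall>s\<in>{0..<\<tau>}. 0 < y s" "0 \<le> q" "q \<le> u" for q \<tau>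
  proof (cases "q = 0")
    case False
    show ?thesis
    proof (cases "q < \<tau>")
      case True
      then show ?thesis using that(3-5) A[of q] False by auto
    next
      case False
      then have "\<tau> \<in> {0..q}" using that by auto
      moreover have "\<not> 0 < y \<tau>" using that(2) by simp
      moreover have "0 < q" using \<open>q \<noteq> 0\<close> that(4) by simp
      ultimately have "\<not> A q" using A[of q] that(5) by blast
      then show ?thesis using False by simp
    qed
  qed (use that A0 in auto)
  ultimately consider (alive) "\<And>q. 0 \<le> q \<Longrightarrow> q \<le> u \<Longrightarrow> A q"
    | (hit) \<tau> where "0 < \<tau>" "\<tau> \<le> u" "y \<tau> = 0" "\<And>q. 0 \<le> q \<Longrightarrow> q \<le> u \<Longrightarrow> A q \<longleftrightarrow> q < \<tau>"
    by (metis greaterThanAtMost_iff)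
  note cases = this
  {
    assume K: "\<And>x. \<bar>\<phi> x\<bar> \<le> K"
    then have "0 \<le> K" by (meson abs_ge_zero order_trans)
    from cases show "\<bar>grid_sum A y u \<phi> m\<bar> \<le> K"
    proof cases
      case alive
      then show ?thesis using grid_sum_alive[OF u, of A] \<open>0 \<le> K\<close> by simp
    next
      case (hit \<tau>)
      show ?thesis
      proof (cases "m = 0")
        case True
        then show ?thesis using \<open>0 \<le> K\<close> by (simp add: grid_sum_def)
      next
        case False
        then show ?thesis
          using grid_sum_hit(1)[of \<tau> u A m y \<phi>] hit K \<open>0 \<le> K\<close> by simp
      qed
    qed
  next
    assume yu: "y u \<noteq> 0" and \<phi>: "isCont \<phi> (y u)"
    from cases show "grid_sum A y u \<phi> \<longlonglongrightarrow> (if A u then 0 else \<phi> (y u))"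
    proof cases
      case alive
      then have "grid_sum A y u \<phi> = (\<lambda>_. 0)" using grid_sum_alive[OF u, of A] by (auto simp: fun_eq_iff)
      then show ?thesis using alive[of u] u by simp
    next
      case (hit \<tau>)
      have "\<tau> < u" using hit yu by (cases "\<tau> = u") auto
      define k where "k m = nat \<lceil>\<tau> * real m / u\<rceil>" for m :: nat
      note gs = grid_sum_hit[OF hit(1,2,4), folded k_def]
      have lim: "(\<lambda>m. u * real (k m) / real m) \<longlonglongrightarrow> \<tau>"
      proof (rule tendsto_sandwich)
        show "\<forall>\<^sub>F m in sequentially. \<tau> \<le> u * real (k m) / real m"
          using gs(2) by (intro eventually_sequentiallyI[of 1]) auto
        show "\<forall>\<^sub>F m in sequentially. u * real (k m) / real m \<le> \<tau> + u / real m"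
          using gs(3) by (intro eventually_sequentiallyI[of 1]) auto
        have "(\<lambda>m. \<tau> + u / real m) \<longlonglongrightarrow> \<tau> + 0"
          by (intro tendsto_intros lim_const_over_n)
        then show "(\<lambda>m. \<tau> + u / real m) \<longlonglongrightarrow> \<tau>" by simp
      qed simp
      have "\<forall>\<^sub>F m in sequentially. u * real (k m) / real m \<in> {0..u}"
      proof (intro eventually_sequentiallyI[of 1])
        fix m :: nat assume "1 \<le> m"
        then have "u * (real (k m) / real m) \<le> u * 1" using gs(4)[of m] u by (intro mult_left_mono) auto
        then show "u * real (k m) / real m \<in> {0..u}" using u by simp
      qed
      then have "(\<lambda>m. y (u * real (k m) / real m)) \<longlonglongrightarrow> y \<tau>"
        using hit by (intro continuous_on_tendsto_compose[OF cont lim]) auto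
      then have "(\<lambda>m. y u - y (u * real (k m) / real m)) \<longlonglongrightarrow> y u - 0"
        using hit(3) by (intro tendsto_diff) auto
      then have "(\<lambda>m. \<phi> (y u - y (u * real (k m) / real m))) \<longlonglongrightarrow> \<phi> (y u)"
        using isCont_tendsto_compose[OF \<phi>] by simp
      moreover have "\<forall>\<^sub>F m in sequentially. grid_sum A y u \<phi> m = \<phi> (y u - y (u * real (k m) / real m))"
      proof -
        \<comment> \<open>Once the mesh u / m is smaller than u - \<tau>, the grid point after
          \<tau> lies before \<open>u\<close>.\<close>
        obtain m0 :: nat where m0: "u / (u - \<tau>) < m0" using reals_Archimedean2 by blast
        show ?thesis
        proof (intro eventually_sequentiallyI[of "max 1 m0"])
          fix m :: nat assume m: "max 1 m0 \<le> m"
          then have "u / (u - \<tau>) < m" using m0 by linarith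
          then have "\<tau> * real m / u + 1 < m" using \<open>\<tau> < u\<close> u by (simp add: field_simps)
          then have "k m < m" using gs(5)[of m] m by linarith
          then show "grid_sum A y u \<phi> m = \<phi> (y u - y (u * real (k m) / real m))" using gs(1)[of m] m by simp
        qed
      qed
      ultimately have "grid_sum A y u \<phi> \<longlonglongrightarrow> \<phi> (y u)"
        by (simp cong: filterlim_cong)
      moreover have "\<not> A u" using hit u by auto
      ultimately show ?thesis by simp
    qed
  }
qed

section \<open>Reflection with drift\<close>

text \<open>Fubini for the product law, with an independent copy \<omega>' in place of the second
  coordinate. In this form the independence of past and future serves as the simple Markov
  property.\<close>

lemma (in prob_space) indep_var_integral:
  fixes f :: "'b \<times> 'b \<Rightarrow> real"
  assumes ind: "indep_var S X T Y" and f[measurable]: "f \<in> borel_measurable (S \<Otimes>\<^sub>M T)"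
    and bound: "\<And>x. \<bar>f x\<bar> \<le> K"
  shows "(LINT \<omega>|M. f (X \<omega>, Y \<omega>)) = (LINT \<omega>|M. (LINT \<omega>'|M. f (X \<omega>, Y \<omega>')))"
proof -
  have X[measurable]: "X \<in> measurable M S" and Y[measurable]: "Y \<in> measurable M T"
    using ind by (auto simp: indep_var_distribution_eq)
  interpret P: prob_space "distr M S X" by (rule prob_space_distr) fact
  interpret Q: prob_space "distr M T Y" by (rule prob_space_distr) fact
  interpret PQ: pair_prob_space "distr M S X" "distr M T Y" ..
  have inner: "(LINT y|distr M T Y. f (x, y)) = (LINT \<omega>'|M. f (x, Y \<omega>'))" if "x \<in> space S" for x
    using that by (intro integral_distr) measurable
  have "(LINT \<omega>|M. f (X \<omega>, Y \<omega>)) = (LINT z|distr M (S \<Otimes>\<^sub>M T) (\<lambda>x. (X x, Y x)). f z)"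
    by (subst integral_distr) auto
  also have "\<dots> = (LINT z|(distr M S X \<Otimes>\<^sub>M distr M T Y). f z)"
    using ind by (simp add: indep_var_distribution_eq)
  also have "\<dots> = (LINT x|distr M S X. (LINT y|distr M T Y. f (x, y)))"
    by (intro PQ.integral_fst'[symmetric] PQ.integrable_const_bound[where B=K] AE_I2) (use bound in auto)
  also have "\<dots> = (LINT x|distr M S X. (LINT \<omega>'|M. f (x, Y \<omega>')))"
    by (intro lint_cong) (auto simp: inner)
  finally have 1: "(LINT \<omega>|M. f (X \<omega>, Y \<omega>)) = (LINT x|distr M S X. (LINT \<omega>'|M. f (x, Y \<omega>')))" .
  have "(\<lambda>x. LINT y|distr M T Y. f (x, y)) \<in> borel_measurable S"
    by measurable
  then have 2: "(\<lambda>x. LINT \<omega>'|M. f (x, Y \<omega>')) \<in> borel_measurable S"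
    by (simp add: inner cong: measurable_cong)
  show ?thesis
    unfolding 1 by (subst integral_distr) (use 2 in auto)
qed

text \<open>The survival event as a subset of path space. The horizon \<open>c\<close> may exceed
  \<open>q\<close>, so that survival up to two different times can be compared within the same
  past.\<close>

definition surviving :: "real \<Rightarrow> real \<Rightarrow> real \<Rightarrow> real \<Rightarrow> (real \<Rightarrow> real) set" where
  "surviving a b c q = {x\<in>space (borel_on {0..c}). below_rat 0 q (\<lambda>r. x r - a * r - b)}"

lemma sets_surviving [measurable]:
  assumes "q \<le> c"
  shows "surviving a b c q \<in> sets (borel_on {0..c})"
  unfolding surviving_def pred_def[symmetric]
proof (rule measurable_below_rat)
  fix r assume "0 \<le> r" "r < q"
  then have "(\<lambda>x. x r) \<in> borel_measurable (borel_on {0..c})"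
    using assms by (intro measurable_component_singleton) auto
  then show "(\<lambda>x. x r - a * r - b) \<in> borel_measurable (borel_on {0..c})" by simp
qed

context brownian
begin

lemma past_measurable: "(\<lambda>\<omega>. \<lambda>s\<in>{0..q}. B s \<omega>) \<in> measurable M (borel_on {0..q})"
  by (intro measurable_restrict B_measurable) auto

lemma B_right_continuous:
  assumes "\<omega> \<in> space M" "0 \<le> r"
  shows "continuous (at_right r) (\<lambda>s. B s \<omega>)"
proof -
  have "continuous (at r within {0..}) (\<lambda>s. B s \<omega>)"
    using B_continuous[OF assms(1)] assms(2) by (simp add: continuous_on_eq_continuous_within)
  then show ?thesis by (rule continuous_within_subset) (use assms in auto)
qed

lemma below_iff_surviving:
  assumes "\<omega> \<in> space M" "q \<le> c"
  shows "below 0 q (\<lambda>r. B r \<omega> - a * r - b) \<longleftrightarrow> (\<lambda>s\<in>{0..c}. B s \<omega>) \<in> surviving a b c q"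
proof -
  have "below 0 q (\<lambda>r. B r \<omega> - a * r - b) \<longleftrightarrow> below_rat 0 q (\<lambda>r. B r \<omega> - a * r - b)"
    by (intro below_iff_rat continuous_intros B_right_continuous assms) auto
  also have "\<dots> \<longleftrightarrow> below_rat 0 q (\<lambda>r. (\<lambda>s\<in>{0..c}. B s \<omega>) r - a * r - b)"
    using assms(2) by (auto simp: below_rat_def)
  also have "\<dots> \<longleftrightarrow> (\<lambda>s\<in>{0..c}. B s \<omega>) \<in> surviving a b c q"
    by (simp add: surviving_def space_PiM)
  finally show ?thesis .
qed

lemma below_event [measurable]: "Measurable.pred M (\<lambda>\<omega>. below 0 q (\<lambda>r. B r \<omega> - a * r - b))"
proof -
  have "Measurable.pred M (\<lambda>\<omega>. (\<lambda>s\<in>{0..q}. B s \<omega>) \<in> surviving a b q q)"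
    using past_measurable[of q] by measurable
  then show ?thesis by (simp add: below_iff_surviving[where c=q] cong: measurable_cong)
qed

lemma increment_integral:
  assumes "0 \<le> q" "q < u" and g[measurable]: "g \<in> borel_measurable borel"
  shows "(LINT \<omega>|M. g (\<alpha> - (B u \<omega> - B q \<omega>))) = (LINT y|lborel. gauss ((u - q)) (\<alpha> - y) * (g y :: real))"
proof -
  have "(LINT \<omega>|M. g (\<alpha> - (B u \<omega> - B q \<omega>))) = (LINT x|lborel. gauss ((u - q)) x * g (\<alpha> - x))"
    by (rule distributed_integral[symmetric, OF B_increment[OF assms(1,2)]]) auto
  also have "\<dots> = (LINT y|lborel. gauss ((u - q)) (\<alpha> - y) * g y)"
    by (subst lborel_integral_real_affine[where c="-1" and t=\<alpha>]) auto
  finally show ?thesis .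
qed

lemma B_integral:
  assumes "0 < u" and g[measurable]: "g \<in> borel_measurable borel"
  shows "(LINT \<omega>|M. g (\<alpha> - B u \<omega>)) = (LINT y|lborel. gauss u (\<alpha> - y) * (g y :: real))"
proof -
  have "(LINT \<omega>|M. g (\<alpha> - B u \<omega>)) = (LINT \<omega>|M. g (\<alpha> - (B u \<omega> - B 0 \<omega>)))"
    by (intro lint_cong) (auto simp: B_0)
  then show ?thesis using increment_integral[of 0 u g \<alpha>] assms by simp
qed

lemma AE_B_neq:
  assumes "0 < u" shows "AE \<omega> in M. B u \<omega> \<noteq> x"
proof -
  have "distributed M lborel (\<lambda>\<omega>. B u \<omega> - B 0 \<omega>) (gauss u)"
    using B_increment[of 0 u] assms by simp
  from distributed_emeasure[OF this, of "{x}"]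
  moreover have "(\<integral>\<^sup>+ y. ennreal (gauss u y) * indicator {x} y \<partial>lborel) = 0"
    by (subst nn_integral_0_iff_AE) (use AE_lborel_singleton[of x] in \<open>auto simp: indicator_def\<close>)
  ultimately have "emeasure M ((\<lambda>\<omega>. B u \<omega> - B 0 \<omega>) -` {x} \<inter> space M) = 0"
    by simp
  then have "emeasure M {\<omega>\<in>space M. \<not> B u \<omega> \<noteq> x} = 0"
    by (simp add: vimage_def Int_def B_0 conj_commute cong: conj_cong)
  moreover have "{\<omega>\<in>space M. \<not> B u \<omega> \<noteq> x} \<in> sets M"
    using measurable_sets[OF B_measurable[of u], of "{x}"] assms
    by (simp add: vimage_def Int_def conj_commute)
  ultimately show ?thesis
    by (intro AE_I[OF subset_refl])
qed

end

text \<open>The two squares differ by 4 y (b + a v). Divided by 2 v this is 2 a y, which the tilt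
  cancels, plus 2 b y / v, which is the exponent on the right.\<close>

lemma normal_density_reflect:
  assumes "0 < v"
  shows "gauss v (b + a * v + y) * exp (2 * a * y) =
    gauss v (b + a * v - y) * exp (- 2 * b * y / v)"
proof -
  have "- (b + a * v + y)\<^sup>2 / (2 * v) + 2 * a * y = - (b + a * v - y)\<^sup>2 / (2 * v) + - 2 * b * y / v"
    using assms by (simp add: field_simps power2_eq_square)
  then show ?thesis
    using assms by (simp add: normal_density_def exp_add[symmetric])
qed

text \<open>With \<open>b = 0\<close> the exponential on the right is 1, and this is the symmetry
  used after a past event; with positive \<open>b\<close> it produces the bridge factor.\<close>

lemma normal_reflect_integral:
  assumes "0 < v"
  shows "(LINT y|lborel. gauss v (b + a * v - y) * (g (- y) * exp (- 2 * a * y))) =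
    (LINT y|lborel. gauss v (b + a * v - y) * (g y * exp (- 2 * b * y / v)))"
proof -
  have "(LINT y|lborel. gauss v (b + a * v - y) * (g (- y) * exp (- 2 * a * y))) =
    (LINT y|lborel. gauss v (b + a * v + y) * (g y * exp (2 * a * y)))"
    by (subst lborel_integral_real_affine[where c="-1" and t=0]) auto
  also have "\<dots> = (LINT y|lborel. gauss v (b + a * v - y) * (g y * exp (- 2 * b * y / v)))"
    using normal_density_reflect[OF assms, of b a]
    by (intro lint_cong refl) (simp add: mult_ac)
  finally show ?thesis .
qed

lemma isCont_indicator_interval:
  assumes "x \<noteq> z" "x \<noteq> z'"
  shows "isCont (indicator {z<..z'} :: real \<Rightarrow> real) x"
proof (cases "z < x \<and> x < z'")
  case True
  then have "\<forall>\<^sub>F y in nhds x. y \<in> {z<..<z'}" by (intro eventually_nhds_in_open) auto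
  then have "\<forall>\<^sub>F y in nhds x. indicator {z<..z'} y = (1::real)" by eventually_elim auto
  then show ?thesis by (subst isCont_cong) auto
next
  case False
  then have "x \<in> {..<z} \<union> {z'<..}" using assms by (cases "z \<le> z'") auto
  then have "\<forall>\<^sub>F y in nhds x. y \<in> {..<z} \<union> {z'<..}"
    by (intro eventually_nhds_in_open) auto
  then have "\<forall>\<^sub>F y in nhds x. indicator {z<..z'} y = (0::real)" by eventually_elim auto
  then show ?thesis by (subst isCont_cong) auto
qed

text \<open>Where the indicator is 1, the exponent lies between its values at the two ends, whatever
  the sign of \<open>a\<close>. The 1 makes the same constant bound the plain indicator as
  well.\<close>

lemma tilted_indicator_bound:
  "\<bar>indicator {z<..z'} (- y) * exp (- 2 * a * y)\<bar> \<le> max 1 (max (exp (2 * a * z)) (exp (2 * a * z')))" for y :: real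
proof (cases "z < - y \<and> - y \<le> z'")
  case True
  have "a * - y \<le> a * z' \<or> a * - y \<le> a * z"
  proof (cases "0 \<le> a")
    case True
    then show ?thesis using mult_left_mono[of "- y" z' a] \<open>z < - y \<and> - y \<le> z'\<close> by auto
  next
    case False
    then show ?thesis using mult_left_mono_neg[of z "- y" a] \<open>z < - y \<and> - y \<le> z'\<close> by auto
  qed
  then have "- 2 * a * y \<le> 2 * a * z \<or> - 2 * a * y \<le> 2 * a * z'" by auto
  then show ?thesis by (auto simp: le_max_iff_disj indicator_def)
next
  case False
  then show ?thesis by (auto simp: indicator_def)
qed

context brownian
begin

text \<open>After a past event \<open>A\<close>, the increment of \<open>b + a s - B s\<close> from \<open>q\<close> to \<open>u\<close> may be
  reflected, at the price of the likelihood ratio \<open>exp (- 2 a y)\<close>.\<close>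
lemma reflect_after_past:
  assumes q: "0 \<le> q" "q < u" and A[measurable]: "A \<in> sets (borel_on {0..q})"
  shows "(LINT \<omega>|M. indicator A (\<lambda>s\<in>{0..q}. B s \<omega>) * indicator {z<..z'} (a * (u - q) - (B u \<omega> - B q \<omega>))) =
    (LINT \<omega>|M. indicator A (\<lambda>s\<in>{0..q}. B s \<omega>) * (indicator {z<..z'} (- (a * (u - q) - (B u \<omega> - B q \<omega>)))
       * exp (- 2 * a * (a * (u - q) - (B u \<omega> - B q \<omega>)))) :: real)"
proof -
  define g where "g y = indicator {z<..z'} (- y) * exp (- 2 * a * y)" for y :: real
  define K where "K = max 1 (max (exp (2 * a * z)) (exp (2 * a * z')))"
  have g_bound: "\<bar>g y\<bar> \<le> K" for y
    unfolding g_def K_def by (rule tilted_indicator_bound)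
  have g[measurable]: "g \<in> borel_measurable borel" unfolding g_def by measurable
  note ind = indep_past_future[OF q(1)]
  have factor: "(LINT \<omega>|M. indicator A (\<lambda>s\<in>{0..q}. B s \<omega>) * f (a * (u - q) - (B u \<omega> - B q \<omega>))) =
      (LINT \<omega>|M. indicator A (\<lambda>s\<in>{0..q}. B s \<omega>) * (LINT y|lborel. gauss ((u - q)) (a * (u - q) - y) * f y))"
    if f[measurable]: "f \<in> borel_measurable borel" and b: "\<And>y. \<bar>f y\<bar> \<le> K" for f :: "real \<Rightarrow> real"
  proof -
    define F where "F = (\<lambda>(x, w). indicator A x * f (a * (u - q) - w (u - q)) :: real)"
    have [measurable]: "(\<lambda>w. w (u - q)) \<in> borel_measurable (borel_on {0..})"
      by (rule measurable_component_singleton) (use q in auto)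
    have F: "F \<in> borel_measurable (borel_on {0..q} \<Otimes>\<^sub>M borel_on {0..})"
      unfolding F_def by measurable
    have FK: "\<bar>F x\<bar> \<le> K" for x
      using b by (auto simp: F_def indicator_def K_def split: prod.splits)
    from indep_var_integral[OF ind F FK] have
      "(LINT \<omega>|M. indicator A (\<lambda>s\<in>{0..q}. B s \<omega>) * f (a * (u - q) - (B u \<omega> - B q \<omega>))) =
       (LINT \<omega>|M. (LINT \<omega>'|M. indicator A (\<lambda>s\<in>{0..q}. B s \<omega>) * f (a * (u - q) - (B u \<omega>' - B q \<omega>'))))"
      using q by (simp add: F_def)
    then show ?thesis
      by (simp add: increment_integral[OF q f])
  qed
  have "(LINT y|lborel. gauss ((u - q)) (a * (u - q) - y) * indicator {z<..z'} y) =
    (LINT y|lborel. gauss ((u - q)) (a * (u - q) - y) * g y)"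
    using normal_reflect_integral[of "u - q" 0 a "indicator {z<..z'}"] q unfolding g_def by simp
  moreover have "\<bar>indicator {z<..z'} y\<bar> \<le> K" for y :: real
    by (auto simp: K_def indicator_def)
  ultimately show ?thesis
    using factor[of "indicator {z<..z'}"] factor[OF g g_bound] by (simp add: g_def)
qed

text \<open>On the grid, the sum over cells is a sum over the time at which the crossing is
  detected, and each term is reflected separately as an event of the past followed by an increment.
  Both sides are then limits of integrals of \<open>grid_sum\<close> by dominated
  convergence.\<close>

lemma crossing_reflection:
  fixes a b u z z' :: real
  assumes u: "0 < u" and b: "0 < b"
  defines "Y \<equiv> \<lambda>\<omega>. b + a * u - B u \<omega>"
    and "alive \<equiv> \<lambda>q \<omega>. below 0 q (\<lambda>r. B r \<omega> - a * r - b)"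
  shows "(LINT \<omega>|M. (if alive u \<omega> then 0 else indicator {z<..z'} (Y \<omega>))) =
    (LINT \<omega>|M. (if alive u \<omega> then 0 else indicator {z<..z'} (- Y \<omega>) * exp (- 2 * a * Y \<omega>)) :: real)"
proof -
  define \<phi>1 :: "real \<Rightarrow> real" where "\<phi>1 = indicator {z<..z'}"
  define \<phi>2 where "\<phi>2 y = indicator {z<..z'} (- y) * exp (- 2 * a * y)" for y :: real
  define K where "K = max 1 (max (exp (2 * a * z)) (exp (2 * a * z')))"
  have K1: "\<bar>\<phi>1 y\<bar> \<le> K" for y by (auto simp: \<phi>1_def K_def indicator_def)
  have K2: "\<bar>\<phi>2 y\<bar> \<le> K" for y
    unfolding \<phi>2_def K_def by (rule tilted_indicator_bound)
  have meas[measurable]: "\<phi>1 \<in> borel_measurable borel" "\<phi>2 \<in> borel_measurable borel"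
    unfolding \<phi>1_def \<phi>2_def by measurable
  define y where "y \<omega> s = b + a * s - B s \<omega>" for \<omega> s
  have [measurable]: "B u \<in> borel_measurable M" using u by (intro B_measurable) auto
  have alive_meas[measurable]: "Measurable.pred M (alive q)" for q unfolding alive_def by measurable
  have cont: "continuous_on {0..u} (y \<omega>)" if "\<omega> \<in> space M" for \<omega>
    unfolding y_def using B_continuous[OF that]
    by (intro continuous_intros) (auto elim: continuous_on_subset)
  have y0: "0 < y \<omega> 0" if "\<omega> \<in> space M" for \<omega> using b B_0[OF that] by (simp add: y_def)
  have A0: "alive 0 \<omega>" for \<omega> by (simp add: alive_def below_def)
  have A: "alive q \<omega> \<longleftrightarrow> (\<forall>s\<in>{0..q}. 0 < y \<omega> s)" if "\<omega> \<in> space M" "0 < q" "q \<le> u" for q \<omega>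
    unfolding alive_def y_def
    by (subst below_continuous_iff) (use that B_continuous[OF that(1)] in \<open>auto intro!: continuous_intros elim: continuous_on_subset\<close>)
  note gs = grid_sum_bound[OF cont y0 u A0 A] grid_sum_tendsto[OF cont y0 u A0 A]
  have gs_integral: "(LINT \<omega>|M. grid_sum (\<lambda>q. alive q \<omega>) (y \<omega>) u \<phi>1 m) =
     (LINT \<omega>|M. grid_sum (\<lambda>q. alive q \<omega>) (y \<omega>) u \<phi>2 m)" for m
  proof -
    define t where "t \<phi> i \<omega> = (if alive (u * real i / real m) \<omega> \<and> \<not> alive (u * real (Suc i) / real m) \<omega>
        then \<phi> (y \<omega> u - y \<omega> (u * real (Suc i) / real m)) else 0)" for \<phi> :: "real \<Rightarrow> real" and i \<omega>
    have t_int: "integrable M (t \<phi> i)" if [measurable]: "\<phi> \<in> borel_measurable borel" and K: "\<And>x. \<bar>\<phi> x\<bar> \<le> K" for \<phi> i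
    proof (rule integrable_const_bound[where B=K])
      have [measurable]: "B (u * real (Suc i) / real m) \<in> borel_measurable M"
        using u by (intro B_measurable) auto
      show "t \<phi> i \<in> borel_measurable M" unfolding t_def y_def by measurable
      have "0 \<le> K" using K[of 0] by linarith
      then show "AE \<omega> in M. norm (t \<phi> i \<omega>) \<le> K" using K by (auto simp: t_def)
    qed
    have "(LINT \<omega>|M. t \<phi>1 i \<omega>) = (LINT \<omega>|M. t \<phi>2 i \<omega>)" if i: "i < m - 1" for i
    proof -
      define q0 q where "q0 = u * real i / real m" and "q = u * real (Suc i) / real m"
      have q: "0 \<le> q" "q < u" "q0 \<le> q"
        using i u mult_strict_left_mono[of "real (Suc i)" "real m" u]
        by (auto simp: q0_def q_def divide_simps mult_left_mono)
      \<comment> \<open>Alive at the start of the cell and dead at its end: an event of the past up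
        to \<open>q\<close>.\<close>
      define H where "H = surviving a b q q0 - surviving a b q q"
      have H: "H \<in> sets (borel_on {0..q})" unfolding H_def using q by auto
      have t_eq: "t \<phi> i \<omega> = indicator H (\<lambda>s\<in>{0..q}. B s \<omega>) * \<phi> (a * (u - q) - (B u \<omega> - B q \<omega>))"
        if "\<omega> \<in> space M" for \<omega> \<phi>
        using below_iff_surviving[OF that q(3), of a b] below_iff_surviving[OF that order_refl, of q a b]
        unfolding t_def H_def alive_def q0_def[symmetric] q_def[symmetric]
        by (simp add: y_def algebra_simps)
      show ?thesis
        using reflect_after_past[OF q(1,2) H, of z z' a]
        by (simp add: t_eq \<phi>1_def \<phi>2_def cong: lint_cong)
    qed
    then show ?thesis
      unfolding grid_sum_def t_def[symmetric]
      by (subst (1 2) Bochner_Integration.integral_sum) (auto intro!: t_int K1 K2)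
  qed
  have gs_meas: "(\<lambda>\<omega>. grid_sum (\<lambda>q. alive q \<omega>) (y \<omega>) u \<phi> m) \<in> borel_measurable M"
    if [measurable]: "\<phi> \<in> borel_measurable borel" for \<phi> m
    unfolding grid_sum_def y_def
  proof (intro borel_measurable_sum)
    fix i
    have [measurable]: "B (u * real (Suc i) / real m) \<in> borel_measurable M"
        using u by (intro B_measurable) auto
    show "(\<lambda>\<omega>. if alive (u * real i / real m) \<omega> \<and> \<not> alive (u * real (Suc i) / real m) \<omega>
      then \<phi> (b + a * u - B u \<omega> - (b + a * (u * real (Suc i) / real m) - B (u * real (Suc i) / real m) \<omega>)) else 0) \<in> borel_measurable M"
      by measurable
  qed
  have lim: "(\<lambda>m. LINT \<omega>|M. grid_sum (\<lambda>q. alive q \<omega>) (y \<omega>) u \<phi> m) \<longlonglongrightarrow> (LINT \<omega>|M. (if alive u \<omega> then 0 else \<phi> (Y \<omega>)))"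
    if [measurable]: "\<phi> \<in> borel_measurable borel" and K: "\<And>x. \<bar>\<phi> x\<bar> \<le> K"
      and cont: "\<And>x. x \<notin> {z, z', - z, - z'} \<Longrightarrow> isCont \<phi> x" for \<phi>
  proof (rule integral_dominated_convergence[where w="\<lambda>_. K"])
    show "AE \<omega> in M. (\<lambda>m. grid_sum (\<lambda>q. alive q \<omega>) (y \<omega>) u \<phi> m) \<longlonglongrightarrow> (if alive u \<omega> then 0 else \<phi> (Y \<omega>))"
      \<comment> \<open>The final value has to avoid 0, where the first zero could be
        \<open>u\<close> itself, and the points z, z', - z, - z', where one of the two test
        functions may jump.\<close>
      using AE_B_neq[OF u, of "b + a * u"] AE_B_neq[OF u, of "b + a * u - z"] AE_B_neq[OF u, of "b + a * u - z'"]
        AE_B_neq[OF u, of "b + a * u + z"] AE_B_neq[OF u, of "b + a * u + z'"] AE_space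
    proof eventually_elim
      case (elim \<omega>)
      then have "Y \<omega> \<notin> {z, z', - z, - z'}" "Y \<omega> \<noteq> 0" by (auto simp: Y_def)
      moreover have yu: "y \<omega> u = Y \<omega>" by (simp add: y_def Y_def)
      ultimately show ?case
        using gs(2)[OF elim(6) elim(6) elim(6), of \<phi>, unfolded yu] cont[of "Y \<omega>"] by blast
    qed
    show "AE \<omega> in M. norm (grid_sum (\<lambda>q. alive q \<omega>) (y \<omega>) u \<phi> m) \<le> K" for m
      using gs(1)[of _ \<phi>] K by (auto intro!: AE_I2)
    show "(\<lambda>\<omega>. if alive u \<omega> then 0 else \<phi> (Y \<omega>)) \<in> borel_measurable M"
      unfolding Y_def by measurable
  qed (use gs_meas[of \<phi>] in auto)
  have "(LINT \<omega>|M. (if alive u \<omega> then 0 else \<phi>1 (Y \<omega>))) = (LINT \<omega>|M. (if alive u \<omega> then 0 else \<phi>2 (Y \<omega>)))"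
  proof (rule LIMSEQ_unique)
    show "(\<lambda>m. LINT \<omega>|M. grid_sum (\<lambda>q. alive q \<omega>) (y \<omega>) u \<phi>1 m) \<longlonglongrightarrow> (LINT \<omega>|M. (if alive u \<omega> then 0 else \<phi>1 (Y \<omega>)))"
      by (intro lim K1 meas) (auto simp: \<phi>1_def intro!: isCont_indicator_interval)
    have "isCont \<phi>2 x" if "x \<notin> {z, z', - z, - z'}" for x
    proof -
      have "isCont (\<lambda>y. indicator {z<..z'} (- y) :: real) x"
        by (rule isCont_o2[where g="indicator {z<..z'}"]) (use that in \<open>auto intro!: isCont_indicator_interval\<close>)
      then show ?thesis unfolding \<phi>2_def by (intro continuous_intros)
    qed
    then show "(\<lambda>m. LINT \<omega>|M. grid_sum (\<lambda>q. alive q \<omega>) (y \<omega>) u \<phi>1 m) \<longlonglongrightarrow> (LINT \<omega>|M. (if alive u \<omega> then 0 else \<phi>2 (Y \<omega>)))"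
      unfolding gs_integral by (intro lim K2 meas)
  qed
  then show ?thesis unfolding \<phi>1_def \<phi>2_def .
qed

end

section \<open>The law of a Brownian motion staying below a line\<close>

text \<open>The probability that the barrier \<open>a s + b\<close> is not crossed on \<open>[0, u]\<close> by the
  Brownian bridge from \<open>0\<close> to \<open>x\<close>.\<close>
definition bridge_factor :: "real \<Rightarrow> real \<Rightarrow> real \<Rightarrow> real \<Rightarrow> real" where
  "bridge_factor a b u x = 1 - exp (- 2 * b * (a * u + b - x) / u)"

lemma measurable_bridge_factor [measurable]: "bridge_factor a b u \<in> borel_measurable borel"
  unfolding bridge_factor_def by measurable

context brownian
begin

lemma surviving_interval:
  assumes u: "0 < u" and b: "0 < b" and z: "0 \<le> z"
  shows "(LINT \<omega>|M. (if below 0 u (\<lambda>r. B r \<omega> - a * r - b) then indicator {z<..z'} (b + a * u - B u \<omega>) else 0)) =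
    (LINT y|lborel. gauss u (b + a * u - y) * (indicator {z<..z'} y * (1 - exp (- 2 * b * y / u))) :: real)"
proof -
  define Y where "Y \<omega> = b + a * u - B u \<omega>" for \<omega>
  define alive where "alive \<omega> = below 0 u (\<lambda>r. B r \<omega> - a * r - b)" for \<omega>
  have [measurable]: "B u \<in> borel_measurable M" using u by (intro B_measurable) auto
  have [measurable]: "Measurable.pred M alive" unfolding alive_def by measurable
  have [measurable]: "Y \<in> borel_measurable M" unfolding Y_def by measurable
  define g where "g y = indicator {z<..z'} (- y) * exp (- 2 * a * y)" for y :: real
  have [measurable]: "g \<in> borel_measurable borel" unfolding g_def by measurable
  note K = tilted_indicator_bound[of z z' _ a, folded g_def]
  have dead: "\<not> alive \<omega>" if "\<omega> \<in> space M" "g (Y \<omega>) \<noteq> 0" for \<omega>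
  proof -
    have "Y \<omega> < 0" using that(2) z by (auto simp: g_def indicator_def split: if_splits)
    moreover have "alive \<omega> \<longleftrightarrow> (\<forall>r\<in>{0..u}. B r \<omega> - a * r - b < 0)"
      unfolding alive_def using u B_continuous[OF that(1)]
      by (subst below_continuous_iff) (auto intro!: continuous_intros elim: continuous_on_subset)
    ultimately show ?thesis using u by (auto simp: Y_def intro!: bexI[of _ u])
  qed
  have int1: "integrable M (\<lambda>\<omega>. indicator {z<..z'} (Y \<omega>) :: real)"
    by (rule integrable_const_bound[where B=1]) (auto simp: indicator_def)
  have int2: "integrable M (\<lambda>\<omega>. if alive \<omega> then 0 else indicator {z<..z'} (Y \<omega>) :: real)"
    by (rule integrable_const_bound[where B=1]) (auto simp: indicator_def)
  have int3: "integrable M (\<lambda>\<omega>. g (Y \<omega>))"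
    by (rule integrable_const_bound[OF AE_I2]) (use K in \<open>auto simp: real_norm_def\<close>)
  have "(LINT \<omega>|M. (if alive \<omega> then indicator {z<..z'} (Y \<omega>) else 0)) =
    (LINT \<omega>|M. (indicator {z<..z'} (Y \<omega>) - (if alive \<omega> then 0 else indicator {z<..z'} (Y \<omega>)) :: real))"
    by (intro lint_cong) auto
  also have "\<dots> = (LINT \<omega>|M. indicator {z<..z'} (Y \<omega>)) - (LINT \<omega>|M. (if alive \<omega> then 0 else indicator {z<..z'} (Y \<omega>)))"
    using int1 int2 by simp
  also have "(LINT \<omega>|M. (if alive \<omega> then 0 else indicator {z<..z'} (Y \<omega>))) = (LINT \<omega>|M. (if alive \<omega> then 0 else g (Y \<omega>)))"
    unfolding alive_def Y_def g_def by (rule crossing_reflection[OF u b])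
  also have "\<dots> = (LINT \<omega>|M. g (Y \<omega>))"
    using dead by (intro lint_cong) auto
  also have "(LINT \<omega>|M. indicator {z<..z'} (Y \<omega>)) - \<dots> =
     (LINT y|lborel. gauss u (b + a * u - y) * indicator {z<..z'} y) -
     (LINT y|lborel. gauss u (b + a * u - y) * g y)"
    unfolding Y_def by (subst (1 2) B_integral[OF u]) auto
  also have "(LINT y|lborel. gauss u (b + a * u - y) * g y) =
     (LINT y|lborel. gauss u (b + a * u - y) * (indicator {z<..z'} y * exp (- 2 * b * y / u)))"
    unfolding g_def by (rule normal_reflect_integral[OF u])
  also have "(LINT y|lborel. gauss u (b + a * u - y) * indicator {z<..z'} y) - \<dots> =
    (LINT y|lborel. gauss u (b + a * u - y) * indicator {z<..z'} y -
       gauss u (b + a * u - y) * (indicator {z<..z'} y * exp (- 2 * b * y / u)))"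
  proof (rule Bochner_Integration.integral_diff[symmetric])
    have nd: "integrable lborel (\<lambda>y. gauss u (b + a * u - y))"
      using integrable_normal_density[of "sqrt u" 0] lborel_integrable_real_affine[of "gauss u" "-1" "b + a * u"] u
      by auto
    show "integrable lborel (\<lambda>y. gauss u (b + a * u - y) * indicator {z<..z'} y)"
      by (rule Bochner_Integration.integrable_bound[OF nd]) (auto simp: indicator_def)
    show "integrable lborel (\<lambda>y. gauss u (b + a * u - y) * (indicator {z<..z'} y * exp (- 2 * b * y / u)))"
      by (rule Bochner_Integration.integrable_bound[OF nd])
         (use u b z in \<open>auto simp: indicator_def abs_mult intro!: AE_I2 mult_left_le divide_nonneg_pos\<close>)
  qed
  also have "\<dots> = (LINT y|lborel. gauss u (b + a * u - y) * (indicator {z<..z'} y * (1 - exp (- 2 * b * y / u))))"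
    by (intro lint_cong) (auto simp: algebra_simps)
  finally show ?thesis unfolding Y_def alive_def .
qed

text \<open>Half-lines determine a finite measure. They are increasing unions of the intervals
  already treated, and neither measure charges the nonpositive half-line, so starting points below 0
  can be replaced by 0.\<close>

lemma surviving_distr:
  assumes u: "0 < u" and b: "0 < b"
  shows "distr (density M (indicator {\<omega>\<in>space M. below 0 u (\<lambda>r. B r \<omega> - a * r - b)})) borel (\<lambda>\<omega>. b + a * u - B u \<omega>) =
    density lborel (\<lambda>y. ennreal (gauss u (b + a * u - y) * (indicator {0<..} y * (1 - exp (- 2 * b * y / u)))))"
    (is "?L = density lborel (\<lambda>y. ennreal (?h y))")
proof -
  define Y where "Y \<omega> = b + a * u - B u \<omega>" for \<omega>
  define S where "S = {\<omega>\<in>space M. below 0 u (\<lambda>r. B r \<omega> - a * r - b)}"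
  have [measurable]: "B u \<in> borel_measurable M" using u by (intro B_measurable) auto
  have [measurable]: "Y \<in> borel_measurable M" unfolding Y_def by measurable
  have S[measurable]: "S \<in> sets M" unfolding S_def by measurable
  have L: "emeasure ?L A = emeasure M (S \<inter> Y -` A)" if [measurable]: "A \<in> sets borel" for A
  proof -
    have m: "Y -` A \<inter> space M \<in> sets M" by measurable
    have "emeasure ?L A = emeasure (density M (indicator S)) (Y -` A \<inter> space M)"
      unfolding S_def[symmetric] Y_def[symmetric] by (subst emeasure_distr) auto
    also have "\<dots> = (\<integral>\<^sup>+ x. indicator S x * indicator (Y -` A \<inter> space M) x \<partial>M)"
      using m by (subst emeasure_density) auto
    also have "\<dots> = (\<integral>\<^sup>+ x. indicator (S \<inter> (Y -` A \<inter> space M)) x \<partial>M)"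
      by (intro nn_integral_cong) (auto simp: indicator_def)
    also have "\<dots> = emeasure M (S \<inter> (Y -` A \<inter> space M))"
      using m by (intro nn_integral_indicator) auto
    also have "S \<inter> (Y -` A \<inter> space M) = S \<inter> Y -` A" by (auto simp: S_def)
    finally show ?thesis .
  qed
  have h[measurable]: "?h \<in> borel_measurable borel" by measurable
  have hpos: "0 \<le> ?h y" for y
    using u b by (auto simp: indicator_def intro!: mult_nonneg_nonneg divide_nonneg_pos)
  have nd: "integrable lborel (\<lambda>y. gauss u (b + a * u - y))"
    using integrable_normal_density[of "sqrt u" 0] lborel_integrable_real_affine[of "gauss u" "-1" "b + a * u"] u
    by auto
  have hint: "integrable lborel ?h"
    by (rule Bochner_Integration.integrable_bound[OF nd])
       (use u b in \<open>auto simp: indicator_def abs_mult intro!: AE_I2 mult_left_le divide_nonneg_pos\<close>)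
  have interval: "emeasure ?L {z<..z'} = emeasure (density lborel ?h) {z<..z'}" if z: "0 \<le> z" for z z'
  proof -
    have [measurable]: "S \<inter> Y -` {z<..z'} \<in> sets M"
    proof -
      have "S \<inter> Y -` {z<..z'} = S \<inter> (Y -` {z<..z'} \<inter> space M)" by (auto simp: S_def)
      then show ?thesis by simp
    qed
    have "emeasure ?L {z<..z'} = ennreal (LINT \<omega>|M. indicator (S \<inter> Y -` {z<..z'}) \<omega>)"
      by (subst L) (auto simp: emeasure_eq_measure)
    also have "(LINT \<omega>|M. indicator (S \<inter> Y -` {z<..z'}) \<omega>) =
      (LINT \<omega>|M. (if below 0 u (\<lambda>r. B r \<omega> - a * r - b) then indicator {z<..z'} (b + a * u - B u \<omega>) else 0) :: real)"
      by (intro lint_cong) (auto simp: S_def Y_def indicator_def)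
    also have "\<dots> = (LINT y|lborel. gauss u (b + a * u - y) * (indicator {z<..z'} y * (1 - exp (- 2 * b * y / u))))"
      by (rule surviving_interval[OF u b z])
    also have "\<dots> = (LINT y|lborel. ?h y * indicator {z<..z'} y)"
      using z by (intro lint_cong) (auto simp: indicator_def)
    also have "ennreal \<dots> = (\<integral>\<^sup>+ y. ennreal (?h y * indicator {z<..z'} y) \<partial>lborel)"
    proof (rule nn_integral_eq_integral[symmetric])
      show "integrable lborel (\<lambda>y. ?h y * indicator {z<..z'} y)"
        by (rule Bochner_Integration.integrable_bound[OF hint]) (auto simp: indicator_def)
      show "AE y in lborel. 0 \<le> ?h y * indicator {z<..z'} y"
        by (rule AE_I2, rule mult_nonneg_nonneg[OF hpos]) auto
    qed
    also have "\<dots> = emeasure (density lborel ?h) {z<..z'}"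
      using hpos by (subst emeasure_density) (auto intro!: nn_integral_cong simp: indicator_def)
    finally show ?thesis .
  qed
  have pos_tail: "emeasure ?L {z<..} = emeasure (density lborel ?h) {z<..}" if z: "0 \<le> z" for z
  proof -
    have "(SUP n. emeasure ?L {z<..real n}) = emeasure ?L (\<Union>n. {z<..real n})"
      by (intro SUP_emeasure_incseq) (auto simp: incseq_def)
    moreover have "(SUP n. emeasure (density lborel ?h) {z<..real n}) = emeasure (density lborel ?h) (\<Union>n. {z<..real n})"
      by (intro SUP_emeasure_incseq) (auto simp: incseq_def)
    moreover have "(\<Union>n. {z<..real n}) = {z<..}" by (auto intro: real_arch_simple)
    ultimately show ?thesis using interval[OF z] by simp
  qed
  have Y_pos: "0 < Y \<omega>" if "\<omega> \<in> S" for \<omega>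
  proof -
    have w: "\<omega> \<in> space M" "below 0 u (\<lambda>r. B r \<omega> - a * r - b)" using that by (auto simp: S_def)
    then have "\<forall>r\<in>{0..u}. B r \<omega> - a * r - b < 0"
      using u B_continuous[OF w(1)]
      by (subst (asm) below_continuous_iff) (auto intro!: continuous_intros elim: continuous_on_subset)
    from this[rule_format, of u] show ?thesis using u by (auto simp: Y_def)
  qed
  show ?thesis
  proof (rule measure_eqI_lessThan)
    fix x :: real
    have "emeasure ?L {x<..} \<le> emeasure M (space M)"
      by (subst L) (auto intro!: emeasure_mono simp: S_def)
    then show "emeasure ?L {x<..} < \<infinity>" by (simp add: emeasure_space_1 le_less_trans)
    have "emeasure ?L {x<..} = emeasure ?L {max x 0<..}"
      using Y_pos by (subst (1 2) L) (auto intro!: arg_cong[where f="emeasure M"])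
    also have "\<dots> = emeasure (density lborel ?h) {max x 0<..}" by (rule pos_tail) simp
    also have "\<dots> = emeasure (density lborel ?h) {x<..}"
      by (subst (1 2) emeasure_density) (auto intro!: nn_integral_cong simp: indicator_def)
    finally show "emeasure ?L {x<..} = emeasure (density lborel ?h) {x<..}" .
  qed auto
qed

text \<open>The distance to the barrier is turned back into the position. The value
  \<open>b = 0\<close> is allowed because the closed integration range of the preceding segment
  includes it; then survival fails at time 0 and the bridge factor is 0.\<close>

lemma surviving_integral:
  fixes g :: "real \<Rightarrow> real"
  assumes u: "0 < u" and b: "0 \<le> b" and g[measurable]: "g \<in> borel_measurable borel"
  shows "(LINT \<omega>|M. (if below 0 u (\<lambda>r. B r \<omega> - a * r - b) then g (B u \<omega>) else 0)) =
    (LINT x|lborel. gauss u x * (indicator {..<a * u + b} x * bridge_factor a b u x * g x))"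
proof (cases "b = 0")
  case True
  have "\<not> below 0 u (\<lambda>r. B r \<omega> - a * r - b)" if "\<omega> \<in> space M" for \<omega>
    using B_0[OF that] u True by (auto simp: below_def intro!: bexI[of _ 0] simp: not_le)
  then have "(LINT \<omega>|M. (if below 0 u (\<lambda>r. B r \<omega> - a * r - b) then g (B u \<omega>) else 0)) = (LINT \<omega>|M. 0)"
    by (intro lint_cong) auto
  then show ?thesis using True by (simp add: bridge_factor_def)
next
  case False
  then have b: "0 < b" using b by simp
  define S where "S = {\<omega>\<in>space M. below 0 u (\<lambda>r. B r \<omega> - a * r - b)}"
  have [measurable]: "B u \<in> borel_measurable M" using u by (intro B_measurable) auto
  have S[measurable]: "S \<in> sets M" unfolding S_def by measurable
  define h where "h y = gauss u (b + a * u - y) * (indicator {0<..} y * (1 - exp (- 2 * b * y / u)))" for y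
  have [measurable]: "h \<in> borel_measurable borel" unfolding h_def by measurable
  have hpos: "0 \<le> h y" for y
    using u b by (auto simp: h_def indicator_def intro!: mult_nonneg_nonneg divide_nonneg_pos)
  have "(LINT \<omega>|M. (if below 0 u (\<lambda>r. B r \<omega> - a * r - b) then g (B u \<omega>) else 0)) =
    (LINT \<omega>|M. indicator S \<omega> *\<^sub>R g (b + a * u - (b + a * u - B u \<omega>)))"
    by (intro lint_cong) (auto simp: S_def indicator_def)
  also have "\<dots> = (LINT \<omega>|density M (\<lambda>\<omega>. ennreal (indicator S \<omega>)). g (b + a * u - (b + a * u - B u \<omega>)))"
    by (intro integral_density[symmetric]) auto
  also have "(\<lambda>\<omega>. ennreal (indicator S \<omega>)) = indicator S" by (auto simp: indicator_def)
  also have "(LINT \<omega>|density M (indicator S). g (b + a * u - (b + a * u - B u \<omega>))) =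
     (LINT y|distr (density M (indicator S)) borel (\<lambda>\<omega>. b + a * u - B u \<omega>). g (b + a * u - y))"
    by (subst integral_distr) auto
  also have "\<dots> = (LINT y|density lborel (\<lambda>y. ennreal (h y)). g (b + a * u - y))"
    unfolding S_def h_def surviving_distr[OF u b] ..
  also have "\<dots> = (LINT y|lborel. h y *\<^sub>R g (b + a * u - y))"
    by (intro integral_density) (auto simp: hpos)
  also have "\<dots> = (LINT x|lborel. h (b + a * u - x) * g x)"
    by (subst lborel_integral_real_affine[where c="-1" and t="b + a * u"]) auto
  also have "\<dots> = (LINT x|lborel. gauss u x * (indicator {..<a * u + b} x * bridge_factor a b u x * g x))"
    by (intro lint_cong)
       (auto simp: h_def bridge_factor_def indicator_def algebra_simps)
  finally show ?thesis .
qed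

end

section \<open>Several segments\<close>

lemma Phi_eq_integral:
  assumes "0 < u"
  shows "Phi u x = (LINT y|lborel. gauss u y * indicator {..x} y)"
proof -
  have "Phi u x = (LINT y|lborel. 1 / sqrt (2 * pi * u) * (indicator {..x} y * exp (- y\<^sup>2 / (2 * u))))"
    by (simp add: Phi_def set_lebesgue_integral_def)
  also have "\<dots> = (LINT y|lborel. gauss u y * indicator {..x} y)"
    using assms by (intro lint_cong) (auto simp: normal_density_def)
  finally show ?thesis .
qed

text \<open>A distribution on the line is determined by its distribution function; this replaces the
  Stieltjes integrals by integrals against a density.\<close>

lemma interval_measure_Phi:
  assumes u: "0 < u"
  shows "interval_measure (Phi u) = density lborel (gauss u)"
proof -
  interpret D: prob_space "density lborel (gauss u)"
    using prob_space_normal_density[of "sqrt u" 0] u by simp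
  interpret D: real_distribution "density lborel (gauss u)"
    by standard auto
  have "cdf (density lborel (gauss u)) = Phi u"
  proof
    fix x
    have "emeasure (density lborel (gauss u)) {..x} =
      (\<integral>\<^sup>+ y. ennreal (gauss u y * indicator {..x} y) \<partial>lborel)"
      by (subst emeasure_density) (auto intro!: nn_integral_cong simp: indicator_def)
    also have "\<dots> = ennreal (LINT y|lborel. gauss u y * indicator {..x} y)"
    proof (rule nn_integral_eq_integral)
      show "integrable lborel (\<lambda>y. gauss u y * indicator {..x} y)"
        by (rule Bochner_Integration.integrable_bound[OF integrable_normal_density[of "sqrt u" 0]])
          (use u in \<open>auto simp: indicator_def\<close>)
    qed auto
    finally have "emeasure (density lborel (gauss u)) {..x} = ennreal (Phi u x)"
      by (simp add: Phi_eq_integral[OF u])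
    then show "cdf (density lborel (gauss u)) x = Phi u x"
      unfolding cdf_def
      by (auto simp: measure_def Phi_eq_integral[OF u] intro!: enn2real_ennreal integral_nonneg_AE)
  qed
  moreover have "real_distribution (interval_measure (cdf (density lborel (gauss u))))"
    by (intro real_distribution_interval_measure D.cdf_nondecreasing D.cdf_is_right_cont
        D.cdf_lim_at_bot D.cdf_lim_at_top_prob)
  moreover have "cdf (interval_measure (cdf (density lborel (gauss u)))) = cdf (density lborel (gauss u))"
    by (intro cdf_interval_measure D.cdf_nondecreasing D.cdf_is_right_cont D.cdf_lim_at_bot)
  ultimately show ?thesis using cdf_unique[OF _ D.real_distribution_axioms] by metis
qed

lemma normal_integral_lessThan:
  assumes u: "0 < u"
  shows "(LINT x|lborel. gauss u (x - m) * indicator {..<c} x) = Phi 1 ((c - m) / sqrt u)"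
proof -
  have "(LINT x|lborel. gauss u (x - m) * indicator {..<c} x) =
    (LINT x|lborel. gauss u (x - m) * indicator {..c} x)"
    by (rule integral_discrete_difference[of "{c}"]) (auto simp: indicator_def)
  also have "\<dots> = sqrt u * (LINT y|lborel. gauss u (sqrt u * y) * indicator {..c} (m + sqrt u * y))"
    using u by (subst lborel_integral_real_affine[where c="sqrt u" and t=m]) auto
  also have "\<dots> = (LINT y|lborel. sqrt u * (gauss u (sqrt u * y) * indicator {..c} (m + sqrt u * y)))"
    by simp
  also have "\<dots> = (LINT y|lborel. gauss 1 y * indicator {..(c - m) / sqrt u} y)"
  proof (intro lint_cong refl)
    fix y
    have "sqrt u * gauss u (sqrt u * y) = gauss 1 y"
      using u by (simp add: normal_density_def power_mult_distrib real_sqrt_mult)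
    moreover have "m + sqrt u * y \<le> c \<longleftrightarrow> y \<le> (c - m) / sqrt u"
      using u by (simp add: field_simps)
    ultimately show "sqrt u * (gauss u (sqrt u * y) * indicator {..c} (m + sqrt u * y)) =
       gauss 1 y * indicator {..(c - m) / sqrt u} y"
      by (auto simp: indicator_def)
  qed
  finally show ?thesis by (simp add: Phi_eq_integral)
qed

text \<open>Multiplying by the exponential moves the centre of the normal density from 0 to
  \<open>2 * b\<close>, the mirror image of the starting point in the level \<open>b\<close>, and
  leaves the constant exp (- 2 a b). The result is the final factor of
  \<open>crossing_integrand\<close>.\<close>

lemma bridge_factor_integral:
  assumes u: "0 < u"
  shows "(LINT x|lborel. gauss u x * (indicator {..<a * u + b} x * bridge_factor a b u x)) =
    Phi 1 (a * sqrt u + b / sqrt u) - exp (- 2 * a * b) * Phi 1 (a * sqrt u - b / sqrt u)"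
proof -
  have shift: "gauss u x * exp (- 2 * b * (a * u + b - x) / u) =
      exp (- 2 * a * b) * gauss u (x - 2 * b)" for x
  proof -
    have "- x\<^sup>2 / (2 * u) + - 2 * b * (a * u + b - x) / u = - 2 * a * b + - (x - 2 * b)\<^sup>2 / (2 * u)"
      using u by (simp add: field_simps power2_eq_square)
    then show ?thesis using u by (simp add: normal_density_def exp_add[symmetric])
  qed
  have nd: "integrable lborel (\<lambda>x. gauss u (x - m))" for m
    using lborel_integrable_real_affine[OF integrable_normal_density[of "sqrt u" 0], of 1 "-m"] u by simp
  have i1: "integrable lborel (\<lambda>x. gauss u (x - m) * indicator {..<a * u + b} x)" for m
    by (rule Bochner_Integration.integrable_bound[OF nd[of m]]) (auto simp: indicator_def)
  have "(LINT x|lborel. gauss u x * (indicator {..<a * u + b} x * bridge_factor a b u x)) =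
    (LINT x|lborel. gauss u (x - 0) * indicator {..<a * u + b} x -
      exp (- 2 * a * b) * (gauss u (x - 2 * b) * indicator {..<a * u + b} x))"
    using shift by (intro lint_cong) (auto simp: bridge_factor_def indicator_def algebra_simps)
  also have "\<dots> = (LINT x|lborel. gauss u (x - 0) * indicator {..<a * u + b} x) -
      exp (- 2 * a * b) * (LINT x|lborel. gauss u (x - 2 * b) * indicator {..<a * u + b} x)"
    using i1[of 0] i1[of "2 * b"] by (subst Bochner_Integration.integral_diff) simp_all
  also have "\<dots> = Phi 1 ((a * u + b - 0) / sqrt u) - exp (- 2 * a * b) * Phi 1 ((a * u + b - 2 * b) / sqrt u)"
    by (subst (1 2) normal_integral_lessThan[OF u]) simp
  also have "(a * u + b - 0) / sqrt u = a * sqrt u + b / sqrt u"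
    using u by (simp add: add_divide_distrib real_div_sqrt times_divide_eq_right[symmetric] del: times_divide_eq_right)
  also have "(a * u + b - 2 * b) / sqrt u = a * sqrt u - b / sqrt u"
    using u by (simp add: diff_divide_distrib real_div_sqrt times_divide_eq_right[symmetric] del: times_divide_eq_right)
  finally show ?thesis .
qed

section \<open>Paths with deterministic jumps, cut at the first jump\<close>

lemma barrier_cong:
  assumes "\<And>j. 1 \<le> j \<Longrightarrow> j < i \<Longrightarrow> x j = y j"
  shows "barrier a b u h x i = barrier a b u h y i"
  using assms by (induction a b u h x i rule: barrier.induct) auto

lemma barrier_upd_le: "j \<le> i \<Longrightarrow> barrier a b u h (x(i := y)) j = barrier a b u h x j"
  by (rule barrier_cong) auto

lemma barrier_Suc: "1 \<le> i \<Longrightarrow> barrier a b u h x (Suc i) = barrier a b u h x i + a * u i - x i - h i"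
  by (cases i) auto

text \<open>Time runs from the start of segment \<open>i\<close>, so cutting off that segment gives
  an object of the same kind with index \<open>Suc i\<close>.\<close>

definition jumps :: "nat \<Rightarrow> nat \<Rightarrow> (nat \<Rightarrow> real) \<Rightarrow> (nat \<Rightarrow> real) \<Rightarrow> real \<Rightarrow> real" where
  "jumps i n u h r = (\<Sum>j\<in>{i..<i + n}. if (\<Sum>l\<in>{i..j}. u l) \<le> r then h j else 0)"

lemma right_continuous_step: "continuous (at_right (r::real)) (\<lambda>r. if s \<le> r then c else (0::real))"
proof (cases "s \<le> r")
  case True
  then have "\<forall>\<^sub>F y in at_right r. (if s \<le> y then c else 0) = c"
    by (intro eventually_at_rightI[of r "r + 1"]) auto
  then show ?thesis using True by (auto simp: continuous_within intro: tendsto_eventually)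
next
  case False
  then have "\<forall>\<^sub>F y in at_right r. (if s \<le> y then c else 0) = 0"
    by (intro eventually_at_rightI[of r s]) auto
  then show ?thesis using False by (auto simp: continuous_within intro: tendsto_eventually)
qed

lemma jumps_right_continuous: "continuous (at_right r) (jumps i n u h)"
  unfolding jumps_def by (intro continuous_sum right_continuous_step)

lemma jumps_before_first:
  assumes "\<And>j. i \<le> j \<Longrightarrow> j < i + n \<Longrightarrow> 0 < u j" "r < u i"
  shows "jumps i n u h r = 0"
  unfolding jumps_def
proof (intro sum.neutral ballI)
  fix j assume j: "j \<in> {i..<i + n}"
  have "u i \<le> (\<Sum>l\<in>{i..j}. u l)"
    using j assms(1) by (intro member_le_sum) (auto intro: less_imp_le)
  then show "(if (\<Sum>l\<in>{i..j}. u l) \<le> r then h j else 0) = 0" using assms(2) by auto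
qed

lemma jumps_0:
  assumes "\<And>j. i \<le> j \<Longrightarrow> j < i + n \<Longrightarrow> 0 < u j"
  shows "jumps i n u h 0 = 0"
proof (cases "n = 0")
  case False
  then show ?thesis using assms[of i] by (intro jumps_before_first assms) auto
qed (simp add: jumps_def)

lemma jumps_after_first:
  assumes "0 \<le> r"
  shows "jumps i (Suc n) u h (u i + r) = h i + jumps (Suc i) n u h r"
proof -
  have "{i..<i + Suc n} = insert i {Suc i..<Suc i + n}" by auto
  moreover have "(\<Sum>l\<in>{i..j}. u l) = u i + (\<Sum>l\<in>{Suc i..j}. u l)" if "Suc i \<le> j" for j
    using that by (intro sum.atLeast_Suc_atMost) auto
  ultimately show ?thesis
    using assms by (auto simp: jumps_def intro!: sum.cong)
qed

context brownian
begin

text \<open>The jumps are deterministic here and the only randomness is \<open>B\<close>. The height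
  \<open>c\<close> is a parameter since it changes from segment to segment, and the definition is
  reused for the restarted motion.\<close>

definition surv_prob :: "real \<Rightarrow> nat \<Rightarrow> nat \<Rightarrow> (nat \<Rightarrow> real) \<Rightarrow> (nat \<Rightarrow> real) \<Rightarrow> real \<Rightarrow> real \<Rightarrow> real" where
  "surv_prob a i n u h T c = (LINT \<omega>|M. (if below 0 T (\<lambda>r. B r \<omega> + jumps i n u h r - a * r - c) then 1 else 0))"

lemma below_jumps_iff_rat:
  assumes "\<omega> \<in> space M"
  shows "below 0 T (\<lambda>r. B r \<omega> + jumps i n u h r - a * r - c) \<longleftrightarrow> below_rat 0 T (\<lambda>r. B r \<omega> + jumps i n u h r - a * r - c)"
  by (intro below_iff_rat continuous_intros B_right_continuous assms jumps_right_continuous) auto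

lemma below_jumps_event [measurable]:
  "Measurable.pred M (\<lambda>\<omega>. below 0 T (\<lambda>r. B r \<omega> + jumps i n u h r - a * r - c))"
proof -
  have "Measurable.pred M (\<lambda>\<omega>. below_rat 0 T (\<lambda>r. B r \<omega> + jumps i n u h r - a * r - c))"
  proof (rule measurable_below_rat)
    fix r :: real assume "0 \<le> r"
    then have [measurable]: "B r \<in> borel_measurable M" by (rule B_measurable)
    show "(\<lambda>\<omega>. B r \<omega> + jumps i n u h r - a * r - c) \<in> borel_measurable M"
      by measurable
  qed
  then show ?thesis by (simp add: below_jumps_iff_rat cong: measurable_cong)
qed

text \<open>Joint measurability in height and outcome is available for the rational form;
  integrating over the outcome keeps measurability in the height.\<close>

lemma surv_prob_measurable [measurable]: "surv_prob a i n u h T \<in> borel_measurable borel"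
proof -
  have "surv_prob a i n u h T = (\<lambda>c. LINT \<omega>|M. (if below_rat 0 T (\<lambda>r. B r \<omega> + jumps i n u h r - a * r - c) then 1 else 0))"
    unfolding surv_prob_def
    by (intro ext lint_cong) (auto simp: below_jumps_iff_rat)
  moreover have [measurable]: "Measurable.pred (borel \<Otimes>\<^sub>M M) (\<lambda>x. below_rat 0 T (\<lambda>r. B r (snd x) + jumps i n u h r - a * r - fst x))"
  proof (rule measurable_below_rat)
    fix r :: real assume "0 \<le> r"
    then have [measurable]: "B r \<in> borel_measurable M" by (rule B_measurable)
    show "(\<lambda>x. B r (snd x) + jumps i n u h r - a * r - fst x) \<in> borel_measurable (borel \<Otimes>\<^sub>M M)"
      by measurable
  qed
  moreover have "(\<lambda>c. LINT \<omega>|M. (if below_rat 0 T (\<lambda>r. B r \<omega> + jumps i n u h r - a * r - c) then 1 else 0 :: real)) \<in> borel_measurable borel"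
    by (intro borel_measurable_lebesgue_integral) (use calculation(2) in \<open>simp add: split_beta'\<close>)
  ultimately show ?thesis by simp
qed

text \<open>No jump happens at time 0, so the path starts at 0 and violates the gap at once. This is
  why integrating beyond \<open>upper_limit\<close> up to the barrier adds nothing.\<close>

lemma surv_prob_nonpos:
  assumes "\<And>j. i \<le> j \<Longrightarrow> j < i + n \<Longrightarrow> 0 < u j" "0 < T" "c \<le> 0"
  shows "surv_prob a i n u h T c = 0"
proof -
  have "\<not> below 0 T (\<lambda>r. B r \<omega> + jumps i n u h r - a * r - c)" if "\<omega> \<in> space M" for \<omega>
  proof
    assume "below 0 T (\<lambda>r. B r \<omega> + jumps i n u h r - a * r - c)"
    then obtain m :: nat where "B 0 \<omega> + jumps i n u h 0 - a * 0 - c \<le> - inverse (real (Suc m))"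
      using assms(2) unfolding below_def by fastforce
    moreover have "B 0 \<omega> = 0" "jumps i n u h 0 = 0" "0 < inverse (real (Suc m))"
      using B_0[OF that] jumps_0[of i n u h, OF assms(1)] by auto
    ultimately show False using assms(3) by linarith
  qed
  then show ?thesis
    unfolding surv_prob_def by (subst lint_cong[OF refl, where g="\<lambda>_. 0"]) auto
qed

end

context brownian
begin

text \<open>The gap on the first piece also controls the left limit at \<open>u i\<close>, before
  the jump; the jump itself only changes the barrier of the second piece.\<close>

lemma below_first_segment:
  assumes w: "\<omega> \<in> space M" and u: "\<And>j. i \<le> j \<Longrightarrow> j < i + Suc n \<Longrightarrow> 0 < u j" and T: "u i < T"
  shows "below 0 T (\<lambda>r. B r \<omega> + jumps i (Suc n) u h r - a * r - c) \<longleftrightarrow>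
    below 0 (u i) (\<lambda>r. B r \<omega> - a * r - c) \<and>
    below 0 (T - u i) (\<lambda>r. (B (u i + r) \<omega> - B (u i) \<omega>) + jumps (Suc i) n u h r - a * r - (c + a * u i - B (u i) \<omega> - h i))"
proof -
  have ui: "0 < u i" using u[of i] by simp
  have "below 0 T (\<lambda>r. B r \<omega> + jumps i (Suc n) u h r - a * r - c) \<longleftrightarrow>
     below 0 (u i) (\<lambda>r. B r \<omega> + jumps i (Suc n) u h r - a * r - c) \<and>
     below (u i) (u i + (T - u i)) (\<lambda>r. B r \<omega> + jumps i (Suc n) u h r - a * r - c)"
    using ui T by (subst below_split[of 0 "u i"]) auto
  also have "below (u i) (u i + (T - u i)) (\<lambda>r. B r \<omega> + jumps i (Suc n) u h r - a * r - c) \<longleftrightarrow>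
     below 0 (T - u i) (\<lambda>r. (B (u i + r) \<omega> - B (u i) \<omega>) + jumps (Suc i) n u h r - a * r - (c + a * u i - B (u i) \<omega> - h i))"
    unfolding below_shift by (intro below_cong) (simp add: jumps_after_first distrib_left)
  also have "below 0 (u i) (\<lambda>r. B r \<omega> + jumps i (Suc n) u h r - a * r - c) \<longleftrightarrow> below 0 (u i) (\<lambda>r. B r \<omega> - a * r - c)"
    by (intro below_cong) (auto simp: jumps_before_first u)
  finally show ?thesis .
qed

text \<open>The Markov property at the first jump, combined with the law of the first segment.\<close>
lemma surv_prob_Suc:
  fixes a c T :: real and u h :: "nat \<Rightarrow> real"
  assumes u: "\<And>j. i \<le> j \<Longrightarrow> j < i + Suc n \<Longrightarrow> 0 < u j" and T: "u i < T" and c: "0 \<le> c"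
  defines "\<psi> \<equiv> brownian.surv_prob M (\<lambda>s \<omega>. B (u i + s) \<omega> - B (u i) \<omega>) a (Suc i) n u h (T - u i)"
  shows "surv_prob a i (Suc n) u h T c =
    (LINT x|lborel. gauss ((u i)) x * (indicator {..<a * u i + c} x * bridge_factor a c (u i) x * \<psi> (c + a * u i - x - h i)))"
proof -
  have ui: "0 < u i" using u[of i] by simp
  interpret W: brownian M "\<lambda>s \<omega>. B (u i + s) \<omega> - B (u i) \<omega>"
    using ui by (intro brownian_shift) auto
  \<comment> \<open>The event as a functional of the past path and of the later increments; the
    rational form makes it jointly measurable.\<close>
  define f where "f = (\<lambda>(x, w). if x \<in> surviving a c (u i) (u i) \<and>
     below_rat 0 (T - u i) (\<lambda>r. w r + jumps (Suc i) n u h r - a * r - (c + a * u i - x (u i) - h i)) then 1 else (0::real))"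
  have [measurable]: "(\<lambda>x. x (u i)) \<in> borel_measurable (borel_on {0..u i})"
    by (rule measurable_component_singleton) (use ui in auto)
  have [measurable]: "Measurable.pred (borel_on {0..u i} \<Otimes>\<^sub>M borel_on {0..})
     (\<lambda>z. below_rat 0 (T - u i) (\<lambda>r. snd z r + jumps (Suc i) n u h r - a * r - (c + a * u i - fst z (u i) - h i)))"
  proof (rule measurable_below_rat)
    fix r :: real assume "0 \<le> r"
    then have [measurable]: "(\<lambda>x. x r) \<in> borel_measurable (borel_on {0..})"
      by (intro measurable_component_singleton) auto
    show "(\<lambda>z. snd z r + jumps (Suc i) n u h r - a * r - (c + a * u i - fst z (u i) - h i)) \<in>
      borel_measurable (borel_on {0..u i} \<Otimes>\<^sub>M borel_on {0..})" by measurable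
  qed
  have f[measurable]: "f \<in> borel_measurable (borel_on {0..u i} \<Otimes>\<^sub>M borel_on {0..})"
    unfolding f_def split_beta' by measurable
  have f_bound: "\<bar>f x\<bar> \<le> 1" for x by (simp add: f_def split: prod.splits)
  have f_eq: "f (\<lambda>s\<in>{0..u i}. B s \<omega>, \<lambda>s\<in>{0..}. B (u i + s) \<omega>' - B (u i) \<omega>') =
     (if below 0 (u i) (\<lambda>r. B r \<omega> - a * r - c) \<and>
      below 0 (T - u i) (\<lambda>r. (B (u i + r) \<omega>' - B (u i) \<omega>') + jumps (Suc i) n u h r - a * r - (c + a * u i - B (u i) \<omega> - h i))
      then 1 else 0)" if w: "\<omega> \<in> space M" "\<omega>' \<in> space M" for \<omega> \<omega>'
  proof -
    have "below_rat 0 (T - u i) (\<lambda>r. (\<lambda>s\<in>{0..}. B (u i + s) \<omega>' - B (u i) \<omega>') r + jumps (Suc i) n u h r - a * r - (c + a * u i - B (u i) \<omega> - h i)) \<longleftrightarrow>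
       below_rat 0 (T - u i) (\<lambda>r. (B (u i + r) \<omega>' - B (u i) \<omega>') + jumps (Suc i) n u h r - a * r - (c + a * u i - B (u i) \<omega> - h i))"
      by (auto simp: below_rat_def)
    also have "\<dots> \<longleftrightarrow> below 0 (T - u i) (\<lambda>r. (B (u i + r) \<omega>' - B (u i) \<omega>') + jumps (Suc i) n u h r - a * r - (c + a * u i - B (u i) \<omega> - h i))"
      using W.below_jumps_iff_rat[OF w(2)] by simp
    finally show ?thesis
      using ui below_iff_surviving[OF w(1) order_refl, of "u i" a c] by (simp add: f_def)
  qed
  have "surv_prob a i (Suc n) u h T c = (LINT \<omega>|M. f (\<lambda>s\<in>{0..u i}. B s \<omega>, \<lambda>s\<in>{0..}. B (u i + s) \<omega> - B (u i) \<omega>))"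
    unfolding surv_prob_def
    by (intro lint_cong refl) (simp add: f_eq below_first_segment u T)
  also have "\<dots> = (LINT \<omega>|M. (LINT \<omega>'|M. f (\<lambda>s\<in>{0..u i}. B s \<omega>, \<lambda>s\<in>{0..}. B (u i + s) \<omega>' - B (u i) \<omega>')))"
    by (rule indep_var_integral[OF indep_past_future f f_bound]) (use ui in simp)
  also have "\<dots> = (LINT \<omega>|M. (if below 0 (u i) (\<lambda>r. B r \<omega> - a * r - c) then \<psi> (c + a * u i - B (u i) \<omega> - h i) else 0))"
  proof (intro lint_cong refl)
    fix \<omega> assume w: "\<omega> \<in> space M"
    have "(LINT \<omega>'|M. f (\<lambda>s\<in>{0..u i}. B s \<omega>, \<lambda>s\<in>{0..}. B (u i + s) \<omega>' - B (u i) \<omega>')) =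
      (LINT \<omega>'|M. (if below 0 (u i) (\<lambda>r. B r \<omega> - a * r - c) then
         (if below 0 (T - u i) (\<lambda>r. (B (u i + r) \<omega>' - B (u i) \<omega>') + jumps (Suc i) n u h r - a * r - (c + a * u i - B (u i) \<omega> - h i)) then 1 else 0) else 0))"
      by (intro lint_cong refl) (simp add: f_eq w)
    then show "(LINT \<omega>'|M. f (\<lambda>s\<in>{0..u i}. B s \<omega>, \<lambda>s\<in>{0..}. B (u i + s) \<omega>' - B (u i) \<omega>')) =
      (if below 0 (u i) (\<lambda>r. B r \<omega> - a * r - c) then \<psi> (c + a * u i - B (u i) \<omega> - h i) else 0)"
      by (simp add: \<psi>_def W.surv_prob_def)
  qed
  also have "\<dots> = (LINT x|lborel. gauss ((u i)) x * (indicator {..<a * u i + c} x * bridge_factor a c (u i) x * \<psi> (c + a * u i - x - h i)))"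
    by (rule surviving_integral[OF ui c]) (unfold \<psi>_def, measurable)
  finally show ?thesis .
qed

end

text \<open>The invariant of the induction: the factors of the coordinates already fixed come out in
  front, and the remaining integrals give the survival probability for the remaining time and the
  current barrier. The motion is arbitrary because each step passes to the motion restarted at
  \<open>u i\<close>, while the left side does not mention it.\<close>

lemma iterated_integral_eq_surv_prob:
  assumes "brownian M B"
    and "1 \<le> i" "i + n = k + 1" "\<And>j. i \<le> j \<Longrightarrow> j \<le> k \<Longrightarrow> 0 < u j" "(\<Sum>j=1..k. u j) < t"
    and "0 \<le> barrier a b u h x i"
  shows "iterated_integral (\<lambda>i. interval_measure (Phi (u i))) (\<lambda>i x. {..upper_limit a b u h x i}) (crossing_integrand a b t k u h) i n x =
    (\<Prod>j=1..<i. bridge_factor a (barrier a b u h x j) (u j) (x j)) *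
    brownian.surv_prob M B a i n u h (t - (\<Sum>j=1..<i. u j)) (barrier a b u h x i)"
  using assms
proof (induction n arbitrary: B i x)
  case 0
  interpret brownian M B by fact
  define c r where "c = barrier a b u h x (k + 1)" and "r = t - (\<Sum>j=1..k. u j)"
  have r: "0 < r" using 0 by (simp add: r_def)
  have c: "0 \<le> c" using 0 by (simp add: c_def)
  have i: "i = k + 1" using 0 by simp
  have iv: "{1..<k + 1} = {1..k}" by auto
  have "surv_prob a i 0 u h r c = (LINT \<omega>|M. (if below 0 r (\<lambda>s. B s \<omega> - a * s - c) then 1 else 0))"
    by (simp add: surv_prob_def jumps_def)
  also have "\<dots> = Phi 1 (a * sqrt r + c / sqrt r) - exp (- 2 * a * c) * Phi 1 (a * sqrt r - c / sqrt r)"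
    using surviving_integral[OF r c, of "\<lambda>_. 1" a] bridge_factor_integral[OF r, of a c] by simp
  finally have surv: "surv_prob a i 0 u h r c = Phi 1 (a * sqrt r + c / sqrt r) - exp (- 2 * a * c) * Phi 1 (a * sqrt r - c / sqrt r)" .
  have "crossing_integrand a b t k u h x = (\<Prod>j=1..k. bridge_factor a (barrier a b u h x j) (u j) (x j)) *
    (Phi 1 (a * sqrt r + c / sqrt r) - exp (- 2 * a * c) * Phi 1 (a * sqrt r - c / sqrt r))"
    by (simp only: crossing_integrand_def Let_def c_def r_def bridge_factor_def)
  then show ?case
    using surv unfolding i iv c_def r_def iterated_integral.simps by simp
next
  case (Suc n)
  interpret brownian M B by fact
  let ?I = "iterated_integral (\<lambda>i. interval_measure (Phi (u i))) (\<lambda>i x. {..upper_limit a b u h x i}) (crossing_integrand a b t k u h)"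
  define c where "c = barrier a b u h x i"
  define T where "T = t - (\<Sum>j=1..<i. u j)"
  define P where "P = (\<Prod>j=1..<i. bridge_factor a (barrier a b u h x j) (u j) (x j))"
  have ui: "0 < u i" using Suc by auto
  have c: "0 \<le> c" using Suc by (simp add: c_def)
  interpret W: brownian M "\<lambda>s \<omega>. B (u i + s) \<omega> - B (u i) \<omega>"
    using ui by (intro brownian_shift) auto
  have "(\<Sum>j=1..<i. u j) + u i \<le> (\<Sum>j=1..k. u j)"
  proof -
    have "{1..k} = {1..<i} \<union> {i..k}" "{1..<i} \<inter> {i..k} = {}" using Suc.prems by auto
    then have "(\<Sum>j=1..k. u j) = (\<Sum>j=1..<i. u j) + (\<Sum>j=i..k. u j)"
      by (simp add: sum.union_disjoint)
    moreover have "u i \<le> (\<Sum>j=i..k. u j)"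
      using Suc.prems by (intro member_le_sum) (auto intro: less_imp_le)
    ultimately show ?thesis by simp
  qed
  then have T: "u i < T" using Suc.prems by (simp add: T_def)
  have sumSuc: "t - (\<Sum>j=1..<Suc i. u j) = T - u i"
    using Suc.prems by (simp add: T_def)
  define \<psi> where "\<psi> = W.surv_prob a (Suc i) n u h (T - u i)"
  have inner: "?I (Suc i) n (x(i := y)) =
     P * bridge_factor a c (u i) y * \<psi> (c + a * u i - y - h i)" if y: "y \<le> upper_limit a b u h x i" for y
  proof -
    have bar: "barrier a b u h (x(i := y)) (Suc i) = c + a * u i - y - h i"
      using Suc.prems by (simp add: barrier_Suc barrier_upd_le c_def)
    have "?I (Suc i) n (x(i := y)) =
      (\<Prod>j=1..<Suc i. bridge_factor a (barrier a b u h (x(i := y)) j) (u j) ((x(i := y)) j)) *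
      W.surv_prob a (Suc i) n u h (t - (\<Sum>j=1..<Suc i. u j)) (barrier a b u h (x(i := y)) (Suc i))"
    proof (rule Suc.IH)
      show "brownian M (\<lambda>s \<omega>. B (u i + s) \<omega> - B (u i) \<omega>)" by (rule W.brownian_axioms)
      show "0 \<le> barrier a b u h (x(i := y)) (Suc i)"
        unfolding bar using y by (simp add: upper_limit_def c_def)
    qed (use Suc.prems in auto)
    also have "(\<Prod>j=1..<Suc i. bridge_factor a (barrier a b u h (x(i := y)) j) (u j) ((x(i := y)) j)) = P * bridge_factor a c (u i) y"
      using Suc.prems by (simp add: P_def c_def barrier_upd_le)
    finally show ?thesis unfolding bar sumSuc \<psi>_def .
  qed
  have \<psi>0: "\<psi> z = 0" if "z \<le> 0" for z
    unfolding \<psi>_def using Suc.prems T that by (intro W.surv_prob_nonpos) auto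
  have [measurable]: "\<psi> \<in> borel_measurable borel" unfolding \<psi>_def by measurable
  \<comment> \<open>The two ranges differ only where the integrand vanishes: at the barrier itself
    the bridge factor is 0, and where the next barrier is not positive, \<psi> is 0.\<close>
  have eq: "indicator {..upper_limit a b u h x i} y * (bridge_factor a c (u i) y * \<psi> (c + a * u i - y - h i)) =
     indicator {..<a * u i + c} y * (bridge_factor a c (u i) y * \<psi> (c + a * u i - y - h i))" for y
  proof -
    consider "y = a * u i + c" | "y > a * u i + c" | "y < a * u i + c" "y > a * u i + c - h i" | "y < a * u i + c" "y \<le> a * u i + c - h i" by linarith
    then show ?thesis
    proof cases
      case 1
      then have "bridge_factor a c (u i) y = 0" by (simp add: bridge_factor_def)
      then show ?thesis by simp
    next
      case 2
      then show ?thesis by (auto simp: upper_limit_def c_def[symmetric] indicator_def)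
    next
      case 3
      then show ?thesis using \<psi>0[of "c + a * u i - y - h i"] by simp
    next
      case 4
      then show ?thesis by (auto simp: upper_limit_def c_def[symmetric] indicator_def)
    qed
  qed
  have "?I i (Suc n) x =
    (LINT y|interval_measure (Phi (u i)). indicator {..upper_limit a b u h x i} y * (P * (bridge_factor a c (u i) y * \<psi> (c + a * u i - y - h i))))"
    unfolding iterated_integral.simps set_lebesgue_integral_def
    by (intro lint_cong refl) (auto simp: indicator_def inner)
  also have "\<dots> = (LINT y|density lborel (gauss ((u i))). P * (indicator {..<a * u i + c} y * (bridge_factor a c (u i) y * \<psi> (c + a * u i - y - h i))))"
    unfolding interval_measure_Phi[OF ui] eq[symmetric] by (simp add: mult_ac)
  also have "\<dots> = P * (LINT y|density lborel (gauss ((u i))). indicator {..<a * u i + c} y * (bridge_factor a c (u i) y * \<psi> (c + a * u i - y - h i)))"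
    by simp
  also have "(LINT y|density lborel (gauss ((u i))). indicator {..<a * u i + c} y * (bridge_factor a c (u i) y * \<psi> (c + a * u i - y - h i))) =
     (LINT x|lborel. gauss ((u i)) x *\<^sub>R (indicator {..<a * u i + c} x * (bridge_factor a c (u i) x * \<psi> (c + a * u i - x - h i))))"
    by (intro integral_density) auto
  also have "\<dots> = surv_prob a i (Suc n) u h T c"
    unfolding \<psi>_def
    by (subst surv_prob_Suc) (use Suc.prems T c in \<open>auto simp: mult.assoc\<close>)
  finally show ?case unfolding P_def c_def T_def .
qed

lemma (in brownian) gaussian_integral_eq:
  assumes "0 < b" "\<And>j. 1 \<le> j \<Longrightarrow> j \<le> k \<Longrightarrow> 0 < u j" "(\<Sum>j=1..k. u j) < t"
  shows "gaussian_integral a b t k u h = surv_prob a 1 k u h t b"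
  unfolding gaussian_integral_def
  by (subst iterated_integral_eq_surv_prob[OF brownian_axioms]) (use assms in auto)

section \<open>Jump times of a counting process\<close>

lemma counting_processD:
  assumes "counting_process M N"
  shows "0 \<le> s \<Longrightarrow> N s \<in> measurable M (count_space UNIV)"
    and "\<omega> \<in> space M \<Longrightarrow> N 0 \<omega> = 0"
    and "\<omega> \<in> space M \<Longrightarrow> 0 \<le> r \<Longrightarrow> r \<le> s \<Longrightarrow> N r \<omega> \<le> N s \<omega>"
    and "\<omega> \<in> space M \<Longrightarrow> 0 \<le> s \<Longrightarrow> ((\<lambda>r. N r \<omega>) \<longlongrightarrow> N s \<omega>) (at_right s)"
    and "\<omega> \<in> space M \<Longrightarrow> 0 < s \<Longrightarrow> N s \<omega> = left_lim N s \<omega> \<or> N s \<omega> = left_lim N s \<omega> + 1"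
  using assms unfolding counting_process_def mono_on_def by auto

text \<open>Convergence in a discrete space means being eventually equal to the limit.\<close>

lemma counting_right_constant:
  assumes "counting_process M N" "\<omega> \<in> space M" "0 \<le> s"
  shows "\<exists>e>s. \<forall>r. s \<le> r \<longrightarrow> r < e \<longrightarrow> N r \<omega> = N s \<omega>"
proof -
  have "\<forall>\<^sub>F r in at_right s. N r \<omega> = N s \<omega>"
    using counting_processD(4)[OF assms] by (simp only: tendsto_discrete)
  then obtain e where "e > s" "\<And>r. s < r \<Longrightarrow> r < e \<Longrightarrow> N r \<omega> = N s \<omega>"
    by (auto simp: eventually_at_right_field)
  then have "\<forall>r. s \<le> r \<longrightarrow> r < e \<longrightarrow> N r \<omega> = N s \<omega>"
    by (metis order_le_less)
  with \<open>e > s\<close> show ?thesis by blast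
qed

text \<open>Being monotone, the process takes finitely many values on \<open>{0..<s}\<close>; it is
  constant from a time at which the largest of them is taken.\<close>

lemma counting_left_lim:
  assumes c: "counting_process M N" and w: "\<omega> \<in> space M" and s: "0 < s"
  shows "\<exists>e. 0 \<le> e \<and> e < s \<and> (\<forall>r. e \<le> r \<longrightarrow> r < s \<longrightarrow> N r \<omega> = left_lim N s \<omega>)"
proof -
  note mono = counting_processD(3)[OF c w]
  have fin: "finite ((\<lambda>r. N r \<omega>) ` {0..<s})"
    by (rule finite_subset[of _ "{..N s \<omega>}"]) (auto intro!: mono)
  have ne: "(\<lambda>r. N r \<omega>) ` {0..<s} \<noteq> {}" using s by auto
  obtain e where e: "0 \<le> e" "e < s" "N e \<omega> = Max ((\<lambda>r. N r \<omega>) ` {0..<s})"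
    using Max_in[OF fin ne] by auto
  have const: "N r \<omega> = N e \<omega>" if "e \<le> r" "r < s" for r
  proof (rule antisym)
    show "N r \<omega> \<le> N e \<omega>" unfolding e(3) using that e by (intro Max_ge fin) auto
    show "N e \<omega> \<le> N r \<omega>" using that e by (intro mono) auto
  qed
  have "((\<lambda>r. N r \<omega>) \<longlongrightarrow> N e \<omega>) (at_left s)"
    by (rule tendsto_eventually, rule eventually_at_leftI[of e]) (use const e in auto)
  then have "left_lim N s \<omega> = N e \<omega>"
    unfolding left_lim_def by (intro tendsto_Lim) auto
  then show ?thesis using e(1,2) const by metis
qed

lemma jump_time_nonneg: "0 \<le> jump_time N k \<omega>"
proof (induction k)
  case (Suc k)
  show ?case
    unfolding jump_time.simps
  proof (rule Inf_greatest, clarify)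
    fix s assume "jump_time N k \<omega> < ereal s"
    with Suc show "0 \<le> ereal s" by (meson less_imp_le order_trans)
  qed
qed simp

text \<open>Let \<sigma> be the first time at which the level \<open>Suc k\<close> is reached,
  attained by right-continuity. Steps of size one force the left limit there to be exactly
  \<open>k\<close>, so the jump time with index \<open>k\<close> lies before \<sigma>, and \<sigma>
  belongs to the set whose infimum is the next one. For the converse, every jump after the one with
  index \<open>k\<close> leads to a level of at least \<open>Suc k\<close>.\<close>

lemma jump_time_le_iff:
  assumes c: "counting_process M N" and w: "\<omega> \<in> space M" and s: "0 \<le> s"
  shows "jump_time N k \<omega> \<le> ereal s \<longleftrightarrow> k \<le> N s \<omega>"
  using s
proof (induction k arbitrary: s)
  case (Suc k)
  note mono = counting_processD(3)[OF c w]
  show ?case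
  proof
    assume *: "Suc k \<le> N s \<omega>"
    define S where "S = {r\<in>{0..s}. Suc k \<le> N r \<omega>}"
    define \<sigma> where "\<sigma> = Inf S"
    have S: "s \<in> S" "bdd_below S" using * Suc.prems by (auto simp: S_def)
    have \<sigma>: "\<sigma> \<le> s" "0 \<le> \<sigma>"
      unfolding \<sigma>_def by (rule cInf_lower[OF S], rule cInf_greatest) (use S(1) in \<open>auto simp: S_def\<close>)
    have N\<sigma>: "Suc k \<le> N \<sigma> \<omega>"
    proof -
      from counting_right_constant[OF c w \<sigma>(2)]
      obtain e where e: "e > \<sigma>" "\<And>r. \<sigma> \<le> r \<Longrightarrow> r < e \<Longrightarrow> N r \<omega> = N \<sigma> \<omega>"
        by blast
      obtain r where r: "r \<in> S" "r < e"
        using cInf_lessD[of S e] S(1) e(1) unfolding \<sigma>_def by blast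
      have "\<sigma> \<le> r" unfolding \<sigma>_def using r S by (intro cInf_lower)
      then have "N r \<omega> = N \<sigma> \<omega>" using r(2) by (rule e(2))
      then show ?thesis using r(1) by (simp add: S_def)
    qed
    have before: "N r \<omega> \<le> k" if "0 \<le> r" "r < \<sigma>" for r
    proof (rule ccontr)
      assume "\<not> N r \<omega> \<le> k"
      then have "r \<in> S" using that \<sigma> by (auto simp: S_def)
      then have "\<sigma> \<le> r" unfolding \<sigma>_def using S by (intro cInf_lower)
      then show False using that by simp
    qed
    have "\<sigma> \<noteq> 0" using N\<sigma> counting_processD(2)[OF c w] by auto
    then have pos: "0 < \<sigma>" using \<sigma>(2) by simp
    obtain e where e: "0 \<le> e" "e < \<sigma>" "\<And>r. e \<le> r \<Longrightarrow> r < \<sigma> \<Longrightarrow> N r \<omega> = left_lim N \<sigma> \<omega>"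
      using counting_left_lim[OF c w pos] by blast
    have ll: "left_lim N \<sigma> \<omega> \<le> k" using before[of e] e by auto
    then have "left_lim N \<sigma> \<omega> = k" "N \<sigma> \<omega> \<noteq> left_lim N \<sigma> \<omega>"
      using counting_processD(5)[OF c w pos] N\<sigma> by auto
    moreover have "jump_time N k \<omega> \<le> ereal e"
      using Suc.IH[OF e(1)] e(2) e(3)[of e] calculation by simp
    then have "jump_time N k \<omega> < ereal \<sigma>" using e(2) by (meson less_ereal.simps(1) order_le_less_trans)
    ultimately have "jump_time N (Suc k) \<omega> \<le> ereal \<sigma>"
      by (auto intro!: Inf_lower)
    then show "jump_time N (Suc k) \<omega> \<le> ereal s" using \<sigma>(1) by (meson ereal_less_eq(3) order_trans)
  next
    assume *: "jump_time N (Suc k) \<omega> \<le> ereal s"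
    show "Suc k \<le> N s \<omega>"
    proof (rule ccontr)
      assume neg: "\<not> Suc k \<le> N s \<omega>"
      \<comment> \<open>An infimum need not be attained, so it does not suffice that all later jumps
        come after \<open>s\<close>; they come no earlier than a fixed \<open>e > s\<close>.\<close>
      obtain e where e: "e > s" "\<And>r. s \<le> r \<Longrightarrow> r < e \<Longrightarrow> N r \<omega> = N s \<omega>"
        using counting_right_constant[OF c w Suc.prems] by blast
      have "e \<le> s'" if s': "jump_time N k \<omega> < ereal s'" "N s' \<omega> \<noteq> left_lim N s' \<omega>" for s'
      proof -
        obtain r where r: "jump_time N k \<omega> < ereal r" "r < s'"
          using ereal_dense2[OF s'(1)] by auto
        have r0: "0 \<le> r" using jump_time_nonneg[of N k \<omega>] r(1) by (metis ereal_less_eq(5) less_imp_le order_trans)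
        have kr: "k \<le> N r \<omega>" using Suc.IH[OF r0] less_imp_le[OF r(1)] by simp
        have s'0: "0 < s'" using r0 r(2) by simp
        obtain d where d: "0 \<le> d" "d < s'" "\<And>r. d \<le> r \<Longrightarrow> r < s' \<Longrightarrow> N r \<omega> = left_lim N s' \<omega>"
          using counting_left_lim[OF c w s'0] by blast
        have "N r \<omega> \<le> N (max r d) \<omega>" using r0 by (intro mono) auto
        also have "\<dots> = left_lim N s' \<omega>" using r(2) d by (intro d(3)) auto
        finally have N': "Suc k \<le> N s' \<omega>" using kr s'(2) counting_processD(5)[OF c w s'0] by auto
        show ?thesis
        proof (rule ccontr)
          assume "\<not> e \<le> s'"
          then show False
            using N' neg e(2)[of s'] mono[of s' s] s'0 by (cases "s \<le> s'") auto
        qed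
      qed
      then have "ereal e \<le> jump_time N (Suc k) \<omega>" by (auto intro!: Inf_greatest)
      then show False using * e(1) by (metis ereal_less_eq(3) not_less order_trans)
    qed
  qed
qed (simp add: jump_time_nonneg)

lemma jump_time_measurable:
  assumes c: "counting_process M N"
  shows "jump_time N k \<in> borel_measurable M"
  unfolding borel_measurable_iff_Iic_ereal
proof
  fix a :: ereal
  show "jump_time N k -` {..a} \<inter> space M \<in> sets M"
  proof (cases a)
    case (real s)
    show ?thesis
    proof (cases "0 \<le> s")
      case True
      then have "jump_time N k -` {..a} \<inter> space M = N s -` {k..} \<inter> space M"
        using real jump_time_le_iff[OF c _ True] by auto
      then show ?thesis using measurable_sets[OF counting_processD(1)[OF c True]] by simp
    next
      case False
      then have "\<not> jump_time N k \<omega> \<le> a" for \<omega>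
        using jump_time_nonneg[of N k \<omega>] real by (metis ereal_less_eq(5) order_trans)
      then have "jump_time N k -` {..a} \<inter> space M = {}" by auto
      then show ?thesis by simp
    qed
  next
    case MInf
    then have "jump_time N k -` {..a} \<inter> space M = {}"
      using jump_time_nonneg[of N k] by (auto simp: ereal_infty_less_eq)
    then show ?thesis by simp
  next
    case PInf
    then have "jump_time N k -` {..a} \<inter> space M = space M" by auto
    then show ?thesis by simp
  qed
qed

text \<open>\<open>real_of_ereal\<close> sends infinity to 0, so finiteness of the jump time, which
  \<open>k \<le> N t \<omega>\<close> provides, is essential.\<close>

lemma jump_time_real_le_iff:
  assumes c: "counting_process M N" and w: "\<omega> \<in> space M" and "0 \<le> t" "k \<le> N t \<omega>" "0 \<le> s"
  shows "real_of_ereal (jump_time N k \<omega>) \<le> s \<longleftrightarrow> k \<le> N s \<omega>"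
proof -
  have "jump_time N k \<omega> \<le> ereal t" using jump_time_le_iff[OF c w] assms by auto
  then obtain x where "jump_time N k \<omega> = ereal x"
    using jump_time_nonneg[of N k \<omega>] by (cases "jump_time N k \<omega>") auto
  then show ?thesis using jump_time_le_iff[OF c w \<open>0 \<le> s\<close>, of k] by simp
qed

text \<open>A measure space that carries only what the family itself observes. Its measurable sets
  are \<open>generated_events\<close>, so the measurability of jump times can be applied again with
  this smaller sigma-algebra.\<close>

definition generated_space :: "'a measure \<Rightarrow> 'i set \<Rightarrow> ('i \<Rightarrow> 'a \<Rightarrow> 'b::topological_space) \<Rightarrow> 'a measure" where
  "generated_space M I X = sigma (space M) {X i -` A \<inter> space M | i A. i \<in> I \<and> A \<in> sets borel}"

lemma space_generated_space [simp]: "space (generated_space M I X) = space M"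
  unfolding generated_space_def by (rule space_measure_of) auto

lemma sets_generated_space: "sets (generated_space M I X) = generated_events M I X"
  unfolding generated_space_def generated_events_def by (rule sets_measure_of) auto

lemma measurable_generated_space: "i \<in> I \<Longrightarrow> X i \<in> measurable (generated_space M I X) borel"
  by (rule measurableI) (auto simp: sets_generated_space generated_events_def)

lemma counting_process_generated:
  assumes "counting_process M N"
  shows "counting_process (generated_space M {0..} N) N"
proof -
  have "N s \<in> measurable (generated_space M {0..} N) (count_space UNIV)" if "0 \<le> s" for s
    using measurable_generated_space[of s "{0..}" N M] that
    by (subst measurable_cong_sets[OF refl sets_borel_eq_count_space[symmetric]]) simp
  then show ?thesis using assms by (auto simp: counting_process_def)
qed

section \<open>Integrating out jump times and heights\<close>

text \<open>Products of two measures are determined on rectangles. This is applied twice: with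
  \<open>A\<close> fixed, to pass from boxes to all sets of the last two factors, and then to the
  outer pair.\<close>

lemma distr_triple_eqI:
  assumes M: "prob_space M" and P: "prob_space P" "prob_space Q" "prob_space R"
    and X[measurable]: "X \<in> measurable M P" "Y \<in> measurable M Q" "Z \<in> measurable M R"
    and box: "\<And>A B C. A \<in> sets P \<Longrightarrow> B \<in> sets Q \<Longrightarrow> C \<in> sets R \<Longrightarrow>
      emeasure M ((X -` A \<inter> space M) \<inter> (Y -` B \<inter> space M) \<inter> (Z -` C \<inter> space M)) = emeasure P A * emeasure Q B * emeasure R C"
  shows "distr M (P \<Otimes>\<^sub>M (Q \<Otimes>\<^sub>M R)) (\<lambda>\<omega>. (X \<omega>, Y \<omega>, Z \<omega>)) = P \<Otimes>\<^sub>M (Q \<Otimes>\<^sub>M R)"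
proof (rule sym)
  interpret M: prob_space M by fact
  interpret P: prob_space P by fact
  interpret Q: prob_space Q by fact
  interpret R: prob_space R by fact
  interpret QR: pair_prob_space Q R ..
  have mid: "emeasure M ((X -` A \<inter> space M) \<inter> ((\<lambda>\<omega>. (Y \<omega>, Z \<omega>)) -` D \<inter> space M)) = emeasure P A * emeasure (Q \<Otimes>\<^sub>M R) D"
    if A[measurable]: "A \<in> sets P" and D: "D \<in> sets (Q \<Otimes>\<^sub>M R)" for A D
  proof -
    have XA[measurable]: "X -` A \<inter> space M \<in> sets M" by measurable
    have e: "emeasure (density M (indicator (X -` A \<inter> space M))) S = emeasure M ((X -` A \<inter> space M) \<inter> S)"
      if [measurable]: "S \<in> sets M" for S
      by (subst emeasure_density) (auto simp: nn_integral_indicator[symmetric] indicator_inter_arith[symmetric] simp del: nn_integral_indicator intro!: nn_integral_cong)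
    \<comment> \<open>The constant \<open>emeasure P A\<close> is absorbed into the last factor, so
      that restricting to the preimage of \<open>A\<close> still gives a product measure.\<close>
    have "Q \<Otimes>\<^sub>M scale_measure (emeasure P A) R = distr (density M (indicator (X -` A \<inter> space M))) (Q \<Otimes>\<^sub>M R) (\<lambda>\<omega>. (Y \<omega>, Z \<omega>))"
    proof (rule pair_measure_eqI)
      show "sigma_finite_measure Q" ..
      show "sigma_finite_measure (scale_measure (emeasure P A) R)"
      proof -
        have "finite_measure (scale_measure (emeasure P A) R)"
          by (rule finite_measureI) (simp add: space_scale_measure R.emeasure_space_1)
        then show ?thesis by (rule finite_measure.axioms(1))
      qed
    next
      fix B C assume "B \<in> sets Q" "C \<in> sets (scale_measure (emeasure P A) R)"
      then have [measurable]: "B \<in> sets Q" "C \<in> sets R" by auto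
      have "emeasure (distr (density M (indicator (X -` A \<inter> space M))) (Q \<Otimes>\<^sub>M R) (\<lambda>\<omega>. (Y \<omega>, Z \<omega>))) (B \<times> C) =
         emeasure M ((X -` A \<inter> space M) \<inter> ((\<lambda>\<omega>. (Y \<omega>, Z \<omega>)) -` (B \<times> C) \<inter> space M))"
        by (subst emeasure_distr) (auto simp: e)
      also have "(X -` A \<inter> space M) \<inter> ((\<lambda>\<omega>. (Y \<omega>, Z \<omega>)) -` (B \<times> C) \<inter> space M) =
         (X -` A \<inter> space M) \<inter> (Y -` B \<inter> space M) \<inter> (Z -` C \<inter> space M)" by auto
      finally show "emeasure Q B * emeasure (scale_measure (emeasure P A) R) C =
          emeasure (distr (density M (indicator (X -` A \<inter> space M))) (Q \<Otimes>\<^sub>M R) (\<lambda>\<omega>. (Y \<omega>, Z \<omega>))) (B \<times> C)"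
        by (simp add: box mult_ac)
    qed (simp cong: sets_pair_measure_cong)
    then have "emeasure (Q \<Otimes>\<^sub>M scale_measure (emeasure P A) R) D =
        emeasure M ((X -` A \<inter> space M) \<inter> ((\<lambda>\<omega>. (Y \<omega>, Z \<omega>)) -` D \<inter> space M))"
      using D by (simp add: emeasure_distr e)
    moreover have "emeasure (Q \<Otimes>\<^sub>M scale_measure (emeasure P A) R) D = emeasure P A * emeasure (Q \<Otimes>\<^sub>M R) D"
    proof -
      interpret S: finite_measure "scale_measure (emeasure P A) R"
        by (rule finite_measureI) (simp add: space_scale_measure R.emeasure_space_1)
      have "D \<in> sets (Q \<Otimes>\<^sub>M scale_measure (emeasure P A) R)" using D by (simp cong: sets_pair_measure_cong)
      then have "emeasure (Q \<Otimes>\<^sub>M scale_measure (emeasure P A) R) D = (\<integral>\<^sup>+ x. emeasure P A * emeasure R (Pair x -` D) \<partial>Q)"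
        by (simp add: S.emeasure_pair_measure_alt)
      also have "\<dots> = emeasure P A * (\<integral>\<^sup>+ x. emeasure R (Pair x -` D) \<partial>Q)"
        using D by (intro nn_integral_cmult R.measurable_emeasure_Pair)
      also have "\<dots> = emeasure P A * emeasure (Q \<Otimes>\<^sub>M R) D"
        using D by (simp add: R.emeasure_pair_measure_alt)
      finally show ?thesis .
    qed
    ultimately show ?thesis by simp
  qed
  show "P \<Otimes>\<^sub>M (Q \<Otimes>\<^sub>M R) = distr M (P \<Otimes>\<^sub>M (Q \<Otimes>\<^sub>M R)) (\<lambda>\<omega>. (X \<omega>, Y \<omega>, Z \<omega>))"
  proof (rule pair_measure_eqI)
    show "sigma_finite_measure P" "sigma_finite_measure (Q \<Otimes>\<^sub>M R)" by standard+
    fix A D assume [measurable]: "A \<in> sets P" "D \<in> sets (Q \<Otimes>\<^sub>M R)"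
    have "emeasure (distr M (P \<Otimes>\<^sub>M (Q \<Otimes>\<^sub>M R)) (\<lambda>\<omega>. (X \<omega>, Y \<omega>, Z \<omega>))) (A \<times> D) =
      emeasure M ((\<lambda>\<omega>. (X \<omega>, Y \<omega>, Z \<omega>)) -` (A \<times> D) \<inter> space M)"
      by (subst emeasure_distr) auto
    also have "(\<lambda>\<omega>. (X \<omega>, Y \<omega>, Z \<omega>)) -` (A \<times> D) \<inter> space M =
      (X -` A \<inter> space M) \<inter> ((\<lambda>\<omega>. (Y \<omega>, Z \<omega>)) -` D \<inter> space M)" by auto
    finally show "emeasure P A * emeasure (Q \<Otimes>\<^sub>M R) D = emeasure (distr M (P \<Otimes>\<^sub>M (Q \<Otimes>\<^sub>M R)) (\<lambda>\<omega>. (X \<omega>, Y \<omega>, Z \<omega>))) (A \<times> D)"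
      by (simp add: mid)
  qed simp
qed

text \<open>The counterpart of \<open>jumps\<close> in absolute jump times, the coordinates of
  \<open>jump_times_law\<close>.\<close>

definition step_sum :: "nat \<Rightarrow> (nat \<Rightarrow> real) \<Rightarrow> (nat \<Rightarrow> real) \<Rightarrow> real \<Rightarrow> real" where
  "step_sum k s h r = (\<Sum>j\<in>{1..k}. if s j \<le> r then h j else 0)"

lemma sum_waiting_time: "1 \<le> j \<Longrightarrow> (\<Sum>l\<in>{1..j}. waiting_time s l) = s j"
  by (induction j rule: dec_induct) (auto simp: waiting_time_def)

lemma jumps_waiting_time: "jumps 1 k (waiting_time s) h = step_sum k s h"
proof -
  have "{1..<1 + k} = {1..k}" by auto
  then show ?thesis
    by (auto simp: jumps_def step_sum_def sum_waiting_time fun_eq_iff intro!: sum.cong simp del: One_nat_def)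
qed

lemma ordered_times_waiting:
  assumes s: "s \<in> ordered_times t k" and t: "0 < t"
  shows "1 \<le> j \<Longrightarrow> j \<le> k \<Longrightarrow> 0 < waiting_time s j" "(\<Sum>l=1..k. waiting_time s l) < t"
proof -
  show "0 < waiting_time s j" if "1 \<le> j" "j \<le> k"
  proof (cases "j = 1")
    case False
    then have "s (j - 1) < s j"
      using s that by (intro strict_mono_onD[of "{1..k}" s]) (auto simp: ordered_times_def)
    then show ?thesis using False by (simp add: waiting_time_def)
  qed (use s that in \<open>auto simp: ordered_times_def waiting_time_def\<close>)
  show "(\<Sum>l=1..k. waiting_time s l) < t"
    using s t by (cases "k = 0") (auto simp: sum_waiting_time ordered_times_def simp del: One_nat_def)
qed

lemma prob_space_jump_heights_law:
  assumes "prob_space M" "\<forall>i\<ge>1. \<eta> i \<in> borel_measurable M"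
  shows "prob_space (jump_heights_law M \<eta> k)"
proof -
  interpret prob_space M by fact
  show ?thesis
    unfolding jump_heights_law_def
    by (rule prob_space_distr) (use assms in \<open>auto intro!: measurable_restrict\<close>)
qed

lemma sets_jump_heights_law [simp, measurable_cong]:
  "sets (jump_heights_law M \<eta> k) = sets (borel_on {1..k})"
  by (simp add: jump_heights_law_def)

lemma sets_jump_times_law [simp, measurable_cong]:
  "sets (jump_times_law M N t k) = sets (borel_on {1..k})"
  by (simp add: jump_times_law_def)

lemma step_event_measurable [measurable]:
  "Measurable.pred (borel_on {1..k} \<Otimes>\<^sub>M (borel_on {1..k} \<Otimes>\<^sub>M borel_on {0..}))
    (\<lambda>z. below_rat 0 t (\<lambda>r. snd (snd z) r + step_sum k (fst z) (fst (snd z)) r - a * r - b))"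
proof (rule measurable_below_rat)
  fix r :: real assume "0 \<le> r"
  then have [measurable]: "(\<lambda>x. x r) \<in> borel_measurable (borel_on {0..})"
    by (intro measurable_component_singleton) auto
  have [measurable]: "(\<lambda>x. x j) \<in> borel_measurable (borel_on {1..k})" if "j \<in> {1..k}" for j
    using that by (intro measurable_component_singleton) auto
  have "(\<lambda>z. step_sum k (fst z) (fst (snd z)) r) \<in> borel_measurable (borel_on {1..k} \<Otimes>\<^sub>M (borel_on {1..k} \<Otimes>\<^sub>M borel_on {0..}))"
    unfolding step_sum_def
  proof (rule borel_measurable_sum)
    fix j assume j: "j \<in> {1..k}"
    show "(\<lambda>z. if fst z j \<le> r then fst (snd z) j else 0) \<in> borel_measurable (borel_on {1..k} \<Otimes>\<^sub>M (borel_on {1..k} \<Otimes>\<^sub>M borel_on {0..}))"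
      using j by measurable
  qed
  then show "(\<lambda>z. snd (snd z) r + step_sum k (fst z) (fst (snd z)) r - a * r - b) \<in>
    borel_measurable (borel_on {1..k} \<Otimes>\<^sub>M (borel_on {1..k} \<Otimes>\<^sub>M borel_on {0..}))" by measurable
qed

lemma measurable_ordered_times [measurable]:
  "Measurable.pred (borel_on {1..k}) (\<lambda>s. s \<in> ordered_times t k)"
proof -
  have "(\<lambda>s. s \<in> ordered_times t k) = (\<lambda>s. (\<forall>i\<in>{1..k}. 0 < s i \<and> s i < t) \<and> (\<forall>i\<in>{1..k}. \<forall>j\<in>{i<..k}. s i < s j))"
    by (auto simp: ordered_times_def strict_mono_on_def fun_eq_iff)
  moreover have "Measurable.pred (borel_on {1..k}) (\<lambda>s. (\<forall>i\<in>{1..k}. 0 < s i \<and> s i < t) \<and> (\<forall>i\<in>{1..k}. \<forall>j\<in>{i<..k}. s i < (s j :: real)))"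
  proof (intro pred_intros_logic pred_intros_finite)
    fix i assume i: "i \<in> {1..k}"
    then have [measurable]: "(\<lambda>x. x i) \<in> borel_measurable (borel_on {1..k})"
      by (rule measurable_component_singleton)
    show "Measurable.pred (borel_on {1..k}) (\<lambda>s. 0 < (s i :: real))" by measurable
    show "Measurable.pred (borel_on {1..k}) (\<lambda>s. s i < t)" by measurable
    fix j assume "j \<in> {i<..k}"
    then have [measurable]: "(\<lambda>x. x j) \<in> borel_measurable (borel_on {1..k})"
      using i by (intro measurable_component_singleton) auto
    show "Measurable.pred (borel_on {1..k}) (\<lambda>s. s i < (s j :: real))" by measurable
  qed auto
  ultimately show ?thesis by simp
qed

section \<open>Conditioning on the number of jumps\<close>

locale jump_brownian = brownian M B for M :: "'a measure" and B +
  fixes N :: "real \<Rightarrow> 'a \<Rightarrow> nat" and \<eta> :: "nat \<Rightarrow> 'a \<Rightarrow> real" and a b t :: real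
  assumes counting: "counting_process M N"
    and eta_measurable: "\<forall>i\<ge>1. \<eta> i \<in> borel_measurable M"
    and indep: "mutually_independent M B N \<eta>"
    and t_pos: "0 < t" and b_pos: "0 < b"
begin

definition path :: "'a \<Rightarrow> real \<Rightarrow> real" where "path \<omega> = (\<lambda>s\<in>{0..}. B s \<omega>)"

definition heights :: "nat \<Rightarrow> 'a \<Rightarrow> nat \<Rightarrow> real" where "heights k \<omega> = (\<lambda>i\<in>{1..k}. \<eta> i \<omega>)"

definition times :: "nat \<Rightarrow> 'a \<Rightarrow> nat \<Rightarrow> real" where
  "times k \<omega> = (\<lambda>i\<in>{1..k}. real_of_ereal (jump_time N i \<omega>))"

definition no_crossing :: "'a \<Rightarrow> bool" where
  "no_crossing \<omega> \<longleftrightarrow> below 0 t (\<lambda>r. jump_bm B N \<eta> r \<omega> - a * r - b)"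

text \<open>The rational form makes this jointly measurable in \<open>s\<close> and \<open>h\<close>
  for all arguments, including times that are not ordered, where no comparison with
  \<open>gaussian_integral\<close> is made.\<close>

definition cond_prob :: "nat \<Rightarrow> (nat \<Rightarrow> real) \<Rightarrow> (nat \<Rightarrow> real) \<Rightarrow> real" where
  "cond_prob k s h = (LINT \<omega>|M. (if below_rat 0 t (\<lambda>r. B r \<omega> + step_sum k s h r - a * r - b) then 1 else 0))"

lemma path_measurable: "path \<in> measurable M (borel_on {0..})"
  unfolding path_def by (intro measurable_restrict B_measurable) auto

lemma heights_measurable: "heights k \<in> measurable M (borel_on {1..k})"
  unfolding heights_def using eta_measurable by (intro measurable_restrict) auto

lemma times_measurable: "times k \<in> measurable M (borel_on {1..k})"
  unfolding times_def
  by (intro measurable_restrict borel_measurable_real_of_ereal jump_time_measurable[OF counting])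

lemma N_event: "{\<omega>\<in>space M. N t \<omega> = k} \<in> sets M"
  using measurable_sets[OF counting_processD(1)[OF counting, of t], of "{k}"] t_pos
  by (simp add: vimage_def Int_def conj_commute)

lemma path_event: "C \<in> sets (borel_on {0..}) \<Longrightarrow> path -` C \<inter> space M \<in> generated_events M {0..} B"
proof -
  assume C: "C \<in> sets (borel_on {0..})"
  have "path \<in> measurable (generated_space M {0..} B) (borel_on {0..})"
    unfolding path_def by (intro measurable_restrict measurable_generated_space)
  from measurable_sets[OF this C] show ?thesis by (simp add: sets_generated_space)
qed

lemma heights_event: "C \<in> sets (borel_on {1..k}) \<Longrightarrow> heights k -` C \<inter> space M \<in> generated_events M {1..} \<eta>"
proof -
  assume C: "C \<in> sets (borel_on {1..k})"
  have "heights k \<in> measurable (generated_space M {1..} \<eta>) (borel_on {1..k})"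
    unfolding heights_def by (intro measurable_restrict measurable_generated_space) auto
  from measurable_sets[OF this C] show ?thesis by (simp add: sets_generated_space)
qed

text \<open>Both conditions are observed by \<open>N\<close> alone; to see this, the measurability
  of the jump times is applied in the space generated by \<open>N\<close>.\<close>

lemma times_event:
  assumes C: "C \<in> sets (borel_on {1..k})"
  shows "{\<omega>\<in>space M. N t \<omega> = k} \<inter> (times k -` C \<inter> space M) \<in> generated_events M {0..} N"
proof -
  let ?G = "generated_space M {0..} N"
  have c: "counting_process ?G N" by (rule counting_process_generated[OF counting])
  have "times k \<in> measurable ?G (borel_on {1..k})"
    unfolding times_def
    by (intro measurable_restrict borel_measurable_real_of_ereal jump_time_measurable[OF c])
  from measurable_sets[OF this C] have "times k -` C \<inter> space M \<in> sets ?G" by simp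
  moreover have "{\<omega>\<in>space M. N t \<omega> = k} \<in> sets ?G"
    using measurable_sets[OF counting_processD(1)[OF c, of t], of "{k}"] t_pos
    by (simp add: vimage_def Int_def conj_commute)
  ultimately show ?thesis unfolding sets_generated_space[symmetric] by (rule sets.Int[rotated])
qed

lemma prob_three:
  assumes "A1 \<in> generated_events M {0..} B" "A2 \<in> generated_events M {0..} N" "A3 \<in> generated_events M {1..} \<eta>"
  shows "prob (A2 \<inter> A3 \<inter> A1) = prob A2 * prob A3 * prob A1"
proof -
  have l3: "{..<3::nat} = {0, 1, 2}" by auto
  have "prob (\<Inter>j\<in>{..<3}. [A1, A2, A3] ! j) = (\<Prod>j\<in>{..<3}. prob ([A1, A2, A3] ! j))"
    by (rule indep_setsD[OF indep[unfolded mutually_independent_def]])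
       (use assms in \<open>auto simp: l3 numeral_2_eq_2\<close>)
  moreover have "(\<Inter>j\<in>{..<3}. [A1, A2, A3] ! j) = A2 \<inter> A3 \<inter> A1"
    unfolding l3 by (auto simp: numeral_2_eq_2)
  moreover have "(\<Prod>j\<in>{..<3}. prob ([A1, A2, A3] ! j)) = prob A2 * prob A3 * prob A1"
    unfolding l3 by (simp add: numeral_2_eq_2 mult_ac)
  ultimately show ?thesis by simp
qed

text \<open>On \<open>N t \<omega> = k\<close> the first \<open>k\<close> jump times are finite, and
  the \<open>j\<close>-th has passed by time \<open>r\<close> exactly if
  \<open>j \<le> N r \<omega>\<close>; so the random sum becomes a step sum of fixed length. The
  upper bound combines compactness for the continuous part with the sum of the absolute
  heights.\<close>

lemma no_crossing_iff:
  assumes w: "\<omega> \<in> space M" and k: "N t \<omega> = k"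
  shows "no_crossing \<omega> \<longleftrightarrow> below_rat 0 t (\<lambda>r. B r \<omega> + step_sum k (times k \<omega>) (heights k \<omega>) r - a * r - b)"
    and "bdd_above ((\<lambda>r. jump_bm B N \<eta> r \<omega> - a * r - b) ` {0..<t})"
proof -
  have eq: "jump_bm B N \<eta> r \<omega> = B r \<omega> + step_sum k (times k \<omega>) (heights k \<omega>) r" if r: "0 \<le> r" "r < t" for r
  proof -
    have Nr: "N r \<omega> \<le> k" using counting_processD(3)[OF counting w r(1), of t] r k by simp
    have "step_sum k (times k \<omega>) (heights k \<omega>) r = (\<Sum>j\<in>{1..k}. if j \<le> N r \<omega> then \<eta> j \<omega> else 0)"
      unfolding step_sum_def
    proof (intro sum.cong refl)
      fix j assume j: "j \<in> {1..k}"
      then have "times k \<omega> j \<le> r \<longleftrightarrow> j \<le> N r \<omega>"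
        using jump_time_real_le_iff[OF counting w, of t j r] t_pos r k by (simp add: times_def)
      then show "(if times k \<omega> j \<le> r then heights k \<omega> j else 0) = (if j \<le> N r \<omega> then \<eta> j \<omega> else 0)"
        using j by (simp add: heights_def)
    qed
    also have "\<dots> = (\<Sum>j\<in>{1..N r \<omega>}. \<eta> j \<omega>)"
      using Nr by (intro sum.mono_neutral_cong_right) auto
    finally show ?thesis by (simp add: jump_bm_def)
  qed
  have "no_crossing \<omega> \<longleftrightarrow> below 0 t (\<lambda>r. B r \<omega> + step_sum k (times k \<omega>) (heights k \<omega>) r - a * r - b)"
    unfolding no_crossing_def by (intro below_cong) (simp add: eq)
  also have "\<dots> \<longleftrightarrow> below_rat 0 t (\<lambda>r. B r \<omega> + step_sum k (times k \<omega>) (heights k \<omega>) r - a * r - b)"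
    using jumps_right_continuous[of _ 1 k "waiting_time (times k \<omega>)" "heights k \<omega>"]
    unfolding jumps_waiting_time
    by (intro below_iff_rat continuous_intros B_right_continuous w)
  finally show "no_crossing \<omega> \<longleftrightarrow> below_rat 0 t (\<lambda>r. B r \<omega> + step_sum k (times k \<omega>) (heights k \<omega>) r - a * r - b)" .
  have "compact ((\<lambda>r. B r \<omega> - a * r - b) ` {0..t})"
    using B_continuous[OF w]
    by (intro compact_continuous_image continuous_intros) (auto elim: continuous_on_subset)
  then have "bdd_above ((\<lambda>r. B r \<omega> - a * r - b) ` {0..t})"
    by (intro bounded_imp_bdd_above compact_imp_bounded)
  then obtain K where "\<forall>x\<in>(\<lambda>r. B r \<omega> - a * r - b) ` {0..t}. x \<le> K"
    unfolding bdd_above_def by blast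
  then have K: "B r \<omega> - a * r - b \<le> K" if "r \<in> {0..t}" for r
    using that by simp
  have "jump_bm B N \<eta> r \<omega> - a * r - b \<le> K + (\<Sum>j\<in>{1..k}. \<bar>heights k \<omega> j\<bar>)" if r: "r \<in> {0..<t}" for r
  proof -
    have "step_sum k (times k \<omega>) (heights k \<omega>) r \<le> (\<Sum>j\<in>{1..k}. \<bar>heights k \<omega> j\<bar>)"
      unfolding step_sum_def by (intro sum_mono) auto
    moreover have "B r \<omega> - a * r - b \<le> K" using r by (intro K) auto
    moreover have "jump_bm B N \<eta> r \<omega> = B r \<omega> + step_sum k (times k \<omega>) (heights k \<omega>) r" using r by (intro eq) auto
    ultimately show ?thesis by linarith
  qed
  then show "bdd_above ((\<lambda>r. jump_bm B N \<eta> r \<omega> - a * r - b) ` {0..<t})" by (rule bdd_aboveI2)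
qed

definition crossing_fun :: "nat \<Rightarrow> (nat \<Rightarrow> real) \<times> (nat \<Rightarrow> real) \<times> (real \<Rightarrow> real) \<Rightarrow> real" where
  "crossing_fun k z = (if below_rat 0 t (\<lambda>r. snd (snd z) r + step_sum k (fst z) (fst (snd z)) r - a * r - b) then 1 else 0)"

lemma crossing_fun_measurable [measurable]:
  "crossing_fun k \<in> borel_measurable (borel_on {1..k} \<Otimes>\<^sub>M (borel_on {1..k} \<Otimes>\<^sub>M borel_on {0..}))"
  unfolding crossing_fun_def by measurable

lemma crossing_fun_le: "\<bar>crossing_fun k z\<bar> \<le> 1"
  by (simp add: crossing_fun_def)

lemma crossing_fun_path: "crossing_fun k (s, h, path \<omega>) = (if below_rat 0 t (\<lambda>r. B r \<omega> + step_sum k s h r - a * r - b) then 1 else 0)"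
proof -
  have "below_rat 0 t (\<lambda>r. path \<omega> r + step_sum k s h r - a * r - b) \<longleftrightarrow> below_rat 0 t (\<lambda>r. B r \<omega> + step_sum k s h r - a * r - b)"
    by (auto simp: below_rat_def path_def)
  then show ?thesis by (simp add: crossing_fun_def)
qed

lemma cond_prob_bounds: "0 \<le> cond_prob k s h" "cond_prob k s h \<le> 1"
proof -
  show "0 \<le> cond_prob k s h" unfolding cond_prob_def by (intro integral_nonneg_AE) auto
  show "cond_prob k s h \<le> 1"
  proof (cases "integrable M (\<lambda>\<omega>. if below_rat 0 t (\<lambda>r. B r \<omega> + step_sum k s h r - a * r - b) then 1 else 0 :: real)")
    case True
    then show ?thesis unfolding cond_prob_def by (intro integral_le_const) auto
  qed (simp add: cond_prob_def not_integrable_integral_eq)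
qed

lemma cond_prob_measurable [measurable]:
  "(\<lambda>(s, h). cond_prob k s h) \<in> borel_measurable (borel_on {1..k} \<Otimes>\<^sub>M borel_on {1..k})"
proof -
  note path_measurable[measurable]
  have "(\<lambda>z. LINT \<omega>|M. crossing_fun k (fst z, snd z, path \<omega>)) \<in> borel_measurable (borel_on {1..k} \<Otimes>\<^sub>M borel_on {1..k})"
    by measurable
  then show ?thesis by (simp add: crossing_fun_path cond_prob_def split_beta')
qed

text \<open>Conditioning on \<open>N t = k\<close> keeps jump times, heights and path independent
  and changes only the law of the times. Fubini then integrates out the path first. If the condition
  has probability 0, the prefactor makes both sides 0.\<close>

lemma prob_no_crossing:
  "prob {\<omega>\<in>space M. N t \<omega> = k \<and> no_crossing \<omega>} =
    prob {\<omega>\<in>space M. N t \<omega> = k} * (LINT s|jump_times_law M N t k. LINT h|jump_heights_law M \<eta> k. cond_prob k s h)"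
proof -
  define E where "E = {\<omega>\<in>space M. N t \<omega> = k}"
  define S where "S = {\<omega>\<in>space M. crossing_fun k (times k \<omega>, heights k \<omega>, path \<omega>) = 1}"
  note [measurable] = times_measurable heights_measurable path_measurable
  have E[measurable]: "E \<in> sets M" unfolding E_def by (rule N_event)
  have S[measurable]: "S \<in> sets M" unfolding S_def by measurable
  have ES: "{\<omega>\<in>space M. N t \<omega> = k \<and> no_crossing \<omega>} = E \<inter> S"
    using no_crossing_iff(1) by (auto simp: E_def S_def crossing_fun_path)
  show ?thesis
  proof (cases "prob E = 0")
    case True
    have "prob (E \<inter> S) \<le> prob E" by (intro finite_measure_mono) auto
    then have "prob (E \<inter> S) = 0" using True by (simp add: measure_le_0_iff)
    then show ?thesis using True unfolding ES by (simp add: E_def)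
  next
    case False
    define M' where "M' = uniform_measure M E"
    have E0: "emeasure M E \<noteq> 0" "emeasure M E \<noteq> \<infinity>" using False by (auto simp: emeasure_eq_measure)
    interpret M': prob_space M' unfolding M'_def by (rule prob_space_uniform_measure[OF E0])
    have space': "space M' = space M" and sets'[measurable_cong]: "sets M' = sets M" by (auto simp: M'_def)
    have meas': "emeasure M' A = emeasure M (E \<inter> A) / emeasure M E" if "A \<in> sets M" for A
      unfolding M'_def using that by simp
    define P where "P = jump_times_law M N t k"
    define Q where "Q = jump_heights_law M \<eta> k"
    define R where "R = distr M (borel_on {0..}) path"
    have P: "P = distr M' (borel_on {1..k}) (times k)"
      unfolding P_def jump_times_law_def M'_def E_def times_def ..
    have Q: "Q = distr M (borel_on {1..k}) (heights k)"
      unfolding Q_def jump_heights_law_def heights_def ..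
    have setsPQR[measurable_cong]: "sets P = sets (borel_on {1..k})" "sets Q = sets (borel_on {1..k})" "sets R = sets (borel_on {0..})"
      by (simp_all add: P Q R_def)
    interpret P: prob_space P unfolding P by (rule M'.prob_space_distr) measurable
    interpret Q: prob_space Q unfolding Q by (rule prob_space_distr) measurable
    interpret R: prob_space R unfolding R_def by (rule prob_space_distr) measurable
    interpret QR: pair_prob_space Q R ..
    interpret PQR: pair_prob_space P "Q \<Otimes>\<^sub>M R" ..
    have joint: "distr M' (P \<Otimes>\<^sub>M (Q \<Otimes>\<^sub>M R)) (\<lambda>\<omega>. (times k \<omega>, heights k \<omega>, path \<omega>)) = P \<Otimes>\<^sub>M (Q \<Otimes>\<^sub>M R)"
    proof (rule distr_triple_eqI)
      fix A B' C assume "A \<in> sets P" "B' \<in> sets Q" "C \<in> sets R"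
      then have [measurable]: "A \<in> sets (borel_on {1..k})" "B' \<in> sets (borel_on {1..k})" "C \<in> sets (borel_on {0..})"
        by (auto simp: setsPQR)
      let ?A = "times k -` A \<inter> space M" and ?B = "heights k -` B' \<inter> space M" and ?C = "path -` C \<inter> space M"
      have [measurable]: "?A \<in> sets M" "?B \<in> sets M" "?C \<in> sets M" by measurable
      \<comment> \<open>The conditioning event is grouped with the times, as both are determined by
        \<open>N\<close>.\<close>
      have "emeasure M (E \<inter> (?A \<inter> ?B \<inter> ?C)) = ennreal (prob (E \<inter> ?A \<inter> ?B \<inter> ?C))"
        by (simp add: emeasure_eq_measure Int_assoc)
      also have "prob (E \<inter> ?A \<inter> ?B \<inter> ?C) = prob (E \<inter> ?A) * prob ?B * prob ?C"
        unfolding E_def by (intro prob_three path_event heights_event times_event) measurable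
      also have "ennreal \<dots> = emeasure M (E \<inter> ?A) * emeasure M ?B * emeasure M ?C"
        by (simp add: emeasure_eq_measure ennreal_mult)
      finally have "emeasure M' (?A \<inter> ?B \<inter> ?C) = emeasure M' ?A * emeasure M ?B * emeasure M ?C"
        by (simp add: meas' divide_ennreal_def mult_ac)
      then show "emeasure M' ((times k -` A \<inter> space M') \<inter> (heights k -` B' \<inter> space M') \<inter> (path -` C \<inter> space M')) =
          emeasure P A * emeasure Q B' * emeasure R C"
        by (simp add: P Q R_def emeasure_distr space' del: One_nat_def)
    qed (unfold_locales, measurable)
    have "prob (E \<inter> S) / prob E = measure M' S"
      unfolding M'_def using E0 by simp
    also have "\<dots> = (LINT \<omega>|M'. indicator S \<omega>)"
      by (simp add: space' Int_absorb2 S_def)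
    also have "\<dots> = (LINT \<omega>|M'. crossing_fun k (times k \<omega>, heights k \<omega>, path \<omega>))"
      by (intro lint_cong) (auto simp: S_def space' crossing_fun_def indicator_def)
    also have "\<dots> = (LINT z|distr M' (P \<Otimes>\<^sub>M (Q \<Otimes>\<^sub>M R)) (\<lambda>\<omega>. (times k \<omega>, heights k \<omega>, path \<omega>)). crossing_fun k z)"
      by (subst integral_distr) auto
    also have "\<dots> = (LINT z|(P \<Otimes>\<^sub>M (Q \<Otimes>\<^sub>M R)). crossing_fun k z)" unfolding joint ..
    also have "\<dots> = (LINT s|P. (LINT y|(Q \<Otimes>\<^sub>M R). crossing_fun k (s, y)))"
      by (intro PQR.integral_fst'[symmetric] PQR.integrable_const_bound[where B=1] AE_I2) (auto simp: crossing_fun_le)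
    also have "\<dots> = (LINT s|P. (LINT h|Q. cond_prob k s h))"
    proof (intro lint_cong refl)
      fix s assume "s \<in> space P"
      then have s[measurable]: "s \<in> space (borel_on {1..k})" by (simp add: P)
      have "(LINT y|(Q \<Otimes>\<^sub>M R). crossing_fun k (s, y)) = (LINT h|Q. (LINT w|R. crossing_fun k (s, h, w)))"
        by (intro QR.integral_fst'[symmetric] QR.integrable_const_bound[where B=1] AE_I2) (auto simp: crossing_fun_le)
      also have "\<dots> = (LINT h|Q. cond_prob k s h)"
      proof (intro lint_cong refl)
        fix h assume "h \<in> space Q"
        then have h[measurable]: "h \<in> space (borel_on {1..k})" by (simp add: Q)
        show "(LINT w|R. crossing_fun k (s, h, w)) = cond_prob k s h"
          unfolding R_def by (subst integral_distr) (auto simp: crossing_fun_path cond_prob_def)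
      qed
      finally show "(LINT y|(Q \<Otimes>\<^sub>M R). crossing_fun k (s, y)) = (LINT h|Q. cond_prob k s h)" .
    qed
    finally show ?thesis
      unfolding ES P_def[symmetric] Q_def[symmetric] E_def[symmetric] using False by (simp add: field_simps)
  qed
qed

lemma no_crossing_event: "{\<omega>\<in>space M. N t \<omega> = k \<and> no_crossing \<omega>} \<in> sets M"
proof -
  note [measurable] = times_measurable heights_measurable path_measurable N_event
  have "{\<omega>\<in>space M. N t \<omega> = k \<and> no_crossing \<omega>} =
     {\<omega>\<in>space M. N t \<omega> = k} \<inter> {\<omega>\<in>space M. crossing_fun k (times k \<omega>, heights k \<omega>, path \<omega>) = 1}"
    using no_crossing_iff(1) by (auto simp: crossing_fun_path)
  also have "\<dots> \<in> sets M" by measurable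
  finally show ?thesis .
qed

lemma prob_no_crossing_sums:
  "(\<lambda>k. prob {\<omega>\<in>space M. N t \<omega> = k} * (LINT s|jump_times_law M N t k. LINT h|jump_heights_law M \<eta> k. cond_prob k s h))
    sums prob {\<omega>\<in>space M. (SUP s\<in>{0..<t}. jump_bm B N \<eta> s \<omega> - a * s - b) < 0}"
proof -
  have "(\<lambda>k. prob {\<omega>\<in>space M. N t \<omega> = k \<and> no_crossing \<omega>}) sums prob (\<Union>k. {\<omega>\<in>space M. N t \<omega> = k \<and> no_crossing \<omega>})"
    using no_crossing_event by (intro finite_measure_UNION) (auto simp: disjoint_family_on_def)
  moreover have "(\<Union>k. {\<omega>\<in>space M. N t \<omega> = k \<and> no_crossing \<omega>}) =
      {\<omega>\<in>space M. (SUP s\<in>{0..<t}. jump_bm B N \<eta> s \<omega> - a * s - b) < 0}"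
    using SUP_less_0_iff_below[OF no_crossing_iff(2) t_pos] by (auto simp: no_crossing_def)
  ultimately show ?thesis by (simp add: prob_no_crossing)
qed

lemma gaussian_integral_cond_prob:
  assumes "s \<in> ordered_times t k"
  shows "gaussian_integral a b t k (waiting_time s) h = cond_prob k s h"
proof -
  have "gaussian_integral a b t k (waiting_time s) h = surv_prob a 1 k (waiting_time s) h t b"
    using ordered_times_waiting[OF assms t_pos] b_pos by (intro gaussian_integral_eq) auto
  also have "\<dots> = cond_prob k s h"
    unfolding surv_prob_def cond_prob_def
    using below_jumps_iff_rat[of _ t 1 k "waiting_time s" h a b] unfolding jumps_waiting_time
    by (intro lint_cong refl) simp
  finally show ?thesis .
qed

lemma heights_integral_measurable [measurable]:
  "(\<lambda>s. LINT h|jump_heights_law M \<eta> k. cond_prob k s h) \<in> borel_measurable (borel_on {1..k})"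
proof -
  interpret Q: prob_space "jump_heights_law M \<eta> k"
    by (rule prob_space_jump_heights_law) (use eta_measurable prob_space_axioms in auto)
  show ?thesis
    using cond_prob_measurable by (intro Q.borel_measurable_lebesgue_integral) (simp add: split_beta' cong: measurable_cong_sets sets_pair_measure_cong)
qed

text \<open>\<open>gaussian_integral\<close> has been evaluated only for ordered times before
  \<open>t\<close>; the almost sure condition makes the indicator of that set equal to 1.\<close>

lemma crossing_general:
  assumes AE: "\<forall>k. AE s in jump_times_law M N t k. s \<in> ordered_times t k"
  shows "(\<lambda>k. prob {\<omega> \<in> space M. N t \<omega> = k} *
             (LINT s:ordered_times t k|jump_times_law M N t k.
               (LINT h|jump_heights_law M \<eta> k.
                 gaussian_integral a b t k (waiting_time s) h)))
         sums prob {\<omega> \<in> space M. (SUP s\<in>{0..<t}. jump_bm B N \<eta> s \<omega> - a * s - b) < 0}"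
proof -
  have "(LINT s:ordered_times t k|jump_times_law M N t k. (LINT h|jump_heights_law M \<eta> k. gaussian_integral a b t k (waiting_time s) h)) =
    (LINT s|jump_times_law M N t k. LINT h|jump_heights_law M \<eta> k. cond_prob k s h)" for k
  proof -
    have "(LINT s:ordered_times t k|jump_times_law M N t k. (LINT h|jump_heights_law M \<eta> k. gaussian_integral a b t k (waiting_time s) h)) =
      (LINT s|jump_times_law M N t k. (if s \<in> ordered_times t k then 1 else 0) * (LINT h|jump_heights_law M \<eta> k. cond_prob k s h))"
      unfolding set_lebesgue_integral_def
      by (intro lint_cong refl)
         (auto intro!: lint_cong simp: gaussian_integral_cond_prob)
    also have "\<dots> = (LINT s|jump_times_law M N t k. LINT h|jump_heights_law M \<eta> k. cond_prob k s h)"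
    proof (rule integral_cong_AE)
      show "AE s in jump_times_law M N t k. (if s \<in> ordered_times t k then 1 else 0) * (LINT h|jump_heights_law M \<eta> k. cond_prob k s h) =
          (LINT h|jump_heights_law M \<eta> k. cond_prob k s h)"
        using AE[rule_format, of k] by eventually_elim simp
    qed measurable
    finally show ?thesis .
  qed
  then show ?thesis using prob_no_crossing_sums by simp
qed

end

section \<open>Jump times of a Poisson process\<close>

text \<open>The times may reach \<open>t\<close>, unlike in \<open>ordered_times\<close>, because
  the boxes below are closed on the right; the extra boundary is a Lebesgue null set.\<close>

definition ordered_simplex :: "real \<Rightarrow> nat \<Rightarrow> (nat \<Rightarrow> real) set" where
  "ordered_simplex t k = {s\<in>space (borel_on {1..k}). (\<forall>i\<in>{1..k}. 0 < s i \<and> s i \<le> t) \<and> (\<forall>i\<in>{1..k}. \<forall>j\<in>{i<..k}. s i < s j)}"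

text \<open>The points cut \<open>{0<..t}\<close> into \<open>2 * k + 1\<close> pieces, gaps and
  boxes alternating: the piece from \<open>p (2 * i - 1)\<close> to \<open>p (2 * i)\<close> is
  meant to hold the jump with index \<open>i\<close>. Neighbours may coincide, so pieces may be
  empty.\<close>

definition grid :: "real \<Rightarrow> nat \<Rightarrow> (nat \<Rightarrow> real) \<Rightarrow> bool" where
  "grid t k p \<longleftrightarrow> mono p \<and> p 0 = 0 \<and> p (2 * k + 1) = t"

definition time_box :: "nat \<Rightarrow> (nat \<Rightarrow> real) \<Rightarrow> (nat \<Rightarrow> real) set" where
  "time_box k p = (\<Pi>\<^sub>E i\<in>{1..k}. {p (2 * i - 1)<..p (2 * i)})"

text \<open>The empty set takes care of intersections of disjoint boxes.\<close>

definition time_boxes :: "real \<Rightarrow> nat \<Rightarrow> (nat \<Rightarrow> real) set set" where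
  "time_boxes t k = insert {} {time_box k p | p. grid t k p}"

lemma sets_simplex [measurable]: "ordered_simplex t k \<in> sets (borel_on {1..k})"
  unfolding ordered_simplex_def pred_def[symmetric]
proof (intro pred_intros_logic pred_intros_finite)
  fix i assume i: "i \<in> {1..k}"
  then have [measurable]: "(\<lambda>x. x i) \<in> borel_measurable (borel_on {1..k})"
    by (rule measurable_component_singleton)
  show "Measurable.pred (borel_on {1..k}) (\<lambda>s. 0 < (s i :: real))" by measurable
  show "Measurable.pred (borel_on {1..k}) (\<lambda>s. s i \<le> t)" by measurable
  fix j assume "j \<in> {i<..k}"
  then have [measurable]: "(\<lambda>x. x j) \<in> borel_measurable (borel_on {1..k})"
    using i by (intro measurable_component_singleton) auto
  show "Measurable.pred (borel_on {1..k}) (\<lambda>s. s i < (s j :: real))" by measurable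
qed auto

section \<open>The boxes as an intersection-stable generator on the simplex\<close>

lemma sets_time_box [measurable]: "time_box k p \<in> sets (borel_on {1..k})"
  unfolding time_box_def by (intro sets_PiM_I_finite) auto

lemma time_box_subset_simplex:
  assumes g: "grid t k p" shows "time_box k p \<subseteq> ordered_simplex t k"
proof
  fix s assume s: "s \<in> time_box k p"
  have m: "i \<le> j \<Longrightarrow> p i \<le> p j" for i j using g by (auto simp: grid_def mono_def)
  have s1: "p (2 * i - 1) < s i" "s i \<le> p (2 * i)" if "i \<in> {1..k}" for i
    using s that unfolding time_box_def by (auto dest: PiE_mem)
  have "0 < s i \<and> s i \<le> t" if i: "i \<in> {1..k}" for i
    using s1[OF i] m[of 0 "2 * i - 1"] m[of "2 * i" "2 * k + 1"] g i by (auto simp: grid_def)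
  moreover have "s i < s j" if "i \<in> {1..k}" "j \<in> {i<..k}" for i j
  proof -
    have "2 * i \<le> 2 * j - 1" using that by auto
    then show ?thesis using s1[of i] s1[of j] m[of "2 * i" "2 * j - 1"] that by auto
  qed
  moreover have "s \<in> space (borel_on {1..k})"
    using s by (auto simp: time_box_def space_PiM PiE_iff)
  ultimately show "s \<in> ordered_simplex t k" unfolding ordered_simplex_def by blast
qed

text \<open>Left ends, at odd indices, are combined by maximum and right ends, at even indices, by
  minimum. From an odd index to the next the new grid is monotone because a common point of the two
  boxes separates the ends; from an even index this is automatic.\<close>

lemma Int_stable_time_boxes: "Int_stable (time_boxes t k)"
proof (rule Int_stableI)
  have "time_box k p \<inter> time_box k q \<in> time_boxes t k" if p: "grid t k p" and q: "grid t k q" for p q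
  proof (cases "time_box k p \<inter> time_box k q = {}")
    case False
    then obtain s where s: "s \<in> time_box k p" "s \<in> time_box k q" by auto
    \<comment> \<open>Beyond the last index the old grids may differ and exceed \<open>t\<close>;
      the constant \<open>t\<close> keeps \<open>r\<close> monotone everywhere.\<close>
    define r where "r j = (if j \<ge> 2 * k + 1 then t else if odd j then max (p j) (q j) else min (p j) (q j))" for j
    have m: "i \<le> j \<Longrightarrow> p i \<le> p j" "i \<le> j \<Longrightarrow> q i \<le> q j" for i j
      using p q by (auto simp: grid_def mono_def)
    have r_le: "p j \<le> t" "q j \<le> t" if "j \<le> 2 * k + 1" for j
      using m(1)[OF that] m(2)[OF that] p q by (auto simp: grid_def)
    have "r j \<le> r (Suc j)" for j
    proof (cases "j < 2 * k")
      case True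
      show ?thesis
      proof (cases "even j")
        case ev: True
        have "p j \<le> p (Suc j)" by (rule m) simp
        then show ?thesis using True ev by (auto simp: r_def)
      next
        case False
        then obtain i where i: "j = 2 * i - 1" "Suc j = 2 * i" "i \<in> {1..k}"
          using True by (auto elim!: oddE intro: that[of "Suc (j div 2)"])
        have "p j < s i" "s i \<le> p (Suc j)" "q j < s i" "s i \<le> q (Suc j)"
          using s i(3) unfolding i(1) i(2)[unfolded i(1)] time_box_def by (auto dest!: PiE_mem)
        then show ?thesis using True False by (auto simp: r_def)
      qed
    next
      case False
      then show ?thesis using r_le[of j] by (auto simp: r_def)
    qed
    then have "mono r" by (simp add: mono_iff_le_Suc)
    then have "grid t k r" using p q by (auto simp: grid_def r_def)
    moreover have "time_box k p \<inter> time_box k q = time_box k r"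
    proof -
      have "{p (2 * i - 1)<..p (2 * i)} \<inter> {q (2 * i - 1)<..q (2 * i)} = {r (2 * i - 1)<..r (2 * i)}" if "i \<in> {1..k}" for i
        using that by (auto simp: r_def)
      then show ?thesis unfolding time_box_def PiE_Int by (intro PiE_cong) auto
    qed
    ultimately show ?thesis by (auto simp: time_boxes_def)
  qed (simp add: time_boxes_def)
  then show "a \<inter> b \<in> time_boxes t k" if "a \<in> time_boxes t k" "b \<in> time_boxes t k" for a b
    using that by (auto simp: time_boxes_def)
qed

text \<open>Half-spaces of the simplex are countable unions of boxes, which will make the
  coordinates measurable. With an index outside \<open>{1..k}\<close> the constraint is void and the
  union is the whole simplex.\<close>

lemma time_boxes_cover:
  assumes t: "0 < t"
  shows "\<exists>F. countable F \<and> F \<subseteq> time_boxes t k \<and> \<Union>F = {s\<in>ordered_simplex t k. i \<in> {1..k} \<longrightarrow> s i \<le> c}"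
proof -
  \<comment> \<open>Rational separating points do not suffice when a coordinate equals
    \<open>c\<close> or the last one equals \<open>t\<close>; these values, and the smaller of them
    for the last coordinate, are allowed as well.\<close>
  define C where "C = insert c (insert t (insert (min t c) \<rat>))"
  have "countable C" unfolding C_def by (simp add: countable_rat)
  \<comment> \<open>Each cut serves twice, as right end of one box and left end of the next: box
    \<open>j\<close> is the interval from \<open>q (j - 1)\<close>, or from 0 if
    \<open>j = 1\<close>, to \<open>q j\<close>.\<close>
  define p where "p q j = (if 2 * k < j then t else if j \<le> 1 then 0 else q (j div 2))" for q :: "nat \<Rightarrow> real" and j :: nat
  define Q where "Q = {q \<in> (\<Pi>\<^sub>E i\<in>{1..k}. C). grid t k (p q) \<and> (i \<in> {1..k} \<longrightarrow> q i \<le> c)}"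
  have "countable Q"
    unfolding Q_def using \<open>countable C\<close> by (intro countable_subset[OF _ countable_PiE[of "{1..k}" "\<lambda>_. C"]]) auto
  define F where "F = (\<lambda>q. time_box k (p q)) ` Q"
  have "F \<subseteq> time_boxes t k" by (auto simp: F_def time_boxes_def Q_def)
  moreover have "\<Union>F = {s\<in>ordered_simplex t k. i \<in> {1..k} \<longrightarrow> s i \<le> c}"
  proof (intro subset_antisym subsetI)
    fix s assume "s \<in> \<Union>F"
    then obtain q where q: "q \<in> Q" "s \<in> time_box k (p q)" by (auto simp: F_def)
    then have "s \<in> ordered_simplex t k" using time_box_subset_simplex by (auto simp: Q_def)
    moreover have "s i \<le> c" if i: "i \<in> {1..k}"
    proof -
      have "s i \<le> p q (2 * i)" using q(2) i unfolding time_box_def by (auto dest: PiE_mem)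
      also have "\<dots> = q i" using i by (auto simp: p_def)
      also have "\<dots> \<le> c" using q i by (auto simp: Q_def)
      finally show ?thesis .
    qed
    ultimately show "s \<in> {s\<in>ordered_simplex t k. i \<in> {1..k} \<longrightarrow> s i \<le> c}" by auto
  next
    fix s assume "s \<in> {s\<in>ordered_simplex t k. i \<in> {1..k} \<longrightarrow> s i \<le> c}"
    then have s: "s \<in> space (borel_on {1..k})" "\<And>j. j \<in> {1..k} \<Longrightarrow> 0 < s j \<and> s j \<le> t"
       "\<And>i j. i \<in> {1..k} \<Longrightarrow> j \<in> {i<..k} \<Longrightarrow> s i < s j" and c: "i \<in> {1..k} \<Longrightarrow> s i \<le> c"
      by (auto simp: ordered_simplex_def)
    have "\<exists>x\<in>C. s j \<le> x \<and> (j < k \<longrightarrow> x < s (Suc j)) \<and> x \<le> t \<and> (j = i \<longrightarrow> x \<le> c)" if j: "j \<in> {1..k}" for j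
    proof (cases "j < k")
      case True
      then have lt: "s j < s (Suc j)" "s (Suc j) \<le> t" using s(3)[of j "Suc j"] s(2)[of "Suc j"] j by auto
      show ?thesis
      proof (cases "j = i \<and> s i = c")
        case True
        then show ?thesis using lt by (intro bexI[of _ c]) (auto simp: C_def)
      next
        case False
        then have "s j < (if j = i then min c (s (Suc j)) else s (Suc j))" using c j lt by auto
        then obtain x where "x \<in> \<rat>" "s j < x" "x < (if j = i then min c (s (Suc j)) else s (Suc j))"
          using Rats_dense_in_real by blast
        then show ?thesis using lt by (intro bexI[of _ x]) (auto simp: C_def split: if_splits)
      qed
    next
      case False
      then show ?thesis using s(2)[OF j] c j
        by (cases "j = i") (auto simp: C_def intro!: bexI[of _ "min t c"] bexI[of _ t])
    qed
    then obtain q0 where q0: "\<And>j. j \<in> {1..k} \<Longrightarrow> q0 j \<in> C \<and> s j \<le> q0 j \<and> (j < k \<longrightarrow> q0 j < s (Suc j)) \<and> q0 j \<le> t \<and> (j = i \<longrightarrow> q0 j \<le> c)"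
      by metis
    define q where "q = restrict q0 {1..k}"
    have q: "q j \<in> C" "s j \<le> q j" "q j \<le> t" "j < k \<Longrightarrow> q j < s (Suc j)" "j = i \<Longrightarrow> q j \<le> c" if "j \<in> {1..k}" for j
      using q0[OF that] that by (auto simp: q_def)
    have "p q j \<le> p q (Suc j)" for j
    proof -
      consider "2 * k < j" | "j \<le> 2 * k" "2 * k < Suc j" | "Suc j \<le> 2 * k" "j = 0" | "Suc j \<le> 2 * k" "j = 1" |
        (mid) "Suc j \<le> 2 * k" "2 \<le> j" by linarith
      then show ?thesis
      proof cases
        case 2
        then have "j = 2 * k" by simp
        then show ?thesis using q(3)[of k] t by (cases "k = 0") (auto simp: p_def)
      next
        case 4
        then show ?thesis using q(2)[of 1] s(2)[of 1] by (auto simp: p_def)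
      next
        case mid
        show ?thesis
        proof (cases "even j")
          case True
          then show ?thesis using mid by (auto simp: p_def)
        next
          case False
          then have "Suc j div 2 = Suc (j div 2)" by (auto elim: oddE)
          moreover have "j div 2 \<in> {1..k}" "Suc (j div 2) \<in> {1..k}" using mid by auto
          ultimately show ?thesis using mid q(4)[of "j div 2"] q(2)[of "Suc (j div 2)"] by (auto simp: p_def)
        qed
      qed (auto simp: p_def)
    qed
    then have "grid t k (p q)" by (auto simp: grid_def mono_iff_le_Suc p_def)
    then have "q \<in> Q" using q by (auto simp: Q_def q_def)
    moreover have "s \<in> time_box k (p q)"
      unfolding time_box_def
    proof (rule PiE_I)
      fix j assume j: "j \<in> {1..k}"
      have "p q (2 * j) = q j" using j by (auto simp: p_def)
      moreover have "p q (2 * j - 1) < s j"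
      proof (cases "j = 1")
        case True
        then show ?thesis using s(2)[OF j] j by (auto simp: p_def)
      next
        case False
        then have "(2 * j - 1) div 2 = j - 1" "j - 1 \<in> {1..k}" using j by auto
        then show ?thesis using q(4)[of "j - 1"] False j by (auto simp: p_def)
      qed
      ultimately show "s j \<in> {p q (2 * j - 1)<..p q (2 * j)}" using q(2)[OF j] by auto
    qed (use s(1) in \<open>auto simp: space_PiM PiE_iff extensional_def\<close>)
    ultimately show "s \<in> \<Union>F" by (auto simp: F_def)
  qed
  moreover have "countable F" using \<open>countable Q\<close> by (simp add: F_def)
  ultimately show ?thesis by blast
qed

text \<open>For the nontrivial inclusion, \<open>time_boxes_cover\<close> makes every coordinate,
  hence the identity map into the product space, measurable for the sigma-algebra generated by the
  boxes.\<close>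

lemma sigma_sets_time_boxes:
  assumes t: "0 < t"
  shows "sigma_sets (ordered_simplex t k) (time_boxes t k) = sets (restrict_space (borel_on {1..k}) (ordered_simplex t k))"
proof (intro subset_antisym subsetI)
  have sub: "time_boxes t k \<subseteq> Pow (ordered_simplex t k)"
    using time_box_subset_simplex by (auto simp: time_boxes_def)
  have sp: "ordered_simplex t k \<subseteq> space (borel_on {1..k})" by (auto simp: ordered_simplex_def)
  {
    fix A assume "A \<in> sigma_sets (ordered_simplex t k) (time_boxes t k)"
    moreover have "time_boxes t k \<subseteq> sets (restrict_space (borel_on {1..k}) (ordered_simplex t k))"
    proof
      fix x assume "x \<in> time_boxes t k"
      then show "x \<in> sets (restrict_space (borel_on {1..k}) (ordered_simplex t k))"
        using time_box_subset_simplex sp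
        by (auto simp: time_boxes_def sets_restrict_space_iff Int_absorb2 simp del: One_nat_def)
    qed
    ultimately show "A \<in> sets (restrict_space (borel_on {1..k}) (ordered_simplex t k))"
      using sets.sigma_sets_subset[of _ "restrict_space (borel_on {1..k}) (ordered_simplex t k)"] sp
      by (auto simp: space_restrict_space Int_absorb2)
  next
    fix A assume "A \<in> sets (restrict_space (borel_on {1..k}) (ordered_simplex t k))"
    then obtain D where D: "D \<in> sets (borel_on {1..k})" "A = ordered_simplex t k \<inter> D"
      by (auto simp: sets_restrict_space)
    let ?S = "sigma (ordered_simplex t k) (time_boxes t k)"
    have sS: "space ?S = ordered_simplex t k" "sets ?S = sigma_sets (ordered_simplex t k) (time_boxes t k)"
      using sub by auto
    have "(\<lambda>s i. s i) \<in> measurable ?S (borel_on {1..k})"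
    proof (rule measurable_PiM_single')
      fix i assume i: "i \<in> {1..k}"
      show "(\<lambda>s. s i) \<in> borel_measurable ?S"
        unfolding borel_measurable_iff_le
      proof
        fix c
        obtain F where F: "countable F" "F \<subseteq> time_boxes t k" "\<Union>F = {s\<in>ordered_simplex t k. i \<in> {1..k} \<longrightarrow> s i \<le> c}"
          using time_boxes_cover[OF t, of k i c] by blast
        have "\<Union>F \<in> sets ?S"
          unfolding sS by (rule sigma_sets_UNION[OF F(1)]) (use F(2) in blast)
        moreover have "\<Union>F = {w \<in> space ?S. w i \<le> c}" unfolding F(3) sS(1) using i by blast
        ultimately show "{w \<in> space ?S. w i \<le> c} \<in> sets ?S" by (simp only:)
      qed
    qed (use sp sS in \<open>auto simp: space_PiM\<close>)
    from measurable_sets[OF this D(1)] show "A \<in> sigma_sets (ordered_simplex t k) (time_boxes t k)"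
      unfolding sS D(2) by (simp add: Int_commute)
  }
qed

text \<open>Uniqueness on an intersection-stable generator, applied after restriction to the
  simplex; the complement is null for both measures, so nothing is lost.\<close>

lemma measure_eqI_time_boxes:
  assumes t: "0 < t"
    and sets: "sets P = sets (borel_on {1..k})" "sets Q = sets (borel_on {1..k})"
    and eq: "\<And>p. grid t k p \<Longrightarrow> emeasure P (time_box k p) = emeasure Q (time_box k p)"
    and fin: "\<And>p. grid t k p \<Longrightarrow> emeasure P (time_box k p) \<noteq> \<infinity>"
    and AE: "AE s in P. s \<in> ordered_simplex t k" "AE s in Q. s \<in> ordered_simplex t k"
  shows "P = Q"
proof (rule measure_eqI)
  have sS: "ordered_simplex t k \<in> sets P" "ordered_simplex t k \<in> sets Q" unfolding sets by (rule sets_simplex)+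
  have sub: "time_boxes t k \<subseteq> Pow (ordered_simplex t k)"
    using time_box_subset_simplex by (auto simp: time_boxes_def)
  have tb: "X \<in> sets (borel_on {1..k})" if "X \<in> time_boxes t k" for X
    using that by (auto simp: time_boxes_def simp del: One_nat_def)
  have rP: "emeasure (restrict_space P (ordered_simplex t k)) X = emeasure P X" "emeasure (restrict_space Q (ordered_simplex t k)) X = emeasure Q X"
    if "X \<subseteq> ordered_simplex t k" for X
    using that sS by (auto simp: emeasure_restrict_space)
  \<comment> \<open>The index 0 is outside \<open>{1..k}\<close>, so this is a countable cover of
    the simplex.\<close>
  obtain F where F: "countable F" "F \<subseteq> time_boxes t k" "\<Union>F = ordered_simplex t k"
    using time_boxes_cover[OF t, of k 0] by auto
  have "restrict_space P (ordered_simplex t k) = restrict_space Q (ordered_simplex t k)"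
  proof (rule measure_eqI_generator_eq_countable[OF Int_stable_time_boxes sub _ _ _ F(2,3,1)])
    show "sets (restrict_space P (ordered_simplex t k)) = sigma_sets (ordered_simplex t k) (time_boxes t k)"
         "sets (restrict_space Q (ordered_simplex t k)) = sigma_sets (ordered_simplex t k) (time_boxes t k)"
      unfolding sigma_sets_time_boxes[OF t] by (rule sets_restrict_space_cong[OF sets(1)], rule sets_restrict_space_cong[OF sets(2)])
    show "emeasure (restrict_space P (ordered_simplex t k)) X = emeasure (restrict_space Q (ordered_simplex t k)) X" if "X \<in> time_boxes t k" for X
    proof -
      have "X \<subseteq> ordered_simplex t k" using that sub by auto
      then show ?thesis using that eq by (simp only: rP) (auto simp: time_boxes_def)
    qed
    show "emeasure (restrict_space P (ordered_simplex t k)) X \<noteq> \<infinity>" if "X \<in> F" for X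
    proof -
      have X: "X \<in> time_boxes t k" using that F(2) by auto
      then have "X \<subseteq> ordered_simplex t k" using sub by auto
      then show ?thesis using X fin by (simp only: rP) (auto simp: time_boxes_def)
    qed
  qed
  then have eq': "emeasure P (A \<inter> ordered_simplex t k) = emeasure Q (A \<inter> ordered_simplex t k)" for A
    using rP[of "A \<inter> ordered_simplex t k"] by simp
  show "emeasure P A = emeasure Q A" if A: "A \<in> sets P" for A
  proof -
    have "emeasure P A = emeasure P (A \<inter> ordered_simplex t k)"
      using AE(1) A sS by (intro emeasure_eq_AE) auto
    also have "\<dots> = emeasure Q (A \<inter> ordered_simplex t k)" by (rule eq')
    also have "\<dots> = emeasure Q A"
      using AE(2) A sS sets by (intro emeasure_eq_AE) auto
    finally show ?thesis .
  qed
qed (simp add: sets)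

section \<open>Box probabilities of a Poisson process\<close>

lemma jump_time_exact:
  assumes c: "counting_process M N" and w: "\<omega> \<in> space M" and k: "1 \<le> k" and x: "jump_time N k \<omega> = ereal x"
  shows "0 < x" "N x \<omega> = k"
proof -
  have x0: "0 \<le> x" using jump_time_nonneg[of N k \<omega>] x by simp
  have kx: "k \<le> N x \<omega>" using jump_time_le_iff[OF c w x0, of k] x by simp
  then have "x \<noteq> 0" using counting_processD(2)[OF c w] k by auto
  then show x_pos: "0 < x" using x0 by simp
  from counting_left_lim[OF c w x_pos] obtain e where e: "0 \<le> e" "e < x"
    and ll: "\<And>r. e \<le> r \<Longrightarrow> r < x \<Longrightarrow> N r \<omega> = left_lim N x \<omega>" by blast
  have "\<not> jump_time N k \<omega> \<le> ereal e" using e x by simp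
  then have "N e \<omega> < k" using jump_time_le_iff[OF c w e(1), of k] by simp
  \<comment> \<open>Just before \<open>x\<close> the count is below \<open>k\<close>, at
    \<open>x\<close> it is at least \<open>k\<close>, and steps have size one.\<close>
  then have "left_lim N x \<omega> < k" using ll[of e] e by simp
  then show "N x \<omega> = k" using counting_processD(5)[OF c w x_pos] kx by auto
qed

text \<open>A grid may have equal neighbours, whereas the Poisson law of increments is given for
  positive length; in the degenerate case the same formula is checked directly.\<close>

lemma poisson_increment_prob:
  assumes M: "prob_space M" and N: "poisson_process M l N" and l: "0 < l" and "0 \<le> s" "s \<le> u"
  shows "measure M {\<omega>\<in>space M. N u \<omega> - N s \<omega> = (if c then 1 else 0)} = exp (- (l * (u - s))) * (if c then l * (u - s) else 1)"
proof (cases "s = u")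
  case True
  have "measure M {\<omega>\<in>space M. N u \<omega> - N s \<omega> = (if c then 1 else 0)} = (if c then 0 else measure M (space M))"
    using True by auto
  moreover have "measure M (space M) = 1" by (rule prob_space.prob_space[OF M])
  ultimately show ?thesis using True by simp
next
  case False
  then have su: "s < u" using assms by simp
  have c: "counting_process M N" using N by (simp add: poisson_process_def)
  have [measurable]: "N u \<in> measurable M (count_space UNIV)" "N s \<in> measurable M (count_space UNIV)"
    using counting_processD(1)[OF c] assms by auto
  have d: "distr M (count_space UNIV) (\<lambda>\<omega>. N u \<omega> - N s \<omega>) = measure_pmf (poisson_pmf (l * (u - s)))"
    using N su assms by (auto simp: poisson_process_def)
  define n :: nat where "n = (if c then 1 else 0)"
  have "measure M {\<omega>\<in>space M. N u \<omega> - N s \<omega> = n} = measure (distr M (count_space UNIV) (\<lambda>\<omega>. N u \<omega> - N s \<omega>)) {n}"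
    by (subst measure_distr) (auto intro!: arg_cong[where f="measure M"])
  also have "\<dots> = exp (- (l * (u - s))) * (if c then l * (u - s) else 1)"
    using l su unfolding d by (simp add: measure_pmf_single n_def)
  finally show ?thesis unfolding n_def .
qed

lemma poisson_count_prob:
  assumes M: "prob_space M" and N: "poisson_process M l N" and l: "0 < l" and t: "0 < t"
  shows "measure M {\<omega>\<in>space M. N t \<omega> = k} = pmf (poisson_pmf (l * t)) k"
proof -
  have c: "counting_process M N" using N by (simp add: poisson_process_def)
  have [measurable]: "N t \<in> measurable M (count_space UNIV)" "N 0 \<in> measurable M (count_space UNIV)"
    using counting_processD(1)[OF c] t by auto
  have d: "distr M (count_space UNIV) (\<lambda>\<omega>. N t \<omega> - N 0 \<omega>) = measure_pmf (poisson_pmf (l * (t - 0)))"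
    using N t unfolding poisson_process_def by blast
  have "measure M {\<omega>\<in>space M. N t \<omega> = k} = measure (distr M (count_space UNIV) (\<lambda>\<omega>. N t \<omega> - N 0 \<omega>)) {k}"
    using counting_processD(2)[OF c] by (subst measure_distr) (auto intro!: arg_cong[where f="measure M"])
  then show ?thesis unfolding d by (simp add: measure_pmf_single)
qed

lemma prod_odd_lessThan:
  fixes f :: "nat \<Rightarrow> real"
  shows "(\<Prod>i<2 * k + 1. if odd i then f i else 1) = (\<Prod>i=1..k. f (2 * i - 1))"
proof (induction k)
  case (Suc k)
  have "2 * Suc k + 1 = Suc (Suc (2 * k + 1))" by simp
  then show ?case using Suc by (simp del: mult_Suc_right)
qed simp

text \<open>Increments over successive pieces are independent. Each piece contributes an
  exponential, and their exponents telescope to - l t; each box also contributes \<open>l\<close>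
  times its length.\<close>

lemma (in prob_space) poisson_box_prob:
  assumes N: "poisson_process M l N" and l: "0 < l" and g: "grid t k p"
  shows "prob {\<omega>\<in>space M. \<forall>i<2 * k + 1. N (p (Suc i)) \<omega> - N (p i) \<omega> = (if odd i then 1 else 0)} =
    l ^ k * exp (- l * t) * (\<Prod>i=1..k. p (2 * i) - p (2 * i - 1))"
proof -
  have mono: "mono p" "p 0 = 0" and pt: "p (2 * k + 1) = t" using g by (auto simp: grid_def)
  have p_le: "p i \<le> p (Suc i)" and p0: "0 \<le> p i" for i
    using mono(1)[THEN monoD, of i "Suc i"] mono(1)[THEN monoD, of 0 i] mono(2) by auto
  define D where "D i \<omega> = N (p (Suc i)) \<omega> - N (p i) \<omega>" for i \<omega>
  have ind: "indep_vars (\<lambda>_. count_space UNIV) D {..<2 * k + 1}"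
    unfolding D_def using N mono by (auto simp: poisson_process_def)
  have "{\<omega>\<in>space M. \<forall>i<2 * k + 1. D i \<omega> = (if odd i then 1 else 0)} =
    (\<Inter>i\<in>{..<2 * k + 1}. D i -` {if odd i then 1 else 0} \<inter> space M)" by auto
  then have "prob {\<omega>\<in>space M. \<forall>i<2 * k + 1. D i \<omega> = (if odd i then 1 else 0)} =
    (\<Prod>i<2 * k + 1. prob (D i -` {if odd i then 1 else 0} \<inter> space M))"
    using indep_varsD[OF ind, of "{..<2 * k + 1}" "\<lambda>i. {if odd i then 1 else 0}"] by auto
  also have "\<dots> = (\<Prod>i<2 * k + 1. exp (- (l * (p (Suc i) - p i))) * (if odd i then l * (p (Suc i) - p i) else 1))"
  proof (intro prod.cong refl)
    fix i
    have "D i -` {if odd i then 1 else 0} \<inter> space M = {\<omega>\<in>space M. N (p (Suc i)) \<omega> - N (p i) \<omega> = (if odd i then 1 else 0)}"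
      by (auto simp: D_def)
    then show "prob (D i -` {if odd i then 1 else 0} \<inter> space M) = exp (- (l * (p (Suc i) - p i))) * (if odd i then l * (p (Suc i) - p i) else 1)"
      using poisson_increment_prob[OF prob_space_axioms N l p0 p_le, of i "odd i"] by simp
  qed
  also have "\<dots> = exp (\<Sum>i<2 * k + 1. - (l * (p (Suc i) - p i))) * (\<Prod>i=1..k. l * (p (Suc (2 * i - 1)) - p (2 * i - 1)))"
    unfolding prod.distrib prod_odd_lessThan exp_sum[OF finite_lessThan] ..
  also have "(\<Sum>i<2 * k + 1. - (l * (p (Suc i) - p i))) = - l * t"
    using sum_lessThan_telescope[of p "2 * k + 1"] mono(2) pt
    by (simp only: sum_negf sum_distrib_left[symmetric]) simp
  also have "(\<Prod>i=1..k. l * (p (Suc (2 * i - 1)) - p (2 * i - 1))) = l ^ k * (\<Prod>i=1..k. p (2 * i) - p (2 * i - 1))"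
    by (simp add: prod.distrib)
  finally show ?thesis by (simp add: D_def)
qed

text \<open>Both sides are equivalent to the count at the grid point with index \<open>j\<close>
  being \<open>j div 2\<close>, for every \<open>j\<close> up to \<open>2 * k + 1\<close>.\<close>

lemma counting_box_iff:
  assumes c: "counting_process M N" and w: "\<omega> \<in> space M" and g: "grid t k p"
  shows "N t \<omega> = k \<and> (\<lambda>i\<in>{1..k}. real_of_ereal (jump_time N i \<omega>)) \<in> time_box k p \<longleftrightarrow>
    (\<forall>i<2 * k + 1. N (p (Suc i)) \<omega> - N (p i) \<omega> = (if odd i then 1 else 0))" (is "?L \<longleftrightarrow> ?R")
proof -
  have mono: "mono p" "p 0 = 0" and pt: "p (2 * k + 1) = t" using g by (auto simp: grid_def)
  have m: "i \<le> j \<Longrightarrow> p i \<le> p j" and p0: "0 \<le> p i" for i j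
    using mono(1)[THEN monoD, of i j] mono(1)[THEN monoD, of 0 i] mono(2) by auto
  have t0: "0 \<le> t" using p0[of "2 * k + 1"] pt by simp
  have Nm: "i \<le> j \<Longrightarrow> N (p i) \<omega> \<le> N (p j) \<omega>" for i j
    using m p0 by (intro counting_processD(3)[OF c w]) auto
  have N0: "N (p 0) \<omega> = 0" using mono(2) counting_processD(2)[OF c w] by simp
  let ?H = "\<forall>j\<le>2 * k + 1. N (p j) \<omega> = j div 2"
  have "?L \<longleftrightarrow> ?H"
  proof
    assume L: ?L
    have all: "\<forall>i\<in>{1..k}. real_of_ereal (jump_time N i \<omega>) \<in> {p (2 * i - 1)<..p (2 * i)}"
      using L unfolding time_box_def restrict_PiE_iff by blast
    have box: "\<not> real_of_ereal (jump_time N i \<omega>) \<le> p (2 * i - 1)" "real_of_ereal (jump_time N i \<omega>) \<le> p (2 * i)" if "i \<in> {1..k}" for i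
      using all[rule_format, OF that] by auto
    have lo: "i \<le> N (p (2 * i)) \<omega>" if "i \<le> k" for i
    proof (cases "i = 0")
      case False
      then have "i \<in> {1..k}" using that by auto
      then show ?thesis using box(2)[of i] jump_time_real_le_iff[OF c w t0, of i "p (2 * i)"] p0 L that by auto
    qed simp
    have hi: "N (p (2 * i + 1)) \<omega> \<le> i" if "i \<le> k" for i
    proof (cases "i = k")
      case True
      then show ?thesis using L pt by simp
    next
      case False
      then have i: "Suc i \<in> {1..k}" using that by auto
      have "2 * Suc i - 1 = 2 * i + 1" by simp
      then have "\<not> Suc i \<le> N (p (2 * i + 1)) \<omega>"
        using box(1)[OF i] jump_time_real_le_iff[OF c w t0, of "Suc i" "p (2 * i + 1)"] p0 L i by auto
      then show ?thesis by simp
    qed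
    show ?H
    proof (intro allI impI)
      fix j assume j: "j \<le> 2 * k + 1"
      define i where "i = j div 2"
      have i: "i \<le> k" "j = 2 * i \<or> j = 2 * i + 1" using j by (auto simp: i_def)
      have "N (p (2 * i)) \<omega> \<le> N (p j) \<omega>" "N (p j) \<omega> \<le> N (p (2 * i + 1)) \<omega>" using i(2) by (auto intro!: Nm)
      then show "N (p j) \<omega> = j div 2" using lo[OF i(1)] hi[OF i(1)] by (simp add: i_def)
    qed
  next
    assume H: ?H
    have Nt: "N t \<omega> = k" using H[rule_format, of "2 * k + 1"] pt by simp
    have "real_of_ereal (jump_time N i \<omega>) \<in> {p (2 * i - 1)<..p (2 * i)}" if i: "i \<in> {1..k}" for i
    proof -
      have "N (p (2 * i - 1)) \<omega> = (2 * i - 1) div 2" "N (p (2 * i)) \<omega> = 2 * i div 2"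
        using i H by auto
      then have "\<not> i \<le> N (p (2 * i - 1)) \<omega>" "i \<le> N (p (2 * i)) \<omega>" using i by auto
      then show ?thesis
        using jump_time_real_le_iff[OF c w t0, of i "p (2 * i - 1)"] jump_time_real_le_iff[OF c w t0, of i "p (2 * i)"] p0 i Nt
        by auto
    qed
    then show ?L using Nt by (auto simp: time_box_def)
  qed
  also have "?H \<longleftrightarrow> ?R"
  proof
    assume H: ?H
    show ?R
    proof (intro allI impI)
      fix i assume "i < 2 * k + 1"
      then have "N (p (Suc i)) \<omega> = Suc i div 2" "N (p i) \<omega> = i div 2" using H by auto
      then show "N (p (Suc i)) \<omega> - N (p i) \<omega> = (if odd i then 1 else 0)" by (auto elim: oddE)
    qed
  next
    assume R: ?R
    have "j \<le> 2 * k + 1 \<longrightarrow> N (p j) \<omega> = j div 2" for j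
    proof (induction j)
      case (Suc j)
      show ?case
      proof
        assume j: "Suc j \<le> 2 * k + 1"
        then have "N (p (Suc j)) \<omega> - N (p j) \<omega> = (if odd j then 1 else 0)" using R by auto
        \<comment> \<open>Subtraction on natural numbers is truncated, so monotonicity is needed to
          recover the count from the increment.\<close>
        moreover have "N (p j) \<omega> \<le> N (p (Suc j)) \<omega>" by (intro Nm) simp
        moreover have "N (p j) \<omega> = j div 2" using Suc j by simp
        ultimately show "N (p (Suc j)) \<omega> = Suc j div 2" by (cases "even j") (auto elim!: evenE oddE)
      qed
    qed (simp add: N0)
    then show ?H by blast
  qed
  finally show ?thesis .
qed

text \<open>The count at the jump time with index \<open>i\<close> is exactly \<open>i\<close>, so
  two jump times in the wrong order would contradict monotonicity.\<close>

lemma times_in_simplex: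
  assumes c: "counting_process M N" and w: "\<omega> \<in> space M" and t: "0 < t" and k: "N t \<omega> = k"
  shows "(\<lambda>i\<in>{1..k}. real_of_ereal (jump_time N i \<omega>)) \<in> ordered_simplex t k"
proof -
  define \<tau> where "\<tau> i = real_of_ereal (jump_time N i \<omega>)" for i
  have ex: "jump_time N i \<omega> = ereal (\<tau> i)" "\<tau> i \<le> t" if "i \<in> {1..k}" for i
  proof -
    have "jump_time N i \<omega> \<le> ereal t" using jump_time_le_iff[OF c w, of t i] t k that by auto
    then show "jump_time N i \<omega> = ereal (\<tau> i)" "\<tau> i \<le> t"
      using jump_time_nonneg[of N i \<omega>] by (cases "jump_time N i \<omega>"; simp add: \<tau>_def)+
  qed
  have pos: "0 < \<tau> i" "N (\<tau> i) \<omega> = i" if "i \<in> {1..k}" for i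
    using jump_time_exact[OF c w _ ex(1)[OF that]] that by auto
  have "\<tau> i < \<tau> j" if "i \<in> {1..k}" "j \<in> {i<..k}" for i j
  proof (rule ccontr)
    assume "\<not> \<tau> i < \<tau> j"
    moreover have j: "j \<in> {1..k}" using that by auto
    ultimately have "N (\<tau> j) \<omega> \<le> N (\<tau> i) \<omega>" using pos[OF j] by (intro counting_processD(3)[OF c w]) auto
    then show False using pos[OF j] pos[OF that(1)] that by auto
  qed
  then show ?thesis
    using pos ex unfolding ordered_simplex_def \<tau>_def[symmetric] by (auto simp: space_PiM)
qed

text \<open>The two measures agree on boxes. The density constant equals k! / t^k: given the count,
  the jump times are distributed like ordered independent uniform variables. It is kept as a
  quotient by \<open>q\<close> because \<open>q\<close> cancels in the final formula.\<close>

lemma poisson_jump_times_law: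
  fixes k :: nat
  assumes M: "prob_space M" and N: "poisson_process M l N" and l: "0 < l" and t: "0 < t"
  defines "q \<equiv> measure M {\<omega>\<in>space M. N t \<omega> = k}"
  shows "0 < q" and
    "jump_times_law M N t k = density (lborel_on {1..k}) (\<lambda>s. ennreal (l ^ k * exp (- l * t) / q * indicator (ordered_simplex t k) s))"
proof -
  interpret prob_space M by fact
  have c: "counting_process M N" using N by (simp add: poisson_process_def)
  interpret L: product_sigma_finite "\<lambda>_::nat. lborel :: real measure" by standard
  define E where "E = {\<omega>\<in>space M. N t \<omega> = k}"
  define X where "X \<omega> = (\<lambda>i\<in>{1..k}. real_of_ereal (jump_time N i \<omega>))" for \<omega>
  have [measurable]: "X \<in> measurable M (borel_on {1..k})"
    unfolding X_def by (intro measurable_restrict borel_measurable_real_of_ereal jump_time_measurable[OF c])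
  have [measurable]: "E \<in> sets M"
    using measurable_sets[OF counting_processD(1)[OF c, of t], of "{k}"] t
    unfolding E_def by (simp add: vimage_def Int_def conj_commute)
  define C where "C = l ^ k * exp (- l * t)"
  have C: "0 < C" using l by (simp add: C_def)
  have box: "prob (E \<inter> (X -` time_box k p \<inter> space M)) = C * (\<Prod>i=1..k. p (2 * i) - p (2 * i - 1))" if g: "grid t k p" for p
  proof -
    have "E \<inter> (X -` time_box k p \<inter> space M) = {\<omega>\<in>space M. \<forall>i<2 * k + 1. N (p (Suc i)) \<omega> - N (p i) \<omega> = (if odd i then 1 else 0)}"
      unfolding E_def X_def using counting_box_iff[OF c _ g]
      by (simp only: set_eq_iff Int_iff mem_Collect_eq vimage_eq) blast
    then show ?thesis using poisson_box_prob[OF N l g] by (simp add: C_def)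
  qed
  have p_le: "p (2 * i - 1) \<le> p (2 * i)" if "grid t k p" for p i
    using that by (auto simp: grid_def mono_def)
  show q: "0 < q"
    unfolding q_def poisson_count_prob[OF M N l t] using l t by (simp add: pmf_poisson)
  have qE: "emeasure M E = ennreal q" by (simp add: q_def E_def emeasure_eq_measure)
  have E0: "emeasure M E \<noteq> 0" "emeasure M E \<noteq> \<infinity>" using q unfolding qE by auto
  have law: "jump_times_law M N t k = distr (uniform_measure M E) (borel_on {1..k}) X"
    unfolding jump_times_law_def E_def X_def ..
  have [simp]: "sets (lborel_on {1..k}) = sets (borel_on {1..k})"
    by (intro sets_PiM_cong) auto
  have box_P: "emeasure (jump_times_law M N t k) (time_box k p) = ennreal (C / q) * (\<Prod>i=1..k. ennreal (p (2 * i) - p (2 * i - 1)))"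
    if g: "grid t k p" for p
  proof -
    have "emeasure (jump_times_law M N t k) (time_box k p) = emeasure M (E \<inter> (X -` time_box k p \<inter> space M)) / emeasure M E"
      unfolding law
      by (subst emeasure_distr) (auto simp: measurable_cong_sets[OF sets_uniform_measure refl] simp del: One_nat_def)
    also have "\<dots> = ennreal (C * (\<Prod>i=1..k. p (2 * i) - p (2 * i - 1)) / q)"
      using C q p_le[OF g] by (simp only: emeasure_eq_measure[of "E \<inter> _"] box[OF g] qE)
        (auto intro!: divide_ennreal mult_nonneg_nonneg prod_nonneg)
    also have "\<dots> = ennreal (C / q) * (\<Prod>i=1..k. ennreal (p (2 * i) - p (2 * i - 1)))"
      using C q p_le[OF g] by (subst prod_ennreal) (auto simp: ennreal_mult[symmetric] prod_nonneg)
    finally show ?thesis .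
  qed
  show "jump_times_law M N t k = density (lborel_on {1..k}) (\<lambda>s. ennreal (l ^ k * exp (- l * t) / q * indicator (ordered_simplex t k) s))"
    unfolding C_def[symmetric]
  proof (rule measure_eqI_time_boxes[OF t])
    fix p assume g: "grid t k p"
    show "emeasure (jump_times_law M N t k) (time_box k p) \<noteq> \<infinity>"
      unfolding box_P[OF g] using p_le[OF g] by (subst prod_ennreal) (auto simp: ennreal_mult_eq_top_iff)
    have "emeasure (density (lborel_on {1..k}) (\<lambda>s. ennreal (C / q * indicator (ordered_simplex t k) s))) (time_box k p) =
      (\<integral>\<^sup>+ s. ennreal (C / q) * indicator (time_box k p) s \<partial>lborel_on {1..k})"
      using time_box_subset_simplex[OF g]
      by (subst emeasure_density) (auto intro!: nn_integral_cong simp: indicator_def simp del: One_nat_def)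
    also have "\<dots> = ennreal (C / q) * emeasure (lborel_on {1..k}) (time_box k p)"
      by (rule nn_integral_cmult_indicator) (simp del: One_nat_def)
    also have "emeasure (lborel_on {1..k}) (time_box k p) = (\<Prod>i=1..k. emeasure lborel {p (2 * i - 1)<..p (2 * i)})"
      unfolding time_box_def by (intro L.emeasure_PiM) auto
    also have "\<dots> = (\<Prod>i=1..k. ennreal (p (2 * i) - p (2 * i - 1)))"
      using p_le[OF g] by (intro prod.cong) auto
    finally show "emeasure (jump_times_law M N t k) (time_box k p) =
        emeasure (density (lborel_on {1..k}) (\<lambda>s. ennreal (C / q * indicator (ordered_simplex t k) s))) (time_box k p)"
      by (simp only: box_P[OF g])
  next
    show "AE s in jump_times_law M N t k. s \<in> ordered_simplex t k"
      unfolding law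
    proof (subst AE_distr_iff)
      show "AE \<omega> in uniform_measure M E. X \<omega> \<in> ordered_simplex t k"
      proof (rule AE_uniform_measureI)
        show "AE \<omega> in M. \<omega> \<in> E \<longrightarrow> X \<omega> \<in> ordered_simplex t k"
          using times_in_simplex[OF c _ t] by (intro AE_I2) (simp add: E_def X_def)
      qed measurable
    qed (auto simp del: One_nat_def simp: measurable_cong_sets[OF sets_uniform_measure refl])
    show "AE s in density (lborel_on {1..k}) (\<lambda>s. ennreal (C / q * indicator (ordered_simplex t k) s)). s \<in> ordered_simplex t k"
      by (subst AE_density) (auto simp: indicator_def simp del: One_nat_def)
  qed (simp_all del: One_nat_def)
qed

section \<open>Iterated integrals over the simplex\<close>

definition prev_time :: "(nat \<Rightarrow> real) \<Rightarrow> nat \<Rightarrow> real" where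
  "prev_time s i = (if i = 1 then 0 else s (i - 1))"

text \<open>Waiting times become jump times by translating one coordinate at a time by the sum of
  the earlier ones. The integrands are compared only for positive waiting times with sum below
  \<open>t\<close>, which is where \<open>gaussian_integral\<close> is known.\<close>

lemma iterated_integral_shift:
  fixes \<phi> g :: "(nat \<Rightarrow> real) \<Rightarrow> real"
  assumes \<phi>g: "\<And>u s. (\<And>j. j \<in> {1..k} \<Longrightarrow> 0 < u j) \<Longrightarrow> (\<Sum>j=1..k. u j) < t \<Longrightarrow>
      (\<And>j. j \<in> {1..k} \<Longrightarrow> s j = (\<Sum>l=1..j. u l)) \<Longrightarrow> \<phi> u = g s"
    and "1 \<le> i" "i + n = k + 1"
    and "\<And>j. j \<in> {1..<i} \<Longrightarrow> 0 < u j" "\<And>j. j \<in> {1..<i} \<Longrightarrow> s j = (\<Sum>l=1..j. u l)" "(\<Sum>j=1..<i. u j) < t"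
  shows "iterated_integral (\<lambda>_. lborel) (\<lambda>i u. {0..t - (\<Sum>j=1..<i. u j)}) \<phi> i n u =
    iterated_integral (\<lambda>_. lborel) (\<lambda>i s. {prev_time s i<..<t}) g i n s"
  using assms(2-)
proof (induction n arbitrary: i u s)
  case 0
  then have "{1..<i} = {1..k}" by auto
  then show ?case using 0 by (simp only: iterated_integral.simps) (rule \<phi>g)
next
  case (Suc n)
  define \<sigma> where "\<sigma> = (\<Sum>j=1..<i. u j)"
  let ?I = "iterated_integral (\<lambda>_. lborel) (\<lambda>i u. {0..t - (\<Sum>j=1..<i. u j)}) \<phi>"
  let ?J = "iterated_integral (\<lambda>_. lborel) (\<lambda>i s. {prev_time s i<..<t}) g"
  have prev: "prev_time s i = \<sigma>"
  proof (cases "i = 1")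
    case False
    then have "{1..<i} = {1..i - 1}" "i - 1 \<in> {1..<i}" using Suc.prems by auto
    then show ?thesis using Suc.prems(4)[of "i - 1"] False by (simp add: prev_time_def \<sigma>_def)
  qed (simp add: prev_time_def \<sigma>_def)
  have step: "?I (Suc i) n (u(i := z - \<sigma>)) = ?J (Suc i) n (s(i := z))" if z: "\<sigma> < z" "z < t" for z
  proof (rule Suc.IH)
    have eq: "(\<Sum>l=1..<i. (u(i := z - \<sigma>)) l) = \<sigma>" unfolding \<sigma>_def by (intro sum.cong) auto
    show "(\<Sum>j=1..<Suc i. (u(i := z - \<sigma>)) j) < t"
      using Suc.prems eq z by simp
    fix j assume j: "j \<in> {1..<Suc i}"
    show "0 < (u(i := z - \<sigma>)) j" using j z Suc.prems(3)[of j] by auto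
    show "(s(i := z)) j = (\<Sum>l=1..j. (u(i := z - \<sigma>)) l)"
    proof (cases "j = i")
      case True
      have "{1..i} = insert i {1..<i}" using Suc.prems by auto
      then show ?thesis using True eq by simp
    next
      case False
      then have "(\<Sum>l=1..j. (u(i := z - \<sigma>)) l) = (\<Sum>l=1..j. u l)" using j by (intro sum.cong) auto
      then show ?thesis using False j Suc.prems(4)[of j] by auto
    qed
  qed (use Suc.prems in auto)
  have "?I i (Suc n) u = (LINT y|lborel. indicator {0..t - \<sigma>} y *\<^sub>R ?I (Suc i) n (u(i := y)))"
    by (simp add: set_lebesgue_integral_def \<sigma>_def)
  \<comment> \<open>The endpoints are removed, a null set, since the induction hypothesis asks for
    strictly positive waiting times and a sum strictly below \<open>t\<close>.\<close>
  also have "\<dots> = (LINT y|lborel. indicator {0<..<t - \<sigma>} y *\<^sub>R ?I (Suc i) n (u(i := y)))"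
    by (rule integral_discrete_difference[of "{0, t - \<sigma>}"]) (auto simp: indicator_def)
  also have "\<dots> = (LINT z|lborel. indicator {0<..<t - \<sigma>} (- \<sigma> + 1 * z) *\<^sub>R ?I (Suc i) n (u(i := - \<sigma> + 1 * z)))"
    by (subst lborel_integral_real_affine[where c=1 and t="- \<sigma>"]) simp_all
  also have "\<dots> = (LINT z|lborel. indicator {\<sigma><..<t} z *\<^sub>R ?J (Suc i) n (s(i := z)))"
    using step by (intro lint_cong refl) (auto simp: indicator_def)
  also have "\<dots> = ?J i (Suc n) s"
    by (simp add: set_lebesgue_integral_def prev)
  finally show ?case .
qed

text \<open>Coordinates below \<open>i\<close> are already fixed by the outer integrals, so the
  conditions start at \<open>i\<close>. Positivity is listed explicitly so that the support visibly
  lies in a cube of side \<open>t\<close>.\<close>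

definition chain_restrict :: "nat \<Rightarrow> real \<Rightarrow> ((nat \<Rightarrow> real) \<Rightarrow> real) \<Rightarrow> nat \<Rightarrow> (nat \<Rightarrow> real) \<Rightarrow> real" where
  "chain_restrict k t f i s = (if \<forall>j\<in>{i..k}. 0 < s j \<and> prev_time s j < s j \<and> s j < t then f s else 0)"

lemma measurable_chain_restrict:
  assumes [measurable]: "f \<in> borel_measurable (borel_on {1..k})" and m: "1 \<le> m"
  shows "chain_restrict k t f m \<in> borel_measurable (borel_on {1..k})"
proof -
  have comp[measurable]: "(\<lambda>s. s j) \<in> borel_measurable (borel_on {1..k})" if "j \<in> {1..k}" for j
    using that by (rule measurable_component_singleton)
  have "Measurable.pred (borel_on {1..k}) (\<lambda>s. \<forall>j\<in>{m..k}. 0 < s j \<and> prev_time s j < s j \<and> s j < (t::real))"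
  proof (intro pred_intros_finite pred_intros_logic)
    fix j assume j: "j \<in> {m..k}"
    have [measurable]: "(\<lambda>s. s j) \<in> borel_measurable (borel_on {1..k})"
      using j m by (intro comp) auto
    have [measurable]: "(\<lambda>s. prev_time s j) \<in> borel_measurable (borel_on {1..k})"
    proof (cases "j = 1")
      case False
      then have "j - 1 \<in> {1..k}" using j m by auto
      from comp[OF this] show ?thesis using False by (simp add: prev_time_def)
    qed (simp add: prev_time_def)
    show "Measurable.pred (borel_on {1..k}) (\<lambda>s. 0 < (s j :: real))" by measurable
    show "Measurable.pred (borel_on {1..k}) (\<lambda>s. s j < t)" by measurable
    show "Measurable.pred (borel_on {1..k}) (\<lambda>s. prev_time s j < s j)" by measurable
  qed auto
  then show ?thesis unfolding chain_restrict_def[abs_def] by measurable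
qed

text \<open>Fubini peels off the outermost coordinate. It applies because the integrand is bounded
  and vanishes outside a cube of finite measure.\<close>

lemma iterated_integral_chain:
  fixes f :: "(nat \<Rightarrow> real) \<Rightarrow> real"
  assumes f[measurable]: "f \<in> borel_measurable (borel_on {1..k})"
    and f_cong: "\<And>s s'. (\<And>j. j \<in> {1..k} \<Longrightarrow> s j = s' j) \<Longrightarrow> f s = f s'"
    and bound: "\<And>s. \<bar>f s\<bar> \<le> K"
    and "1 \<le> i" "i + n = k + 1" "0 \<le> prev_time x i"
  shows "iterated_integral (\<lambda>_. lborel) (\<lambda>i s. {prev_time s i<..<t}) f i n x =
    (LINT y|lborel_on {i..k}. chain_restrict k t f i (\<lambda>j. if j < i then x j else y j))"
  using assms(4-)
proof (induction n arbitrary: i x)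
  case 0
  interpret product_sigma_finite "\<lambda>_::nat. lborel :: real measure" by standard
  have e: "{i..k} = {}" using 0 by auto
  have "f (\<lambda>j. if j < i then x j else undefined) = f x" using 0 by (intro f_cong) auto
  then show ?case unfolding e by (simp add: PiM_empty lebesgue_integral_count_space_finite chain_restrict_def e)
next
  case (Suc n)
  interpret product_sigma_finite "\<lambda>_::nat. lborel :: real measure" by standard
  define J where "J = {Suc i..k}"
  have ik: "i \<in> {1..k}" using Suc.prems by auto
  have IJ: "{i..k} = {i} \<union> J" "{i} \<inter> J = {}" using ik by (auto simp: J_def)
  have cr_cong: "chain_restrict k t f m s = chain_restrict k t f m s'"
    if "1 \<le> m" "\<And>j. j \<in> {1..k} \<Longrightarrow> s j = s' j" for m s s'
  proof -
    have "prev_time s j = prev_time s' j \<and> s j = s' j" if "j \<in> {m..k}" for j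
    proof (cases "j = 1")
      case False
      then have "j \<in> {1..k}" "j - 1 \<in> {1..k}" using that \<open>1 \<le> m\<close> by auto
      then show ?thesis using \<open>\<And>j. j \<in> {1..k} \<Longrightarrow> s j = s' j\<close> False by (simp add: prev_time_def)
    next
      case True
      then have "j \<in> {1..k}" using that \<open>1 \<le> m\<close> by auto
      then show ?thesis using \<open>\<And>j. j \<in> {1..k} \<Longrightarrow> s j = s' j\<close> True by (simp add: prev_time_def)
    qed
    then show ?thesis using f_cong[of s s'] that by (auto simp: chain_restrict_def)
  qed
  note cr_meas = measurable_chain_restrict[OF f]
  \<comment> \<open>The same argument as in the statement, but as an element of the product space,
    which measurability requires; \<open>f_cong\<close> makes the two interchangeable.\<close>
  define mix where "mix m x y = (\<lambda>j\<in>{1..k}. if j < m then x j else y j)" for m and x y :: "nat \<Rightarrow> real"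
  have cr_mix: "chain_restrict k t f m (\<lambda>j. if j < m then x j else y j) = chain_restrict k t f m (mix m x y)"
    if "1 \<le> m" for m x y
    using that by (intro cr_cong) (auto simp: mix_def)
  have mix_meas: "mix i x \<in> measurable (lborel_on {i..k}) (borel_on {1..k})"
    unfolding mix_def
  proof (rule measurable_restrict)
    fix j assume j: "j \<in> {1..k}"
    show "(\<lambda>y. if j < i then x j else y j) \<in> borel_measurable (lborel_on {i..k})"
    proof (cases "j < i")
      case False
      then have "(\<lambda>y. y j) \<in> measurable (lborel_on {i..k}) (lborel :: real measure)"
        using j by (intro measurable_component_singleton) auto
      then show ?thesis using False by simp
    qed simp
  qed
  have cr_bound: "\<bar>chain_restrict k t f m s\<bar> \<le> K" for m s
    using bound[of s] by (auto simp: chain_restrict_def intro: order_trans[OF abs_ge_zero])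
  have int: "integrable (lborel_on {i..k}) (\<lambda>y. chain_restrict k t f i (mix i x y))"
  proof (rule integrableI_bounded_set[where A="\<Pi>\<^sub>E j\<in>{i..k}. {0..t}" and B=K])
    show "(\<Pi>\<^sub>E j\<in>{i..k}. {0..t}) \<in> sets (lborel_on {i..k})" by (intro sets_PiM_I_finite) auto
    show "(\<lambda>y. chain_restrict k t f i (mix i x y)) \<in> borel_measurable (lborel_on {i..k})"
      by (rule measurable_compose[OF mix_meas cr_meas]) (use Suc.prems in simp)
    show "emeasure (lborel_on {i..k}) (\<Pi>\<^sub>E j\<in>{i..k}. {0..t}) < \<infinity>"
      by (subst emeasure_PiM) (auto simp: less_top[symmetric] emeasure_lborel_Icc_eq power_eq_top_ennreal split: if_splits)
    show "AE y in lborel_on {i..k}. y \<in> (\<Pi>\<^sub>E j\<in>{i..k}. {0..t}) \<longrightarrow> norm (chain_restrict k t f i (mix i x y)) \<le> K"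
      using cr_bound by simp
    show "AE y in lborel_on {i..k}. y \<notin> (\<Pi>\<^sub>E j\<in>{i..k}. {0..t}) \<longrightarrow> chain_restrict k t f i (mix i x y) = 0"
    proof (intro AE_I2 impI)
      fix y assume "y \<in> space (lborel_on {i..k})" "y \<notin> (\<Pi>\<^sub>E j\<in>{i..k}. {0..t})"
      then obtain j where j: "j \<in> {i..k}" "y j \<notin> {0..t}" by (auto simp: space_PiM PiE_iff)
      then have "mix i x y j = y j" using Suc.prems by (auto simp: mix_def)
      then have "\<not> (0 < mix i x y j \<and> prev_time (mix i x y) j < mix i x y j \<and> mix i x y j < t)" using j by auto
      then have "\<not> (\<forall>j\<in>{i..k}. 0 < mix i x y j \<and> prev_time (mix i x y) j < mix i x y j \<and> mix i x y j < t)"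
        using j(1) by blast
      then show "chain_restrict k t f i (mix i x y) = 0" unfolding chain_restrict_def by (simp only: if_False)
    qed
  qed
  define F where "F v = indicator {prev_time x i<..<t} v * (LINT y|lborel_on J. chain_restrict k t f (Suc i) (mix (Suc i) (x(i := v)) y))" for v
  have F_meas: "F \<in> borel_measurable lborel"
  proof -
    have "(\<lambda>p. mix (Suc i) (x(i := fst p)) (snd p)) \<in> measurable (lborel \<Otimes>\<^sub>M lborel_on J) (borel_on {1..k})"
      unfolding mix_def
    proof (rule measurable_restrict)
      fix j assume j: "j \<in> {1..k}"
      show "(\<lambda>p. if j < Suc i then (x(i := fst p)) j else snd p j) \<in> borel_measurable (lborel \<Otimes>\<^sub>M lborel_on J)"
      proof (cases "j < Suc i")
        case False
        then have "(\<lambda>y. y j) \<in> measurable (lborel_on J) (lborel :: real measure)"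
          using j by (intro measurable_component_singleton) (auto simp: J_def)
        then have "(\<lambda>y. y j) \<in> borel_measurable (lborel_on J)" by simp
        from measurable_compose[OF measurable_snd this] show ?thesis using False by simp
      next
        case True
        then show ?thesis by (cases "j = i") auto
      qed
    qed
    from measurable_compose[OF this cr_meas[of "Suc i"]]
    have "(\<lambda>(v, y). chain_restrict k t f (Suc i) (mix (Suc i) (x(i := v)) y)) \<in> borel_measurable (lborel \<Otimes>\<^sub>M lborel_on J)"
      by (simp add: split_beta')
    moreover have "sigma_finite_measure (lborel_on J)"
      by (rule sigma_finite) (simp add: J_def)
    ultimately have "(\<lambda>v. LINT y|lborel_on J. chain_restrict k t f (Suc i) (mix (Suc i) (x(i := v)) y)) \<in> borel_measurable lborel"
      by (intro sigma_finite_measure.borel_measurable_lebesgue_integral)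
    then show ?thesis unfolding F_def by measurable
  qed
  have "(LINT y|lborel_on {i..k}. chain_restrict k t f i (\<lambda>j. if j < i then x j else y j)) =
    (LINT y|PiM ({i} \<union> J) (\<lambda>_. lborel). chain_restrict k t f i (mix i x y))"
    unfolding IJ(1)[symmetric] using Suc.prems by (simp add: cr_mix)
  also have "\<dots> = (LINT v|lborel_on {i}. LINT y|lborel_on J. chain_restrict k t f i (mix i x (merge {i} J (v, y))))"
    using int unfolding IJ(1) by (intro product_integral_fold IJ(2)) (auto simp: J_def)
  also have "\<dots> = (LINT v|lborel_on {i}. F (v i))"
  proof (intro lint_cong refl)
    fix v :: "nat \<Rightarrow> real"
    have split: "chain_restrict k t f i s = (if 0 < s i \<and> prev_time s i < s i \<and> s i < t then chain_restrict k t f (Suc i) s else 0)" for s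
    proof -
      have "{i..k} = insert i {Suc i..k}" using ik by auto
      then show ?thesis by (auto simp: chain_restrict_def)
    qed
    have "chain_restrict k t f i (mix i x (merge {i} J (v, y))) = indicator {prev_time x i<..<t} (v i) * chain_restrict k t f (Suc i) (mix (Suc i) (x(i := v i)) y)" for y
    proof -
      have eq: "mix i x (merge {i} J (v, y)) = mix (Suc i) (x(i := v i)) y"
        using ik by (auto simp: mix_def merge_def J_def fun_eq_iff)
      have "mix (Suc i) (x(i := v i)) y i = v i" using ik by (simp add: mix_def)
      moreover have "prev_time (mix (Suc i) (x(i := v i)) y) i = prev_time x i"
        using ik by (auto simp: mix_def prev_time_def)
      ultimately show ?thesis unfolding eq using Suc.prems(3) by (subst split) (auto simp: indicator_def)
    qed
    then show "(LINT y|lborel_on J. chain_restrict k t f i (mix i x (merge {i} J (v, y)))) = F (v i)"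
      by (simp add: F_def)
  qed
  also have "\<dots> = (LINT v|lborel. F v)"
    by (rule product_integral_singleton[OF F_meas])
  also have "\<dots> = (LINT v|lborel. indicator {prev_time x i<..<t} v *\<^sub>R iterated_integral (\<lambda>_. lborel) (\<lambda>i s. {prev_time s i<..<t}) f (Suc i) n (x(i := v)))"
  proof (intro lint_cong refl)
    fix v
    show "F v = indicator {prev_time x i<..<t} v *\<^sub>R iterated_integral (\<lambda>_. lborel) (\<lambda>i s. {prev_time s i<..<t}) f (Suc i) n (x(i := v))"
    proof (cases "v \<in> {prev_time x i<..<t}")
      case True
      have pv: "0 \<le> prev_time (x(i := v)) (Suc i)" using Suc.prems True by (simp add: prev_time_def)
      have "iterated_integral (\<lambda>_. lborel) (\<lambda>i s. {prev_time s i<..<t}) f (Suc i) n (x(i := v)) =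
         (LINT y|lborel_on {Suc i..k}. chain_restrict k t f (Suc i) (\<lambda>j. if j < Suc i then (x(i := v)) j else y j))"
        by (rule Suc.IH[of "Suc i" "x(i := v)", OF _ _ pv]) (use Suc.prems(2) in simp_all)
      also have "\<dots> = (LINT y|lborel_on {Suc i..k}. chain_restrict k t f (Suc i) (mix (Suc i) (x(i := v)) y))"
        by (intro lint_cong refl cr_mix) simp
      finally show ?thesis by (simp only: F_def J_def real_scaleR_def)
    qed (simp add: F_def)
  qed
  also have "\<dots> = iterated_integral (\<lambda>_. lborel) (\<lambda>i s. {prev_time s i<..<t}) f i (Suc n) x"
    by (simp add: set_lebesgue_integral_def)
  finally show ?case by simp
qed

lemma AE_component_neq:
  assumes "finite I" "i \<in> I"
  shows "AE y in lborel_on I. y i \<noteq> c"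
proof -
  interpret product_sigma_finite "\<lambda>_. lborel :: real measure" by standard
  define A where "A j = (if j = i then {c} else UNIV)" for j
  have "emeasure (lborel_on I) (Pi\<^sub>E I A) = (\<Prod>j\<in>I. emeasure lborel (A j))"
    using assms(1) by (intro emeasure_PiM) (auto simp: A_def)
  also have "\<dots> = 0" using assms by (intro prod_zero) (auto simp: A_def intro!: bexI[of _ i])
  finally have "emeasure (lborel_on I) (Pi\<^sub>E I A) = 0" .
  moreover have "Pi\<^sub>E I A \<in> sets (lborel_on I)"
    using assms(1) by (intro sets_PiM_I_finite) (auto simp: A_def)
  moreover have "{y\<in>space (lborel_on I). \<not> y i \<noteq> c} \<subseteq> Pi\<^sub>E I A"
    by (auto simp: space_PiM A_def PiE_iff extensional_def)
  ultimately show ?thesis by (intro AE_I)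
qed

text \<open>Comparing neighbours suffices for an increasing chain, and the points with a coordinate
  equal to \<open>t\<close>, where the two domains differ, form a null set.\<close>

lemma integral_ordered_simplex:
  fixes f :: "(nat \<Rightarrow> real) \<Rightarrow> real"
  assumes f[measurable]: "f \<in> borel_measurable (borel_on {1..k})"
    and f_cong: "\<And>s s'. (\<And>j. j \<in> {1..k} \<Longrightarrow> s j = s' j) \<Longrightarrow> f s = f s'"
    and bound: "\<And>s. \<bar>f s\<bar> \<le> K"
  shows "(LINT s|lborel_on {1..k}. indicator (ordered_simplex t k) s * f s) =
    iterated_integral_from_1 k (\<lambda>_. lborel) (\<lambda>i s. {prev_time s i<..<t}) f"
proof -
  have chain: "(\<forall>j\<in>{1..k}. 0 < s j \<and> prev_time s j < s j \<and> s j < t) \<longleftrightarrow> s \<in> ordered_simplex t k"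
    if s: "s \<in> space (lborel_on {1..k})" and nt: "\<And>j. j \<in> {1..k} \<Longrightarrow> s j \<noteq> t" for s
  proof
    assume c: "\<forall>j\<in>{1..k}. 0 < s j \<and> prev_time s j < s j \<and> s j < t"
    have lt: "i + d \<le> k \<Longrightarrow> 0 < d \<Longrightarrow> s i < s (i + d)" if "1 \<le> i" for i d
    proof (induction d)
      case (Suc d)
      have "i + Suc d \<in> {1..k}" using Suc.prems that by auto
      then have "prev_time s (i + Suc d) < s (i + Suc d)" using c by blast
      then have "s (i + d) < s (i + Suc d)" using that by (simp add: prev_time_def)
      then show ?case using Suc by (cases "d = 0") auto
    qed simp
    have "s i < s j" if "i \<in> {1..k}" "j \<in> {i<..k}" for i j
      using lt[of i "j - i"] that by auto
    then show "s \<in> ordered_simplex t k"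
      using c s by (auto simp: ordered_simplex_def space_PiM)
  next
    assume s: "s \<in> ordered_simplex t k"
    show "\<forall>j\<in>{1..k}. 0 < s j \<and> prev_time s j < s j \<and> s j < t"
    proof
      fix j assume j: "j \<in> {1..k}"
      have "s j < t" using s j nt[OF j] by (force simp: ordered_simplex_def)
      moreover have "0 < s j" using s j by (auto simp: ordered_simplex_def)
      moreover have "prev_time s j < s j"
      proof (cases "j = 1")
        case False
        then have "j - 1 \<in> {1..k}" "j \<in> {j - 1<..k}" using j by auto
        then show ?thesis using s False by (auto simp: ordered_simplex_def prev_time_def)
      qed (use \<open>0 < s j\<close> in \<open>simp add: prev_time_def\<close>)
      ultimately show "0 < s j \<and> prev_time s j < s j \<and> s j < t" by simp
    qed
  qed
  have se: "sets (lborel_on {1..k}) = sets (borel_on {1..k})"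
    by (intro sets_PiM_cong) auto
  have "iterated_integral_from_1 k (\<lambda>_. lborel) (\<lambda>i s. {prev_time s i<..<t}) f =
    (LINT y|lborel_on {1..k}. chain_restrict k t f 1 (\<lambda>j. if j < 1 then 0 else y j))"
    by (rule iterated_integral_chain[OF f f_cong bound]) (auto simp: prev_time_def)
  also have "\<dots> = (LINT s|lborel_on {1..k}. chain_restrict k t f 1 s)"
  proof (intro lint_cong refl)
    fix y :: "nat \<Rightarrow> real"
    have "f (\<lambda>j. if j < 1 then 0 else y j) = f y" by (intro f_cong) auto
    then show "chain_restrict k t f 1 (\<lambda>j. if j < 1 then 0 else y j) = chain_restrict k t f 1 y"
      by (auto simp: chain_restrict_def prev_time_def)
  qed
  also have "\<dots> = (LINT s|lborel_on {1..k}. indicator (ordered_simplex t k) s * f s)"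
  proof (rule integral_cong_AE)
    have "AE y in lborel_on {1..k}. \<forall>j\<in>{1..k}. y j \<noteq> t"
      by (intro AE_finite_allI AE_component_neq) auto
    then show eq: "AE s in lborel_on {1..k}. chain_restrict k t f 1 s = indicator (ordered_simplex t k) s * f s"
      using AE_space
    proof eventually_elim
      case (elim s)
      then show ?case using chain[of s] unfolding chain_restrict_def by (auto simp: indicator_def)
    qed
    show m: "(\<lambda>s. indicator (ordered_simplex t k) s * f s) \<in> borel_measurable (lborel_on {1..k})"
      by (subst measurable_cong_sets[OF se refl]) measurable
    show "chain_restrict k t f 1 \<in> borel_measurable (lborel_on {1..k})"
      using measurable_chain_restrict[OF f order_refl] by (subst measurable_cong_sets[OF se refl])
  qed
  finally show ?thesis ..
qed

context jump_brownian
begin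

text \<open>The probability of \<open>N t = k\<close> cancels against the normalisation of the
  conditional density, which leaves l^k exp (- l t) times an integral over the simplex; this is then
  rewritten in waiting times.\<close>

lemma crossing_poisson:
  assumes l: "0 < l" and N: "poisson_process M l N"
    and ind: "indep_vars (\<lambda>_. borel) \<eta> {1..}" and G: "\<And>i. 1 \<le> i \<Longrightarrow> distr M borel (\<eta> i) = G"
  shows "(\<lambda>k. l ^ k * exp (- l * t) *
             iterated_integral_from_1 k (\<lambda>_. lborel) (\<lambda>i u. {0..t - (\<Sum>j = 1..<i. u j)})
               (\<lambda>u. LINT h|Pi\<^sub>M {1..k} (\<lambda>_. G). gaussian_integral a b t k u h))
         sums prob {\<omega> \<in> space M. (SUP s\<in>{0..<t}. jump_bm B N \<eta> s \<omega> - a * s - b) < 0}"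
proof -
  have "l ^ k * exp (- l * t) *
      iterated_integral_from_1 k (\<lambda>_. lborel) (\<lambda>i u. {0..t - (\<Sum>j = 1..<i. u j)})
        (\<lambda>u. LINT h|Pi\<^sub>M {1..k} (\<lambda>_. G). gaussian_integral a b t k u h) =
    prob {\<omega>\<in>space M. N t \<omega> = k} * (LINT s|jump_times_law M N t k. LINT h|jump_heights_law M \<eta> k. cond_prob k s h)" for k
  proof -
    define g where "g s = (LINT h|jump_heights_law M \<eta> k. cond_prob k s h)" for s
    define q where "q = prob {\<omega>\<in>space M. N t \<omega> = k}"
    define C where "C = l ^ k * exp (- l * t)"
    have C: "0 \<le> C" using l by (simp add: C_def)
    have q: "0 < q" unfolding q_def by (rule poisson_jump_times_law(1)[OF prob_space_axioms N l t_pos])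
    have heights: "jump_heights_law M \<eta> k = PiM {1..k} (\<lambda>_. G)"
    \<comment> \<open>The characterisation of independence by a product law needs a nonempty index
      set; without jumps both laws are probability measures on a one-point space.\<close>
    proof (cases "k = 0")
      case True
      interpret Q: prob_space "jump_heights_law M \<eta> 0"
        by (rule prob_space_jump_heights_law) (use eta_measurable prob_space_axioms in auto)
      have "emeasure (jump_heights_law M \<eta> 0) A = emeasure (PiM {} (\<lambda>_. G)) A"
        if "A \<in> sets (jump_heights_law M \<eta> 0)" for A
      proof -
        have "A = {} \<or> A = {\<lambda>_. undefined}" using that by (auto simp: sets_PiM_empty)
        moreover have "space (jump_heights_law M \<eta> 0) = {\<lambda>_. undefined}"
          by (simp add: jump_heights_law_def space_PiM_empty)
        ultimately show ?thesis using Q.emeasure_space_1 by auto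
      qed
      then have "jump_heights_law M \<eta> 0 = PiM {} (\<lambda>_. G)"
        by (intro measure_eqI) (auto simp: sets_PiM_empty)
      then show ?thesis using True by simp
    next
      case False
      then have ne: "{1..k} \<noteq> {}" by simp
      have "indep_vars (\<lambda>_. borel) \<eta> {1..k}" by (rule indep_vars_subset[OF ind]) auto
      then have "distr M (borel_on {1..k}) (\<lambda>\<omega>. \<lambda>i\<in>{1..k}. \<eta> i \<omega>) = PiM {1..k} (\<lambda>i. distr M borel (\<eta> i))"
        using eta_measurable by (subst (asm) indep_vars_iff_distr_eq_PiM'[OF ne]) auto
      also have "\<dots> = PiM {1..k} (\<lambda>_. G)" by (intro PiM_cong G) auto
      finally show ?thesis by (simp add: jump_heights_law_def)
    qed
    have g_meas: "g \<in> borel_measurable (borel_on {1..k})"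
      unfolding g_def[abs_def] by (rule heights_integral_measurable)
    have g_cong: "g s = g s'" if "\<And>j. j \<in> {1..k} \<Longrightarrow> s j = s' j" for s s'
    proof -
      have "step_sum k s h = step_sum k s' h" for h
        using that by (auto simp: step_sum_def fun_eq_iff intro!: sum.cong)
      then show ?thesis by (simp add: g_def cond_prob_def)
    qed
    have g_bound: "\<bar>g s\<bar> \<le> 1" for s
    proof -
      interpret Q: prob_space "jump_heights_law M \<eta> k"
        by (rule prob_space_jump_heights_law) (use eta_measurable prob_space_axioms in auto)
      have "0 \<le> g s" unfolding g_def by (intro integral_nonneg_AE) (auto simp: cond_prob_bounds)
      moreover have "g s \<le> 1"
      proof (cases "integrable (jump_heights_law M \<eta> k) (cond_prob k s)")
        case True
        then show ?thesis unfolding g_def by (intro Q.integral_le_const) (auto simp: cond_prob_bounds)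
      next
        case False
        then show ?thesis by (simp add: g_def not_integrable_integral_eq)
      qed
      ultimately show ?thesis by simp
    qed
    have "iterated_integral_from_1 k (\<lambda>_. lborel) (\<lambda>i u. {0..t - (\<Sum>j = 1..<i. u j)})
        (\<lambda>u. LINT h|Pi\<^sub>M {1..k} (\<lambda>_. G). gaussian_integral a b t k u h) =
      iterated_integral_from_1 k (\<lambda>_. lborel) (\<lambda>i s. {prev_time s i<..<t}) g"
    proof (rule iterated_integral_shift)
      fix u s :: "nat \<Rightarrow> real"
      assume u: "\<And>j. j \<in> {1..k} \<Longrightarrow> 0 < u j" "(\<Sum>j=1..k. u j) < t" and s: "\<And>j. j \<in> {1..k} \<Longrightarrow> s j = (\<Sum>l=1..j. u l)"
      have "gaussian_integral a b t k u h = cond_prob k s h" for h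
      proof -
        have js: "jumps 1 k u h = step_sum k s h"
        proof -
          have "{1..<1 + k} = {1..k}" by auto
          then show ?thesis
            using s by (auto simp: jumps_def step_sum_def fun_eq_iff intro!: sum.cong simp del: One_nat_def)
        qed
        have "gaussian_integral a b t k u h = surv_prob a 1 k u h t b"
          using u b_pos by (intro gaussian_integral_eq) auto
        also have "\<dots> = cond_prob k s h"
          unfolding surv_prob_def cond_prob_def
          using below_jumps_iff_rat[of _ t 1 k u h a b] unfolding js
          by (intro lint_cong refl) simp
        finally show ?thesis .
      qed
      then show "(LINT h|Pi\<^sub>M {1..k} (\<lambda>_. G). gaussian_integral a b t k u h) = g s"
        by (simp add: g_def heights)
    qed (use t_pos in auto)
    also have "\<dots> = (LINT s|lborel_on {1..k}. indicator (ordered_simplex t k) s * g s)"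
      by (rule integral_ordered_simplex[OF g_meas g_cong g_bound, symmetric])
    finally have it: "C * iterated_integral_from_1 k (\<lambda>_. lborel) (\<lambda>i u. {0..t - (\<Sum>j = 1..<i. u j)})
        (\<lambda>u. LINT h|Pi\<^sub>M {1..k} (\<lambda>_. G). gaussian_integral a b t k u h) =
       C * (LINT s|lborel_on {1..k}. indicator (ordered_simplex t k) s * g s)" by simp
    have se: "sets (lborel_on {1..k}) = sets (borel_on {1..k})"
      by (intro sets_PiM_cong) auto
    have "(LINT s|jump_times_law M N t k. g s) = (LINT s|density (lborel_on {1..k}) (\<lambda>s. ennreal (C / q * indicator (ordered_simplex t k) s)). g s)"
      unfolding poisson_jump_times_law(2)[OF prob_space_axioms N l t_pos] C_def q_def ..
    also have "\<dots> = (LINT s|lborel_on {1..k}. (C / q * indicator (ordered_simplex t k) s) *\<^sub>R g s)"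
    proof (rule integral_density)
      show "g \<in> borel_measurable (lborel_on {1..k})"
        using g_meas by (subst measurable_cong_sets[OF se refl])
      show "(\<lambda>s. C / q * indicator (ordered_simplex t k) s) \<in> borel_measurable (lborel_on {1..k})"
        by (subst measurable_cong_sets[OF se refl]) measurable
      show "AE s in lborel_on {1..k}. 0 \<le> C / q * indicator (ordered_simplex t k) s"
        using C q by (intro AE_I2 mult_nonneg_nonneg) auto
    qed
    also have "\<dots> = (LINT s|lborel_on {1..k}. C / q * (indicator (ordered_simplex t k) s * g s))"
      by (simp add: mult.assoc)
    also have "\<dots> = C / q * (LINT s|lborel_on {1..k}. indicator (ordered_simplex t k) s * g s)"
      by (rule integral_mult_right_zero)
    finally have "q * (LINT s|jump_times_law M N t k. g s) =
        C * (LINT s|lborel_on {1..k}. indicator (ordered_simplex t k) s * g s)"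
      using q by (simp only: times_divide_eq_left) simp
    then show ?thesis using it by (simp only: g_def q_def C_def)
  qed
  then show ?thesis using prob_no_crossing_sums by simp
qed

end

theorem theorem2p1:
  fixes M :: "'a measure"
    and B :: "real \<Rightarrow> 'a \<Rightarrow> real"
    and N :: "real \<Rightarrow> 'a \<Rightarrow> nat"
    and \<eta> :: "nat \<Rightarrow> 'a \<Rightarrow> real"
    and a b t :: real
  assumes "prob_space M"
    and "standard_brownian_motion M B"
    and "counting_process M N"
    and "\<forall>i\<ge>1. \<eta> i \<in> borel_measurable M"
    and "mutually_independent M B N \<eta>"
    and "t > 0" and "b > 0"
  shows
    "((\<forall>k. AE s in jump_times_law M N t k. s \<in> ordered_times t k) \<longrightarrow>
       (\<lambda>k. measure M {\<omega> \<in> space M. N t \<omega> = k} *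
             (LINT s:ordered_times t k|jump_times_law M N t k.
               (LINT h|jump_heights_law M \<eta> k.
                 gaussian_integral a b t k (waiting_time s) h)))
         sums measure M {\<omega> \<in> space M. (SUP s\<in>{0..<t}. jump_bm B N \<eta> s \<omega> - a * s - b) < 0})
     \<and>
     (\<forall>(l::real) (G::real measure).
       l > 0 \<and> poisson_process M l N \<and>
       prob_space.indep_vars M (\<lambda>_. borel) \<eta> {1..} \<and> (\<forall>i\<ge>1. distr M borel (\<eta> i) = G) \<longrightarrow>
       (\<lambda>k. l ^ k * exp (- l * t) *
             iterated_integral_from_1 k (\<lambda>_. lborel) (\<lambda>i u. {0..t - (\<Sum>j = 1..<i. u j)})
               (\<lambda>u. LINT h|Pi\<^sub>M {1..k} (\<lambda>_. G). gaussian_integral a b t k u h))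
         sums measure M {\<omega> \<in> space M. (SUP s\<in>{0..<t}. jump_bm B N \<eta> s \<omega> - a * s - b) < 0})"
proof (intro conjI impI allI)
  interpret jump_brownian M B N \<eta> a b t
    using assms by (intro jump_brownian.intro brownian.intro brownian_axioms.intro jump_brownian_axioms.intro)
  show "(\<lambda>k. measure M {\<omega> \<in> space M. N t \<omega> = k} *
             (LINT s:ordered_times t k|jump_times_law M N t k.
               (LINT h|jump_heights_law M \<eta> k.
                 gaussian_integral a b t k (waiting_time s) h)))
         sums measure M {\<omega> \<in> space M. (SUP s\<in>{0..<t}. jump_bm B N \<eta> s \<omega> - a * s - b) < 0}"
    if "\<forall>k. AE s in jump_times_law M N t k. s \<in> ordered_times t k"
    using that by (rule crossing_general)
  fix l G
  assume "l > 0 \<and> poisson_process M l N \<and>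
       prob_space.indep_vars M (\<lambda>_. borel) \<eta> {1..} \<and> (\<forall>i\<ge>1. distr M borel (\<eta> i) = G)"
  then show "(\<lambda>k. l ^ k * exp (- l * t) *
             iterated_integral_from_1 k (\<lambda>_. lborel) (\<lambda>i u. {0..t - (\<Sum>j = 1..<i. u j)})
               (\<lambda>u. LINT h|Pi\<^sub>M {1..k} (\<lambda>_. G). gaussian_integral a b t k u h))
         sums measure M {\<omega> \<in> space M. (SUP s\<in>{0..<t}. jump_bm B N \<eta> s \<omega> - a * s - b) < 0}"
    by (intro crossing_poisson) auto
qed

end
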